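(* Let $G$ be a connected and simply connected three-dimensional real affine Lie group, with Lie algebra $\mathfrak g$. Then: 1. $G$ is complete; 2. $G$ is a Novikov Lie group; 3. $G$ is radiant; 4. $G$ is associative if and only if $\mathfrak g$ is isomorphic to one of $\mathfrak g_{3,4}^{\alpha=-1}$, $\mathfrak g_{3,3}$, $\mathfrak g_{3,1}$, $2\mathfrak g_{2,1}\oplus\mathfrak g_1$, $3\mathfrak g_1$; 5. $G$ is bi-symmetric if and only if $\mathfrak g$ is isomorphic to one of $\mathfrak g_{3,4}^{\alpha=-1}$, $\mathfrak g_{3,3}$, $\mathfrak g_{3,1}$, $2\mathfrak g_{2,1}\oplus\mathfrak g_1$, $3\mathfrak g_1$.
   Context: An affine Lie group is a Lie group admitting a left-invariant affine structure, i.e. a left-invariant flat torsion-free connection. Left-invariant affine structures on $G$ with Lie algebra $\mathfrak g$ correspond one-to-one to bilinear products $X\cdot Y=\nabla_XY$ on $\mathfrak g$ with $X\cdot Y-Y\cdot X=[X,Y]$ and $[X,Y]\cdot Z=X\cdot(Y\cdot Z)-Y\cdot(X\cdot Z)$ for all $X,Y,Z$. For such a product put $R_X(Y)=Y\cdot X$ and $(X,Y,Z)=(X\cdot Y)\cdot Z-X\cdot(Y\cdot Z)$. The structure is: complete if $R_X$ is nilpotent for every $X$; Novikov if $R_XR_Y=R_YR_X$ for all $X,Y$; radiant if there is $\zeta\in\mathfrak g$ with $X\cdot\zeta=X$ for all $X$; associative if $(X,Y,Z)=0$ for all $X,Y,Z$; bi-symmetric if $(X,Y,Z)=(X,Z,Y)$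 for all $X,Y,Z$. The group $G$ is called complete (Novikov, radiant, associative, bi-symmetric) if it admits a left-invariant affine structure with that property. Lie algebras with basis $e_1,e_2,e_3$ (nonzero brackets): $3\mathfrak g_1$ abelian; $2\mathfrak g_{2,1}\oplus\mathfrak g_1$: $[e_1,e_2]=e_1$; $\mathfrak g_{3,1}$: $[e_1,e_2]=e_3$; $\mathfrak g_{3,3}$: $[e_1,e_3]=e_1,\ [e_2,e_3]=e_2$; $\mathfrak g_{3,4}^{\alpha=-1}$: $[e_1,e_3]=e_1,\ [e_2,e_3]=-e_2$. *)

theory Defs
  imports "HOL-Analysis.Analysis" "HOL-Library.Function_Algebras"
begin

text \<open>Pointwise real vector space structure on functions. It makes the operators
  \<open>('g \<Rightarrow> real) \<Rightarrow> ('g \<Rightarrow> real)\<close>, which represent vector fields below, a real vector space.\<close>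

instantiation "fun" :: (type, real_vector) real_vector
begin

definition scaleR_fun :: "real \<Rightarrow> ('a \<Rightarrow> 'b) \<Rightarrow> 'a \<Rightarrow> 'b"
  where "scaleR_fun r f = (\<lambda>x. r *\<^sub>R f x)"

instance
  by standard (auto simp: scaleR_fun_def fun_eq_iff scaleR_add_right scaleR_add_left)

end


section \<open>Smooth maps and Lie groups\<close>

primrec Ck_on :: "nat \<Rightarrow> 'a::real_normed_vector set \<Rightarrow> ('a \<Rightarrow> 'b::real_normed_vector) \<Rightarrow> bool"
  where
    "Ck_on 0 S f \<longleftrightarrow> continuous_on S f"
  | "Ck_on (Suc k) S f \<longleftrightarrow>
       (\<forall>x\<in>S. f differentiable (at x)) \<and> (\<forall>v. Ck_on k S (\<lambda>x. frechet_derivative f (at x) v))"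

text \<open>Only used for open \<open>S\<close> in a finite-dimensional space.\<close>

definition smooth_on :: "'a::real_normed_vector set \<Rightarrow> ('a \<Rightarrow> 'b::real_normed_vector) \<Rightarrow> bool"
  where "smooth_on S f \<longleftrightarrow> (\<forall>k. Ck_on k S f)"

text \<open>A chart is a pair of its domain \<open>U\<close> and a map \<open>\<phi>\<close>, which is only relevant on \<open>U\<close>.
  The dimension of the manifold is the dimension of the model space \<open>'m\<close>.\<close>

type_synonym ('g, 'm) chart = "'g set \<times> ('g \<Rightarrow> 'm)"
type_synonym ('g, 'm) atlas = "('g, 'm) chart set"

definition smooth_atlas ::
    "('g::{t2_space,second_countable_topology}, 'm::euclidean_space) atlas \<Rightarrow> bool"
  where "smooth_atlas A \<longleftrightarrow>
    (\<forall>(U, \<phi>)\<in>A. open U \<and> open (\<phi> ` U) \<and> homeomorphism U (\<phi> ` U) \<phi> (inv_into U \<phi>)) \<and>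
    (\<Union>(U, \<phi>)\<in>A. U) = UNIV \<and>
    (\<forall>(U, \<phi>)\<in>A. \<forall>(V, \<psi>)\<in>A. smooth_on (\<phi> ` (U \<inter> V)) (\<psi> \<circ> inv_into U \<phi>))"

text \<open>The class \<^class>\<open>group_add\<close> does not assume commutativity: \<open>x + y\<close>, \<open>- x\<close> and \<open>0\<close> are the
  product, the inverse and the neutral element of an arbitrary group. Continuity of the group
  operations, part of \<^class>\<open>topological_group_add\<close>, makes the domains of the coordinate
  expressions below open.\<close>

definition lie_group ::
    "('g::{topological_group_add,t2_space,second_countable_topology}, 'm::euclidean_space) atlas \<Rightarrow> bool"
  where "lie_group A \<longleftrightarrow>
    smooth_atlas A \<and>
    (\<forall>(U, \<phi>)\<in>A. \<forall>(V, \<psi>)\<in>A. \<forall>(W, \<theta>)\<in>A.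
       smooth_on {(x, y). x \<in> \<phi> ` U \<and> y \<in> \<psi> ` V \<and> inv_into U \<phi> x + inv_into V \<psi> y \<in> W}
         (\<lambda>(x, y). \<theta> (inv_into U \<phi> x + inv_into V \<psi> y))) \<and>
    (\<forall>(U, \<phi>)\<in>A. \<forall>(V, \<psi>)\<in>A.
       smooth_on {x \<in> \<phi> ` U. - inv_into U \<phi> x \<in> V} (\<lambda>x. \<psi> (- inv_into U \<phi> x)))"


section \<open>Vector fields and the Lie algebra\<close>

definition smooth_fun :: "('g, 'm::euclidean_space) atlas \<Rightarrow> ('g \<Rightarrow> real) \<Rightarrow> bool"
  where "smooth_fun A f \<longleftrightarrow> (\<forall>(U, \<phi>)\<in>A. smooth_on (\<phi> ` U) (f \<circ> inv_into U \<phi>))"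

text \<open>A smooth vector field is identified with its action on smooth functions. In a chart it is
  \<open>\<Sum>i. a\<^sub>i \<partial>/\<partial>x\<^sub>i\<close> with a smooth coefficient vector \<open>a\<close>, i.e. it maps \<open>f\<close> to the
  directional derivative of \<open>f\<close> along \<open>a\<close>. The value \<open>0\<close> at functions that are not smooth
  is a convention making this identification injective.\<close>

type_synonym 'g field = "('g \<Rightarrow> real) \<Rightarrow> ('g \<Rightarrow> real)"

definition vector_field :: "('g, 'm::euclidean_space) atlas \<Rightarrow> 'g field \<Rightarrow> bool"
  where "vector_field A X \<longleftrightarrow>
    (\<forall>(U, \<phi>)\<in>A. \<exists>a. smooth_on (\<phi> ` U) a \<and>
       (\<forall>f. smooth_fun A f \<longrightarrow> (\<forall>p\<in>U.
          X f p = frechet_derivative (f \<circ> inv_into U \<phi>) (at (\<phi> p)) (a (\<phi> p))))) \<and>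
    (\<forall>f. \<not> smooth_fun A f \<longrightarrow> X f = 0)"

definition lie_bracket :: "'g field \<Rightarrow> 'g field \<Rightarrow> 'g field"
  where "lie_bracket X Y = (\<lambda>f. X (Y f) - Y (X f))"

definition fmult :: "('g \<Rightarrow> real) \<Rightarrow> 'g field \<Rightarrow> 'g field"
  where "fmult f X = (\<lambda>h. f * X h)"

text \<open>Push-forward of a vector field along the left translation \<open>x \<mapsto> g + x\<close>.\<close>

definition left_push :: "'g::group_add \<Rightarrow> 'g field \<Rightarrow> 'g field"
  where "left_push g X = (\<lambda>f x. X (\<lambda>y. f (g + y)) (- g + x))"

definition lie_algebra :: "('g::group_add, 'm::euclidean_space) atlas \<Rightarrow> 'g field set"
  where "lie_algebra A = {X. vector_field A X \<and> (\<forall>g. left_push g X = X)}"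

text \<open>The bracket \<open>br\<close> is the one of a Lie algebra on the vector space \<open>'v\<close>.\<close>

definition lie_algebra_isomorphic ::
    "('g::group_add, 'm::euclidean_space) atlas \<Rightarrow> ('v::real_vector \<Rightarrow> 'v \<Rightarrow> 'v) \<Rightarrow> bool"
  where "lie_algebra_isomorphic A br \<longleftrightarrow>
    (\<exists>T :: 'v \<Rightarrow> 'g field. linear T \<and> bij_betw T UNIV (lie_algebra A) \<and>
       (\<forall>x y. T (br x y) = lie_bracket (T x) (T y)))"


section \<open>Left-invariant affine structures\<close>

type_synonym 'g connection = "'g field \<Rightarrow> 'g field \<Rightarrow> 'g field"

text \<open>\<open>nab X Y\<close> is the covariant derivative of \<open>Y\<close> along \<open>X\<close>; only its values at
  vector fields matter. Homogeneity over the reals is contained in the two rules for \<^const>\<open>fmult\<close>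
  (take \<open>f\<close> constant).\<close>

definition affine_connection :: "('g, 'm::euclidean_space) atlas \<Rightarrow> 'g connection \<Rightarrow> bool"
  where "affine_connection A nab \<longleftrightarrow>
    (\<forall>X Y. vector_field A X \<longrightarrow> vector_field A Y \<longrightarrow>
       vector_field A (nab X Y) \<and>
       (\<forall>Z. vector_field A Z \<longrightarrow>
          nab (X + Y) Z = nab X Z + nab Y Z \<and> nab Z (X + Y) = nab Z X + nab Z Y) \<and>
       (\<forall>f. smooth_fun A f \<longrightarrow>
          nab (fmult f X) Y = fmult f (nab X Y) \<and>
          nab X (fmult f Y) = fmult (X f) Y + fmult f (nab X Y)))"

definition torsion_free :: "('g, 'm::euclidean_space) atlas \<Rightarrow> 'g connection \<Rightarrow> bool"
  where "torsion_free A nab \<longleftrightarrow>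
    (\<forall>X Y. vector_field A X \<longrightarrow> vector_field A Y \<longrightarrow> nab X Y - nab Y X = lie_bracket X Y)"

definition flat :: "('g, 'm::euclidean_space) atlas \<Rightarrow> 'g connection \<Rightarrow> bool"
  where "flat A nab \<longleftrightarrow>
    (\<forall>X Y Z. vector_field A X \<longrightarrow> vector_field A Y \<longrightarrow> vector_field A Z \<longrightarrow>
       nab X (nab Y Z) - nab Y (nab X Z) = nab (lie_bracket X Y) Z)"

definition left_invariant :: "('g::group_add, 'm::euclidean_space) atlas \<Rightarrow> 'g connection \<Rightarrow> bool"
  where "left_invariant A nab \<longleftrightarrow>
    (\<forall>g X Y. vector_field A X \<longrightarrow> vector_field A Y \<longrightarrow>
       nab (left_push g X) (left_push g Y) = left_push g (nab X Y))"

definition left_invariant_affine_structure ::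
    "('g::group_add, 'm::euclidean_space) atlas \<Rightarrow> 'g connection \<Rightarrow> bool"
  where "left_invariant_affine_structure A nab \<longleftrightarrow>
    affine_connection A nab \<and> left_invariant A nab \<and> flat A nab \<and> torsion_free A nab"

definition affine_lie_group :: "('g::group_add, 'm::euclidean_space) atlas \<Rightarrow> bool"
  where "affine_lie_group A \<longleftrightarrow> (\<exists>nab. left_invariant_affine_structure A nab)"

text \<open>The product on the Lie algebra is \<open>X \<cdot> Y = nab X Y\<close> for left-invariant \<open>X\<close> and \<open>Y\<close>;
  the right multiplication by \<open>X\<close> is \<open>\<lambda>Y. nab Y X\<close>.\<close>

definition associator :: "'g connection \<Rightarrow> 'g field \<Rightarrow> 'g field \<Rightarrow> 'g field \<Rightarrow> 'g field"
  where "associator nab X Y Z = nab (nab X Y) Z - nab X (nab Y Z)"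

definition complete_structure :: "('g::group_add, 'm::euclidean_space) atlas \<Rightarrow> 'g connection \<Rightarrow> bool"
  where "complete_structure A nab \<longleftrightarrow>
    (\<forall>X\<in>lie_algebra A. \<exists>n. \<forall>Y\<in>lie_algebra A. ((\<lambda>Y. nab Y X) ^^ n) Y = 0)"

definition novikov_structure :: "('g::group_add, 'm::euclidean_space) atlas \<Rightarrow> 'g connection \<Rightarrow> bool"
  where "novikov_structure A nab \<longleftrightarrow>
    (\<forall>X\<in>lie_algebra A. \<forall>Y\<in>lie_algebra A. \<forall>Z\<in>lie_algebra A.
       nab (nab Z Y) X = nab (nab Z X) Y)"

definition radiant_structure :: "('g::group_add, 'm::euclidean_space) atlas \<Rightarrow> 'g connection \<Rightarrow> bool"
  where "radiant_structure A nab \<longleftrightarrow>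
    (\<exists>\<zeta>\<in>lie_algebra A. \<forall>X\<in>lie_algebra A. nab X \<zeta> = X)"

definition associative_structure :: "('g::group_add, 'm::euclidean_space) atlas \<Rightarrow> 'g connection \<Rightarrow> bool"
  where "associative_structure A nab \<longleftrightarrow>
    (\<forall>X\<in>lie_algebra A. \<forall>Y\<in>lie_algebra A. \<forall>Z\<in>lie_algebra A. associator nab X Y Z = 0)"

definition bisymmetric_structure :: "('g::group_add, 'm::euclidean_space) atlas \<Rightarrow> 'g connection \<Rightarrow> bool"
  where "bisymmetric_structure A nab \<longleftrightarrow>
    (\<forall>X\<in>lie_algebra A. \<forall>Y\<in>lie_algebra A. \<forall>Z\<in>lie_algebra A.
       associator nab X Y Z = associator nab X Z Y)"

definition complete_lie_group :: "('g::group_add, 'm::euclidean_space) atlas \<Rightarrow> bool"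
  where "complete_lie_group A \<longleftrightarrow>
    (\<exists>nab. left_invariant_affine_structure A nab \<and> complete_structure A nab)"

definition novikov_lie_group :: "('g::group_add, 'm::euclidean_space) atlas \<Rightarrow> bool"
  where "novikov_lie_group A \<longleftrightarrow>
    (\<exists>nab. left_invariant_affine_structure A nab \<and> novikov_structure A nab)"

definition radiant_lie_group :: "('g::group_add, 'm::euclidean_space) atlas \<Rightarrow> bool"
  where "radiant_lie_group A \<longleftrightarrow>
    (\<exists>nab. left_invariant_affine_structure A nab \<and> radiant_structure A nab)"

definition associative_lie_group :: "('g::group_add, 'm::euclidean_space) atlas \<Rightarrow> bool"
  where "associative_lie_group A \<longleftrightarrow>
    (\<exists>nab. left_invariant_affine_structure A nab \<and> associative_structure A nab)"

definition bisymmetric_lie_group :: "('g::group_add, 'm::euclidean_space) atlas \<Rightarrow> bool"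
  where "bisymmetric_lie_group A \<longleftrightarrow>
    (\<exists>nab. left_invariant_affine_structure A nab \<and> bisymmetric_structure A nab)"


section \<open>Three-dimensional Lie algebras\<close>

abbreviation "e1 \<equiv> axis 1 1 :: real ^ 3"
abbreviation "e2 \<equiv> axis 2 1 :: real ^ 3"
abbreviation "e3 \<equiv> axis 3 1 :: real ^ 3"

text \<open>The alternating bilinear map with \<open>[e1, e2] = c12\<close>, \<open>[e1, e3] = c13\<close>, \<open>[e2, e3] = c23\<close>.\<close>

definition bracket3 :: "real ^ 3 \<Rightarrow> real ^ 3 \<Rightarrow> real ^ 3 \<Rightarrow> real ^ 3 \<Rightarrow> real ^ 3 \<Rightarrow> real ^ 3"
  where "bracket3 c12 c13 c23 x y =
    (x $ 1 * y $ 2 - x $ 2 * y $ 1) *\<^sub>R c12 +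
    (x $ 1 * y $ 3 - x $ 3 * y $ 1) *\<^sub>R c13 +
    (x $ 2 * y $ 3 - x $ 3 * y $ 2) *\<^sub>R c23"

text \<open>In order: \<open>3\<gg>\<^sub>1\<close>, \<open>2\<gg>\<^sub>2\<^sub>,\<^sub>1 \<oplus> \<gg>\<^sub>1\<close>, \<open>\<gg>\<^sub>3\<^sub>,\<^sub>1\<close>, \<open>\<gg>\<^sub>3\<^sub>,\<^sub>3\<close> and \<open>\<gg>\<^sub>3\<^sub>,\<^sub>4\<close> with \<open>\<alpha> = -1\<close>.\<close>

definition br_3g1 :: "real ^ 3 \<Rightarrow> real ^ 3 \<Rightarrow> real ^ 3"
  where "br_3g1 = bracket3 0 0 0"

definition br_2g21_g1 :: "real ^ 3 \<Rightarrow> real ^ 3 \<Rightarrow> real ^ 3"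
  where "br_2g21_g1 = bracket3 e1 0 0"

definition br_g31 :: "real ^ 3 \<Rightarrow> real ^ 3 \<Rightarrow> real ^ 3"
  where "br_g31 = bracket3 e3 0 0"

definition br_g33 :: "real ^ 3 \<Rightarrow> real ^ 3 \<Rightarrow> real ^ 3"
  where "br_g33 = bracket3 0 e1 e2"

definition br_g34m1 :: "real ^ 3 \<Rightarrow> real ^ 3 \<Rightarrow> real ^ 3"
  where "br_g34m1 = bracket3 0 e1 (- e2)"

end

theory Submission
  imports Defs
begin

text \<open>Left-invariant vector fields form a frame, so vector fields correspond to smooth functions into
  the model space, and left-invariant affine structures to left-symmetric products on the Lie algebra.
  In dimension three a left-symmetric product forces a two-dimensional abelian ideal: otherwise the
  bracket is simple, and a Casimir element acts by a right multiplication, whose trace vanishes because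
  the algebra is perfect; a trace form argument then makes the representation by left multiplications
  trivial. So the Lie algebra is a semidirect product of the plane with a line acting by \<open>\<delta>\<close>, with
  \<open>a\<close> spanning the line. The product \<open>a \<cdot> x = \<delta> x\<close> (all others zero) is complete and Novikov, and
  \<open>a \<cdot> a = a\<close>, \<open>a \<cdot> x = \<delta> x + x\<close>, \<open>x \<cdot> a = x\<close> is radiant. A bi-symmetric
  product with \<open>\<delta>\<close> invertible satisfies \<open>\<delta>\<^sup>2 = c\<^sup>2\<close> with \<open>c \<noteq> 0\<close>; this and the singular \<open>\<delta>\<close> give
  exactly the listed algebras, each of which carries an explicit associative product.\<close>

section \<open>Calculus of \<open>C\<^sup>k\<close> maps\<close>

text \<open>Vector fields are operators on globally defined smooth functions, so their chart
  coefficients can only be recovered if such functions take prescribed differentials at a point;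
  this is what the flat exponential function and extension by zero provide. Translating these test
  functions around the group reads off the coordinates of any field in the left-invariant frame, and
  smoothness of the coordinates comes from smoothness of the group operations in two variables. In
  the algebra there is no passage to complex scalars: the simple brackets, compact or not, are
  diagonalized together by maximizing a real quadratic form, and the signs of three constants tell
  the two real forms apart. The two equivalences are closed as one cycle: listed, associative,
  bi-symmetric, listed.\<close>

lemma Ck_on_cong:
  assumes "open S" "\<And>x. x \<in> S \<Longrightarrow> f x = g x" "Ck_on k S f"
  shows "Ck_on k S g"
  using assms(2,3)
proof (induction k arbitrary: f g)
  case 0
  then show ?case using continuous_on_cong[of S S f g] by simp
next
  case (Suc k)
  have g: "g differentiable (at x)" if "x \<in> S" for x
    using Suc.prems that assms(1) has_derivative_transform_within_open
    unfolding differentiable_def Ck_on.simps by metis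
  have "frechet_derivative f (at x) = frechet_derivative g (at x)" if "x \<in> S" for x
    using Suc.prems that frechet_derivative_transform_within_open[OF _ assms(1) that, of f g]
    by auto
  then have "Ck_on k S (\<lambda>x. frechet_derivative g (at x) v)" for v
    using Suc.IH[of "\<lambda>x. frechet_derivative f (at x) v" "\<lambda>x. frechet_derivative g (at x) v"]
      Suc.prems by auto
  then show ?case using g by simp
qed

lemma Ck_on_subset: "Ck_on k S f \<Longrightarrow> T \<subseteq> S \<Longrightarrow> Ck_on k T f"
  by (induction k arbitrary: f) (auto intro: continuous_on_subset)

lemma Ck_on_local:
  assumes "\<And>x. x \<in> S \<Longrightarrow> \<exists>T. open T \<and> x \<in> T \<and> Ck_on k T f"
  shows "Ck_on k S f"
  using assms
proof (induction k arbitrary: f)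
  case 0
  have "isCont f x" if "x \<in> S" for x
    using 0[OF that] by (auto simp: continuous_on_eq_continuous_at)
  then show ?case by (simp add: continuous_at_imp_continuous_on)
next
  case (Suc k)
  have "f differentiable (at x)" if "x \<in> S" for x
    using Suc.prems[OF that] by auto
  moreover have "Ck_on k S (\<lambda>x. frechet_derivative f (at x) v)" for v
    by (rule Suc.IH) (use Suc.prems in fastforce)
  ultimately show ?case by simp
qed

lemma Ck_on_SucD: "Ck_on (Suc k) S f \<Longrightarrow> Ck_on k S f"
proof (induction k arbitrary: f)
  case 0
  then show ?case
    by (auto intro!: continuous_at_imp_continuous_on differentiable_imp_continuous_within)
next
  case (Suc k)
  then show ?case by (metis Ck_on.simps(2))
qed

lemma Ck_on_Suc_has_derivative:
  "Ck_on (Suc k) S f \<Longrightarrow> x \<in> S \<Longrightarrow> (f has_derivative frechet_derivative f (at x)) (at x)"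
  using frechet_derivative_works by auto

lemma Ck_on_const: "Ck_on k S (\<lambda>x. c)"
  by (induction k arbitrary: c) auto

lemma Ck_on_bounded_linear_compose:
  assumes l: "bounded_linear l" and "open S" "Ck_on k S f"
  shows "Ck_on k S (\<lambda>x. l (f x))"
  using assms(3)
proof (induction k arbitrary: f)
  case 0
  then show ?case
    using bounded_linear.continuous_on[OF l] by simp
next
  case (Suc k)
  have d: "((\<lambda>x. l (f x)) has_derivative (\<lambda>v. l (frechet_derivative f (at x) v))) (at x)" if "x \<in> S" for x
    by (rule bounded_linear.has_derivative[OF l Ck_on_Suc_has_derivative[OF Suc.prems that]])
  have "Ck_on k S (\<lambda>x. frechet_derivative (\<lambda>x. l (f x)) (at x) v)" for v
    using Ck_on_cong[OF assms(2) _ Suc.IH[of "\<lambda>x. frechet_derivative f (at x) v"]]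
      frechet_derivative_at[OF d, symmetric] Suc.prems by (simp add: fun_eq_iff)
  then show ?case using d unfolding Ck_on.simps differentiable_def by blast
qed

lemma Ck_on_bounded_linear: "bounded_linear l \<Longrightarrow> Ck_on k S l"
proof (cases k)
  case (Suc j)
  assume l: "bounded_linear l"
  then have "frechet_derivative l (at x) = l" for x
    using bounded_linear_imp_has_derivative frechet_derivative_at by metis
  then show ?thesis
    using l Suc bounded_linear_imp_differentiable by (auto simp: Ck_on_const)
qed (simp add: linear_continuous_on)

lemma Ck_on_add:
  assumes "open S" "Ck_on k S f" "Ck_on k S g"
  shows "Ck_on k S (\<lambda>x. f x + g x)"
  using assms(2,3)
proof (induction k arbitrary: f g)
  case 0
  then show ?case by (auto intro: continuous_intros)
next
  case (Suc k)
  have d: "((\<lambda>x. f x + g x) has_derivative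
      (\<lambda>v. frechet_derivative f (at x) v + frechet_derivative g (at x) v)) (at x)" if "x \<in> S" for x
    by (intro has_derivative_add Ck_on_Suc_has_derivative[OF Suc.prems(1) that]
        Ck_on_Suc_has_derivative[OF Suc.prems(2) that])
  have "Ck_on k S (\<lambda>x. frechet_derivative (\<lambda>x. f x + g x) (at x) v)" for v
    using Ck_on_cong[OF assms(1) _ Suc.IH[of "\<lambda>x. frechet_derivative f (at x) v" "\<lambda>x. frechet_derivative g (at x) v"]]
      frechet_derivative_at[OF d, symmetric] Suc.prems by (simp add: fun_eq_iff)
  then show ?case using d unfolding Ck_on.simps differentiable_def by blast
qed

lemma Ck_on_scaleR:
  assumes "open S" "Ck_on k S f" "Ck_on k S g"
  shows "Ck_on k S (\<lambda>x. f x *\<^sub>R g x)"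
  using assms(2,3)
proof (induction k arbitrary: f g)
  case 0
  then show ?case by (auto intro: continuous_intros)
next
  case (Suc k)
  have d: "((\<lambda>x. f x *\<^sub>R g x) has_derivative
      (\<lambda>v. f x *\<^sub>R frechet_derivative g (at x) v + frechet_derivative f (at x) v *\<^sub>R g x)) (at x)"
    if "x \<in> S" for x
    by (intro has_derivative_scaleR Ck_on_Suc_has_derivative[OF Suc.prems(1) that]
        Ck_on_Suc_has_derivative[OF Suc.prems(2) that])
  have "Ck_on k S (\<lambda>x. f x *\<^sub>R frechet_derivative g (at x) v + frechet_derivative f (at x) v *\<^sub>R g x)" for v
    using Suc.prems Ck_on_SucD[OF Suc.prems(1)] Ck_on_SucD[OF Suc.prems(2)]
    by (intro Ck_on_add assms(1) Suc.IH) auto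
  then have "Ck_on k S (\<lambda>x. frechet_derivative (\<lambda>x. f x *\<^sub>R g x) (at x) v)" for v
    by (rule Ck_on_cong[OF assms(1), rotated]) (simp add: frechet_derivative_at[OF d, symmetric])
  then show ?case using d unfolding Ck_on.simps differentiable_def by blast
qed

lemma Ck_on_sum:
  assumes "open S" "\<And>i. i \<in> I \<Longrightarrow> Ck_on k S (f i)"
  shows "Ck_on k S (\<lambda>x. \<Sum>i\<in>I. f i x)"
  using assms(2)
  by (induction I rule: infinite_finite_induct) (auto intro: Ck_on_const Ck_on_add[OF assms(1)])

lemma linear_basis_expansion:
  fixes l :: "'a::euclidean_space \<Rightarrow> 'b::real_vector"
  assumes "linear l"
  shows "l v = (\<Sum>i\<in>Basis. (v \<bullet> i) *\<^sub>R l i)"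
  by (metis (no_types, lifting) assms euclidean_representation linear_scale linear_sum sum.cong)

text \<open>Chain rule in coordinates: expanding the inner derivative in \<open>Basis\<close> makes
  the derivative of the composition a finite sum of products, in which only derivatives of
  \<open>g\<close> are composed with \<open>f\<close>. This is why the induction generalizes over
  \<open>g\<close> and keeps \<open>f\<close> fixed.\<close>

lemma Ck_on_compose:
  fixes f :: "'a::real_normed_vector \<Rightarrow> 'b::euclidean_space"
  assumes "open S" "open T" "f ` S \<subseteq> T" "Ck_on k S f" "Ck_on k T g"
  shows "Ck_on k S (\<lambda>x. g (f x))"
  using assms(4,5)
proof (induction k arbitrary: g)
  case 0
  then show ?case
    using continuous_on_compose2 assms(3) by auto
next
  case (Suc k)
  have fg: "f differentiable (at x)" "g differentiable (at (f x))" if "x \<in> S" for x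
    using Suc.prems that assms(3) by auto
  have d: "((\<lambda>x. g (f x)) has_derivative
      (\<lambda>v. frechet_derivative g (at (f x)) (frechet_derivative f (at x) v))) (at x)" if "x \<in> S" for x
    using diff_chain_at[of f _ x g] fg[OF that, unfolded frechet_derivative_works]
    by (simp add: o_def)
  have e: "frechet_derivative (\<lambda>x. g (f x)) (at x) v =
      (\<Sum>i\<in>Basis. (frechet_derivative f (at x) v \<bullet> i) *\<^sub>R frechet_derivative g (at (f x)) i)" if "x \<in> S" for x v
    unfolding frechet_derivative_at[OF d[OF that], symmetric]
    by (rule linear_basis_expansion[OF linear_frechet_derivative[OF fg(2)[OF that]]])
  have "Ck_on k S (\<lambda>x. \<Sum>i\<in>Basis. (frechet_derivative f (at x) v \<bullet> i) *\<^sub>R frechet_derivative g (at (f x)) i)" for v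
    using Suc.prems Ck_on_SucD[OF Suc.prems(1)]
    by (intro Ck_on_sum Ck_on_scaleR assms(1) Suc.IH
        Ck_on_bounded_linear_compose[OF bounded_linear_inner_left]) auto
  then have "Ck_on k S (\<lambda>x. frechet_derivative (\<lambda>x. g (f x)) (at x) v)" for v
    by (rule Ck_on_cong[OF assms(1), rotated]) (simp add: e)
  then show ?case using d unfolding Ck_on.simps differentiable_def by blast
qed

lemma smooth_on_cong: "open S \<Longrightarrow> (\<And>x. x \<in> S \<Longrightarrow> f x = g x) \<Longrightarrow> smooth_on S f \<Longrightarrow> smooth_on S g"
  unfolding smooth_on_def using Ck_on_cong by blast

lemma smooth_on_subset: "smooth_on S f \<Longrightarrow> T \<subseteq> S \<Longrightarrow> smooth_on T f"
  unfolding smooth_on_def using Ck_on_subset by blast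

lemma smooth_on_local:
  assumes "\<And>x. x \<in> S \<Longrightarrow> \<exists>T. open T \<and> x \<in> T \<and> smooth_on T f"
  shows "smooth_on S f"
  unfolding smooth_on_def using Ck_on_local assms unfolding smooth_on_def by metis

lemma smooth_on_const: "smooth_on S (\<lambda>x. c)"
  by (simp add: smooth_on_def Ck_on_const)

lemma smooth_on_bounded_linear: "bounded_linear l \<Longrightarrow> smooth_on S l"
  by (simp add: smooth_on_def Ck_on_bounded_linear)

lemma smooth_on_bounded_linear_compose:
  "bounded_linear l \<Longrightarrow> open S \<Longrightarrow> smooth_on S f \<Longrightarrow> smooth_on S (\<lambda>x. l (f x))"
  by (simp add: smooth_on_def Ck_on_bounded_linear_compose)

lemma smooth_on_add:
  "open S \<Longrightarrow> smooth_on S f \<Longrightarrow> smooth_on S g \<Longrightarrow> smooth_on S (\<lambda>x. f x + g x)"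
  by (simp add: smooth_on_def Ck_on_add)

lemma smooth_on_scaleR:
  "open S \<Longrightarrow> smooth_on S f \<Longrightarrow> smooth_on S g \<Longrightarrow> smooth_on S (\<lambda>x. f x *\<^sub>R g x)"
  by (simp add: smooth_on_def Ck_on_scaleR)

lemma smooth_on_sum:
  "open S \<Longrightarrow> (\<And>i. i \<in> I \<Longrightarrow> smooth_on S (f i)) \<Longrightarrow> smooth_on S (\<lambda>x. \<Sum>i\<in>I. f i x)"
  by (simp add: smooth_on_def Ck_on_sum)

lemma smooth_on_compose:
  fixes f :: "'a::real_normed_vector \<Rightarrow> 'b::euclidean_space"
  assumes "open S" "open T" "f ` S \<subseteq> T" "smooth_on S f" "smooth_on T g"
  shows "smooth_on S (\<lambda>x. g (f x))"
  using assms Ck_on_compose unfolding smooth_on_def by blast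

lemma smooth_on_Pair:
  assumes "open S" "smooth_on S f" "smooth_on S g"
  shows "smooth_on S (\<lambda>x. (f x, g x))"
proof -
  have "bounded_linear (\<lambda>a::'b. (a, 0::'c))" "bounded_linear (\<lambda>b::'c. (0::'b, b))"
    by (auto intro!: bounded_linear_Pair bounded_linear_ident bounded_linear_zero)
  from smooth_on_add[OF assms(1) smooth_on_bounded_linear_compose[OF this(1) assms(1,2)]
      smooth_on_bounded_linear_compose[OF this(2) assms(1,3)]]
  show ?thesis by simp
qed

lemma smooth_on_imp_continuous_on: "smooth_on S f \<Longrightarrow> continuous_on S f"
  unfolding smooth_on_def using Ck_on.simps(1) by blast

lemma smooth_on_imp_differentiable: "smooth_on S f \<Longrightarrow> x \<in> S \<Longrightarrow> f differentiable (at x)"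
  unfolding smooth_on_def using Ck_on.simps(2) by blast

lemma smooth_on_frechet_derivative: "smooth_on S f \<Longrightarrow> smooth_on S (\<lambda>x. frechet_derivative f (at x) v)"
  unfolding smooth_on_def using Ck_on.simps(2) by blast

lemma smooth_on_frechet_derivative_along:
  fixes f :: "'a::euclidean_space \<Rightarrow> 'b::real_normed_vector"
  assumes S: "open S" and f: "smooth_on S f" and a: "smooth_on S a"
  shows "smooth_on S (\<lambda>x. frechet_derivative f (at x) (a x))"
proof -
  have "smooth_on S (\<lambda>x. \<Sum>i\<in>Basis. (a x \<bullet> i) *\<^sub>R frechet_derivative f (at x) i)"
    by (intro smooth_on_sum smooth_on_scaleR S smooth_on_frechet_derivative f
        smooth_on_bounded_linear_compose[OF bounded_linear_inner_left] a)
  then show ?thesis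
    by (rule smooth_on_cong[OF S, rotated])
      (rule linear_basis_expansion[symmetric],
        rule linear_frechet_derivative[OF smooth_on_imp_differentiable[OF f]])
qed

section \<open>Smoothness of the flat exponential function\<close>

lemma smooth_on_real_derivI:
  fixes g :: "nat \<Rightarrow> real \<Rightarrow> real"
  assumes d: "\<And>n x. (g n has_real_derivative a n * g (n + 1) x + b n * g (n + 2) x) (at x)"
  shows "smooth_on UNIV (g n)"
proof -
  have *: "Ck_on k UNIV (g n)" for k n
  proof (induction k arbitrary: n)
    case 0
    show ?case using DERIV_isCont d continuous_at_imp_continuous_on by (metis Ck_on.simps(1))
  next
    case (Suc k)
    have "frechet_derivative (g n) (at x) v = (v * a n) *\<^sub>R g (n + 1) x + (v * b n) *\<^sub>R g (n + 2) x" for x v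
      using frechet_derivative_at[OF d[of n x, unfolded has_field_derivative_def], symmetric]
      by (simp add: algebra_simps)
    moreover have "Ck_on k UNIV (\<lambda>x. (v * a n) *\<^sub>R g (n + 1) x + (v * b n) *\<^sub>R g (n + 2) x)" for v
      by (intro Ck_on_add Ck_on_scaleR Ck_on_const Suc.IH open_UNIV)
    moreover have "g n differentiable (at x)" for x
      using d[of n x] unfolding has_field_derivative_def differentiable_def by blast
    ultimately show ?case by simp
  qed
  then show ?thesis by (simp add: smooth_on_def)
qed

text \<open>For \<open>n = 0\<close> this is the classical smooth function that is flat at 0. The
  powers of \<open>t\<close> in the denominator close the family under differentiation: the
  derivative of member \<open>n\<close> combines members \<open>n + 1\<close> and
  \<open>n + 2\<close>, the shape required by \<open>smooth_on_real_derivI\<close>.\<close>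

definition flat_exp :: "nat \<Rightarrow> real \<Rightarrow> real"
  where "flat_exp n t = (if t > 0 then exp (- inverse t) / t ^ n else 0)"

lemma flat_exp_tendsto_0: "((\<lambda>t. exp (- inverse t) / t ^ n) \<longlongrightarrow> 0) (at_right (0::real))"
proof -
  have "((\<lambda>x::real. x ^ n * exp (- x)) \<longlongrightarrow> 0) at_top"
    using tendsto_power_div_exp_0[of n] by (simp add: exp_minus field_simps)
  then have "((\<lambda>t::real. inverse t ^ n * exp (- inverse t)) \<longlongrightarrow> 0) (at_right 0)"
    using filterlim_compose filterlim_inverse_at_top_right by blast
  then show ?thesis by (simp add: field_simps)
qed

lemma flat_exp_deriv:
  "(flat_exp n has_real_derivative - real n * flat_exp (n + 1) x + 1 * flat_exp (n + 2) x) (at x)"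
proof -
  consider "x > 0" | "x < 0" | "x = 0" by linarith
  then show ?thesis
  proof cases
    case 1
    have "((\<lambda>t. exp (- inverse t) / t ^ n) has_real_derivative
       - real n * flat_exp (n + 1) x + 1 * flat_exp (n + 2) x) (at x)"
    proof -
      \<comment> \<open>Truncated subtraction: for \<open>n = 0\<close> the exponent
        \<open>n - 1\<close> is again 0, but the factor \<open>real n\<close> kills both
        sides.\<close>
      have p: "real n * x ^ (n - 1) = real n * x ^ n / x"
        using 1 by (cases n) auto
      show ?thesis
        by (rule derivative_eq_intros refl | use 1 in force)+
          (use 1 p in \<open>auto simp: flat_exp_def field_simps power2_eq_square\<close>)
    qed
    then show ?thesis
      by (rule has_field_derivative_transform_within_open[of _ _ _ "{0<..}"])
        (use 1 in \<open>auto simp: flat_exp_def\<close>)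
  next
    case 2
    have "((\<lambda>t. 0) has_real_derivative
       - real n * flat_exp (n + 1) x + 1 * flat_exp (n + 2) x) (at x)"
      using 2 by (simp add: flat_exp_def)
    then show ?thesis
      by (rule has_field_derivative_transform_within_open[of _ _ _ "{..<0}"])
        (use 2 in \<open>auto simp: flat_exp_def\<close>)
  next
    case 3
    \<comment> \<open>To the right of 0 the difference quotient is member \<open>n + 1\<close>
      itself, to the left it is 0.\<close>
    have "((\<lambda>t. (flat_exp n t - flat_exp n 0) / (t - 0)) \<longlongrightarrow> 0) (at 0)"
    proof (rule filterlim_split_at)
      show "((\<lambda>t. (flat_exp n t - flat_exp n 0) / (t - 0)) \<longlongrightarrow> 0) (at_left 0)"
        by (rule tendsto_eventually) (auto simp: flat_exp_def eventually_at_filter)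
      show "((\<lambda>t. (flat_exp n t - flat_exp n 0) / (t - 0)) \<longlongrightarrow> 0) (at_right 0)"
        by (rule Lim_transform_eventually[OF flat_exp_tendsto_0[of "n + 1"]])
          (auto simp: flat_exp_def eventually_at_filter field_simps)
    qed
    then show ?thesis
      using 3 by (simp add: has_field_derivative_iff flat_exp_def)
  qed
qed

lemma smooth_on_flat_exp: "smooth_on UNIV (flat_exp n)"
  using smooth_on_real_derivI[of flat_exp "\<lambda>n. - real n" "\<lambda>n. 1", OF flat_exp_deriv] .

text \<open>A partial derivative in the second variable is the total derivative of \<open>H\<close>
  in the directions \<open>(0, i)\<close>, hence smooth in the base point. It is applied with
  \<open>H\<close> a coordinate expression built from the group operations.\<close>

lemma smooth_on_partial_derivative:
  fixes H :: "'a::euclidean_space \<times> 'b::euclidean_space \<Rightarrow> 'c::real_normed_vector"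
    and s :: "'d::real_normed_vector \<Rightarrow> 'a"
  assumes Q: "open Q" and H: "smooth_on Q H" and S: "open S"
    and s: "smooth_on S s" and t: "smooth_on S t" and a: "smooth_on S a"
    and st: "\<And>x. x \<in> S \<Longrightarrow> (s x, t x) \<in> Q"
  shows "smooth_on S (\<lambda>x. frechet_derivative (\<lambda>y. H (s x, y)) (at (t x)) (a x))"
proof -
  have "smooth_on S (\<lambda>x. \<Sum>i\<in>Basis. (a x \<bullet> i) *\<^sub>R frechet_derivative H (at (s x, t x)) (0, i))"
    by (intro smooth_on_sum smooth_on_scaleR S a smooth_on_bounded_linear_compose[OF bounded_linear_inner_left]
        smooth_on_compose[where f = "\<lambda>x. (s x, t x)", OF S Q _ smooth_on_Pair[OF S s t]]
        smooth_on_frechet_derivative H) (use st in auto)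
  moreover have "(\<Sum>i\<in>Basis. (a x \<bullet> i) *\<^sub>R frechet_derivative H (at (s x, t x)) (0, i)) =
      frechet_derivative (\<lambda>y. H (s x, y)) (at (t x)) (a x)" if x: "x \<in> S" for x
  proof -
    let ?D = "frechet_derivative H (at (s x, t x))"
    have d: "(H has_derivative ?D) (at (s x, t x))"
      using smooth_on_imp_differentiable[OF H st[OF x]] frechet_derivative_works by blast
    have "((\<lambda>y. (s x, y)) has_derivative (\<lambda>w. (0, w))) (at (t x))"
      by (auto intro!: derivative_eq_intros)
    from diff_chain_at[OF this d] have d2: "((\<lambda>y. H (s x, y)) has_derivative (\<lambda>w. ?D (0, w))) (at (t x))"
      by (simp add: o_def)
    then have "linear (\<lambda>w. ?D (0, w))"
      by (simp add: has_derivative_linear)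
    from linear_basis_expansion[OF this, symmetric] frechet_derivative_at[OF d2, symmetric]
    show ?thesis by simp
  qed
  ultimately show ?thesis
    by (rule smooth_on_cong[OF S, rotated])
qed

section \<open>Smooth maps into a Lie group\<close>

text \<open>Domains lie in Euclidean spaces, which suffices because every parameter below ranges
  over a chart image or a product of two of them. No manifold structure on the product of the group
  with itself has to be set up.\<close>

definition smooth_map :: "('g::topological_space, 'm::euclidean_space) atlas \<Rightarrow>
    'a::euclidean_space set \<Rightarrow> ('a \<Rightarrow> 'g) \<Rightarrow> bool"
  where "smooth_map A P F \<longleftrightarrow>
    continuous_on P F \<and> (\<forall>(W, \<theta>)\<in>A. smooth_on {x\<in>P. F x \<in> W} (\<lambda>x. \<theta> (F x)))"

lemma open_Collect_mem_preimage:
  "open P \<Longrightarrow> continuous_on P F \<Longrightarrow> open W \<Longrightarrow> open {x\<in>P. F x \<in> W}"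
  using continuous_open_preimage[of P F W] by (simp add: vimage_def Int_def)

locale lie_grp =
  fixes A :: "('g::{topological_group_add,t2_space,second_countable_topology}, 'm::euclidean_space) atlas"
  assumes lie: "lie_group A"
begin

lemma chart:
  assumes "(U, \<phi>) \<in> A"
  shows chart_open: "open U" and chart_image_open: "open (\<phi> ` U)"
    and chart_continuous: "continuous_on U \<phi>"
    and chart_inv_continuous: "continuous_on (\<phi> ` U) (inv_into U \<phi>)"
    and chart_inv_left: "\<And>p. p \<in> U \<Longrightarrow> inv_into U \<phi> (\<phi> p) = p"
    and chart_inv_right: "\<And>x. x \<in> \<phi> ` U \<Longrightarrow> \<phi> (inv_into U \<phi> x) = x"
    and chart_inv_mem: "\<And>x. x \<in> \<phi> ` U \<Longrightarrow> inv_into U \<phi> x \<in> U"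
proof -
  have "open U \<and> open (\<phi> ` U) \<and> homeomorphism U (\<phi> ` U) \<phi> (inv_into U \<phi>)"
    using lie assms unfolding lie_group_def smooth_atlas_def by auto
  then show "open U" "open (\<phi> ` U)" "continuous_on U \<phi>" "continuous_on (\<phi> ` U) (inv_into U \<phi>)"
    "\<And>p. p \<in> U \<Longrightarrow> inv_into U \<phi> (\<phi> p) = p"
    by (auto simp: homeomorphism_def)
  show "\<And>x. x \<in> \<phi> ` U \<Longrightarrow> \<phi> (inv_into U \<phi> x) = x" "\<And>x. x \<in> \<phi> ` U \<Longrightarrow> inv_into U \<phi> x \<in> U"
    by (auto simp: f_inv_into_f inv_into_into)
qed

lemma chart_exists:
  obtains U \<phi> where "(U, \<phi>) \<in> A" "p \<in> U"
proof -
  have "p \<in> (\<Union>(U, \<phi>)\<in>A. U)"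
    using lie unfolding lie_group_def smooth_atlas_def by simp
  then show ?thesis using that by auto
qed

lemma smooth_map_open:
  "smooth_map A P F \<Longrightarrow> open P \<Longrightarrow> (W, \<theta>) \<in> A \<Longrightarrow> open {x\<in>P. F x \<in> W}"
  using open_Collect_mem_preimage chart_open unfolding smooth_map_def by blast

lemma smooth_mapD: "smooth_map A P F \<Longrightarrow> (W, \<theta>) \<in> A \<Longrightarrow> smooth_on {x\<in>P. F x \<in> W} (\<lambda>x. \<theta> (F x))"
  unfolding smooth_map_def by auto

lemma smooth_fun_iff: "smooth_fun A f \<longleftrightarrow> (\<forall>(U, \<phi>)\<in>A. smooth_on (\<phi> ` U) (\<lambda>x. f (inv_into U \<phi> x)))"
  by (simp add: smooth_fun_def o_def)

lemma smooth_fun_compose: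
  assumes P: "open P" and F: "smooth_map A P F" and f: "smooth_fun A f"
  shows "smooth_on P (\<lambda>x. f (F x))"
proof (rule smooth_on_local)
  fix x assume x: "x \<in> P"
  obtain W \<theta> where W: "(W, \<theta>) \<in> A" "F x \<in> W" using chart_exists .
  let ?T = "{x\<in>P. F x \<in> W}"
  have T: "open ?T" by (rule smooth_map_open[OF F P W(1)])
  have "smooth_on ?T (\<lambda>x. (f \<circ> inv_into W \<theta>) (\<theta> (F x)))"
    using f W(1) by (intro smooth_on_compose[OF T chart_image_open[OF W(1)] _ smooth_mapD[OF F W(1)]])
      (auto simp: smooth_fun_iff)
  then have "smooth_on ?T (\<lambda>x. f (F x))"
    by (rule smooth_on_cong[OF T, rotated]) (simp add: chart_inv_left[OF W(1)])
  then show "\<exists>T. open T \<and> x \<in> T \<and> smooth_on T (\<lambda>x. f (F x))"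
    using T x W(2) by blast
qed

lemma smooth_map_chart_inv:
  assumes U: "(U, \<phi>) \<in> A"
  shows "smooth_map A (\<phi> ` U) (inv_into U \<phi>)"
  unfolding smooth_map_def
proof (intro conjI ballI, goal_cases)
  case 1
  show ?case by (rule chart_inv_continuous[OF U])
next
  case (2 y)
  obtain W \<theta> where y: "y = (W, \<theta>)" by force
  have "smooth_on (\<phi> ` (U \<inter> W)) (\<theta> \<circ> inv_into U \<phi>)"
    using lie U 2 y unfolding lie_group_def smooth_atlas_def by blast
  moreover have "{x \<in> \<phi> ` U. inv_into U \<phi> x \<in> W} = \<phi> ` (U \<inter> W)"
    using chart_inv_left[OF U] by auto
  ultimately show ?case by (simp add: y o_def)
qed

lemma smooth_map_const: "smooth_map A P (\<lambda>x. c)"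
  by (auto simp: smooth_map_def smooth_on_const)

lemma smooth_map_precompose:
  assumes "open Q" "open P" "smooth_on Q h" "h ` Q \<subseteq> P" "smooth_map A P F"
  shows "smooth_map A Q (\<lambda>x. F (h x))"
  unfolding smooth_map_def
proof (intro conjI ballI, goal_cases)
  case 1
  show ?case
    using assms smooth_on_imp_continuous_on[OF assms(3)] continuous_on_compose2[of P F Q h]
    unfolding smooth_map_def by auto
next
  case (2 y)
  obtain W \<theta> where y: "y = (W, \<theta>)" by force
  have W: "(W, \<theta>) \<in> A" using 2 y by simp
  have c: "continuous_on Q (\<lambda>x. F (h x))"
    using assms smooth_on_imp_continuous_on[OF assms(3)] continuous_on_compose2[of P F Q h]
    unfolding smooth_map_def by auto
  have "smooth_on {x \<in> Q. F (h x) \<in> W} (\<lambda>x. \<theta> (F (h x)))"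
    by (rule smooth_on_compose[OF open_Collect_mem_preimage[OF assms(1) c chart_open[OF W]]
          smooth_map_open[OF assms(5,2) W] _ _ smooth_mapD[OF assms(5) W]])
      (use assms(3,4) in \<open>auto intro: smooth_on_subset\<close>)
  then show ?case by (simp add: y)
qed

lemma continuous_on_chart_inv_add:
  assumes "(U, \<phi>) \<in> A" "(V, \<psi>) \<in> A"
  shows "continuous_on (\<phi> ` U \<times> \<psi> ` V) (\<lambda>z. inv_into U \<phi> (fst z) + inv_into V \<psi> (snd z))"
  by (intro continuous_on_add continuous_on_compose2[OF chart_inv_continuous[OF assms(1)]]
      continuous_on_compose2[OF chart_inv_continuous[OF assms(2)]] continuous_intros) auto

text \<open>Near a point, charts around \<open>F x\<close> and \<open>G x\<close> and the given
  target chart make the product smooth in coordinates by the definition of a Lie group; this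
  expression is composed with the pair of coordinate expressions of \<open>F\<close> and
  \<open>G\<close>.\<close>

lemma smooth_map_add:
  assumes P: "open P" and F: "smooth_map A P F" and G: "smooth_map A P G"
  shows "smooth_map A P (\<lambda>x. F x + G x)"
  unfolding smooth_map_def
proof (intro conjI ballI, goal_cases)
  case 1
  show ?case using F G continuous_on_add unfolding smooth_map_def by blast
next
  case (2 y)
  obtain W \<theta> where y: "y = (W, \<theta>)" by force
  have W: "(W, \<theta>) \<in> A" using 2 y by simp
  have c: "continuous_on P (\<lambda>x. F x + G x)"
    using F G continuous_on_add unfolding smooth_map_def by blast
  have "smooth_on {x \<in> P. F x + G x \<in> W} (\<lambda>x. \<theta> (F x + G x))"
  proof (rule smooth_on_local)
    fix x assume x: "x \<in> {x \<in> P. F x + G x \<in> W}"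
    obtain U \<phi> where U: "(U, \<phi>) \<in> A" "F x \<in> U" using chart_exists .
    obtain V \<psi> where V: "(V, \<psi>) \<in> A" "G x \<in> V" using chart_exists .
    let ?T = "{x\<in>P. F x \<in> U} \<inter> {x\<in>P. G x \<in> V} \<inter> {x\<in>P. F x + G x \<in> W}"
    let ?Q = "{(x, y). x \<in> \<phi> ` U \<and> y \<in> \<psi> ` V \<and> inv_into U \<phi> x + inv_into V \<psi> y \<in> W}"
    let ?m = "\<lambda>(x, y). \<theta> (inv_into U \<phi> x + inv_into V \<psi> y)"
    have T: "open ?T"
      by (intro open_Int smooth_map_open[OF F P U(1)] smooth_map_open[OF G P V(1)]
          open_Collect_mem_preimage[OF P c chart_open[OF W]])
    have "open {z\<in>\<phi> ` U \<times> \<psi> ` V. inv_into U \<phi> (fst z) + inv_into V \<psi> (snd z) \<in> W}"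
      by (intro open_Collect_mem_preimage open_Times chart_image_open[OF U(1)] chart_image_open[OF V(1)]
          chart_open[OF W] continuous_on_chart_inv_add[OF U(1) V(1)])
    also have "{z\<in>\<phi> ` U \<times> \<psi> ` V. inv_into U \<phi> (fst z) + inv_into V \<psi> (snd z) \<in> W} = ?Q"
      by auto
    finally have Q: "open ?Q" .
    have m: "smooth_on ?Q ?m"
      using lie U(1) V(1) W unfolding lie_group_def by blast
    have FG: "smooth_on ?T (\<lambda>x. (\<phi> (F x), \<psi> (G x)))"
      by (intro smooth_on_Pair T smooth_on_subset[OF smooth_mapD[OF F U(1)]]
          smooth_on_subset[OF smooth_mapD[OF G V(1)]]) auto
    have "smooth_on ?T (\<lambda>x. ?m (\<phi> (F x), \<psi> (G x)))"
      by (rule smooth_on_compose[OF T Q _ FG m])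
        (auto simp: chart_inv_left[OF U(1)] chart_inv_left[OF V(1)])
    then have "smooth_on ?T (\<lambda>x. \<theta> (F x + G x))"
      by (rule smooth_on_cong[OF T, rotated])
        (auto simp: chart_inv_left[OF U(1)] chart_inv_left[OF V(1)])
    then show "\<exists>T. open T \<and> x \<in> T \<and> smooth_on T (\<lambda>x. \<theta> (F x + G x))"
      using T x U(2) V(2) by blast
  qed
  then show ?case by (simp add: y)
qed

lemma smooth_map_uminus:
  assumes P: "open P" and F: "smooth_map A P F"
  shows "smooth_map A P (\<lambda>x. - F x)"
  unfolding smooth_map_def
proof (intro conjI ballI, goal_cases)
  case 1
  show ?case using F tendsto_minus unfolding smooth_map_def continuous_on_def by blast
next
  case (2 y)
  obtain W \<theta> where y: "y = (W, \<theta>)" by force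
  have W: "(W, \<theta>) \<in> A" using 2 y by simp
  have c: "continuous_on S (\<lambda>x. - K x)" if "continuous_on S K" for S and K :: "'z::topological_space \<Rightarrow> 'g"
    using that tendsto_minus unfolding continuous_on_def by blast
  have cF: "continuous_on P F" using F by (simp add: smooth_map_def)
  have "smooth_on {x \<in> P. - F x \<in> W} (\<lambda>x. \<theta> (- F x))"
  proof (rule smooth_on_local)
    fix x assume x: "x \<in> {x \<in> P. - F x \<in> W}"
    obtain U \<phi> where U: "(U, \<phi>) \<in> A" "F x \<in> U" using chart_exists .
    let ?T = "{x\<in>P. F x \<in> U} \<inter> {x\<in>P. - F x \<in> W}"
    let ?Q = "{x \<in> \<phi> ` U. - inv_into U \<phi> x \<in> W}"
    have T: "open ?T"
      by (intro open_Int smooth_map_open[OF F P U(1)]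
          open_Collect_mem_preimage[OF P c[OF cF] chart_open[OF W]])
    have Q: "open ?Q"
      by (intro open_Collect_mem_preimage chart_image_open[OF U(1)] chart_open[OF W] c
          chart_inv_continuous[OF U(1)])
    have m: "smooth_on ?Q (\<lambda>x. \<theta> (- inv_into U \<phi> x))"
      using lie U(1) W unfolding lie_group_def by blast
    have "smooth_on ?T (\<lambda>x. \<theta> (- inv_into U \<phi> (\<phi> (F x))))"
      by (rule smooth_on_compose[OF T Q _ smooth_on_subset[OF smooth_mapD[OF F U(1)]] m])
        (auto simp: chart_inv_left[OF U(1)])
    then have "smooth_on ?T (\<lambda>x. \<theta> (- F x))"
      by (rule smooth_on_cong[OF T, rotated]) (auto simp: chart_inv_left[OF U(1)])
    then show "\<exists>T. open T \<and> x \<in> T \<and> smooth_on T (\<lambda>x. \<theta> (- F x))"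
      using T x U(2) by blast
  qed
  then show ?case by (simp add: y)
qed

lemma smooth_funD: "smooth_fun A f \<Longrightarrow> (U, \<phi>) \<in> A \<Longrightarrow> smooth_on (\<phi> ` U) (\<lambda>x. f (inv_into U \<phi> x))"
  using smooth_fun_iff by fast

lemma smooth_fun_const: "smooth_fun A (\<lambda>p. c)"
  by (simp add: smooth_fun_iff smooth_on_const case_prod_beta)

lemma smooth_fun_add: "smooth_fun A f \<Longrightarrow> smooth_fun A h \<Longrightarrow> smooth_fun A (\<lambda>p. f p + h p)"
  using smooth_on_add chart_image_open unfolding smooth_fun_iff by fast

lemma smooth_fun_mult: "smooth_fun A f \<Longrightarrow> smooth_fun A h \<Longrightarrow> smooth_fun A (\<lambda>p. f p * h p)"
  using smooth_on_scaleR[where 'b = real] chart_image_open unfolding smooth_fun_iff real_scaleR_def by fast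

lemma smooth_fun_sum: "(\<And>i. i \<in> I \<Longrightarrow> smooth_fun A (f i)) \<Longrightarrow> smooth_fun A (\<lambda>p. \<Sum>i\<in>I. f i p)"
  by (induction I rule: infinite_finite_induct) (auto intro: smooth_fun_const smooth_fun_add)

lemma smooth_fun_translate:
  assumes "smooth_fun A f"
  shows "smooth_fun A (\<lambda>y. f (g + y))"
  unfolding smooth_fun_iff
proof safe
  fix U \<phi> assume U: "(U, \<phi>) \<in> A"
  show "smooth_on (\<phi> ` U) (\<lambda>x. f (g + inv_into U \<phi> x))"
    by (intro smooth_fun_compose[OF _ _ assms] smooth_map_add chart_image_open[OF U] smooth_map_const
        smooth_map_chart_inv[OF U])
qed

lemma smooth_fun_translate_iff: "smooth_fun A (\<lambda>y. f (g + y)) \<longleftrightarrow> smooth_fun A f"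
  using smooth_fun_translate[of f g] smooth_fun_translate[of "\<lambda>y. f (g + y)" "- g"]
  by (auto simp: add.assoc[symmetric])

lemma smooth_fun_has_derivative:
  assumes "smooth_fun A f" "(U, \<phi>) \<in> A" "p \<in> U"
  shows "((\<lambda>x. f (inv_into U \<phi> x)) has_derivative
    frechet_derivative (\<lambda>x. f (inv_into U \<phi> x)) (at (\<phi> p))) (at (\<phi> p))"
  using smooth_on_imp_differentiable[OF smooth_funD[OF assms(1,2)]] assms(3) frechet_derivative_works by blast

section \<open>Vector fields\<close>

lemma vector_fieldD:
  assumes "vector_field A X" "(U, \<phi>) \<in> A"
  obtains a where "smooth_on (\<phi> ` U) a"
    "\<And>f p. smooth_fun A f \<Longrightarrow> p \<in> U \<Longrightarrow>
      X f p = frechet_derivative (\<lambda>x. f (inv_into U \<phi> x)) (at (\<phi> p)) (a (\<phi> p))"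
  using assms unfolding vector_field_def o_def by fast

lemma vector_fieldI:
  assumes "\<And>U \<phi>. (U, \<phi>) \<in> A \<Longrightarrow> \<exists>a. smooth_on (\<phi> ` U) a \<and>
    (\<forall>f. smooth_fun A f \<longrightarrow> (\<forall>p\<in>U.
      X f p = frechet_derivative (\<lambda>x. f (inv_into U \<phi> x)) (at (\<phi> p)) (a (\<phi> p))))"
    "\<And>f. \<not> smooth_fun A f \<Longrightarrow> X f = 0"
  shows "vector_field A X"
  using assms unfolding vector_field_def o_def by fast

lemma vector_field_not_smooth: "vector_field A X \<Longrightarrow> \<not> smooth_fun A f \<Longrightarrow> X f = 0"
  unfolding vector_field_def by blast

lemma vector_field_smooth:
  assumes X: "vector_field A X" and f: "smooth_fun A f"
  shows "smooth_fun A (X f)"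
  unfolding smooth_fun_iff
proof safe
  fix U \<phi> assume U: "(U, \<phi>) \<in> A"
  obtain a where a: "smooth_on (\<phi> ` U) a" "\<And>f p. smooth_fun A f \<Longrightarrow> p \<in> U \<Longrightarrow>
      X f p = frechet_derivative (\<lambda>x. f (inv_into U \<phi> x)) (at (\<phi> p)) (a (\<phi> p))"
    by (rule vector_fieldD[OF X U]) blast
  show "smooth_on (\<phi> ` U) (\<lambda>x. X f (inv_into U \<phi> x))"
    by (rule smooth_on_cong[OF chart_image_open[OF U] _
          smooth_on_frechet_derivative_along[OF chart_image_open[OF U] smooth_funD[OF f U] a(1)]])
      (simp add: a(2)[OF f] chart_inv_mem[OF U] chart_inv_right[OF U])
qed

lemma vector_field_add_fun:
  assumes X: "vector_field A X" and f: "smooth_fun A f" and h: "smooth_fun A h"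
  shows "X (\<lambda>p. f p + h p) p = X f p + X h p"
proof -
  obtain U \<phi> where U: "(U, \<phi>) \<in> A" "p \<in> U" using chart_exists .
  show ?thesis
    by (rule vector_fieldD[OF X U(1)])
      (simp add: f h U(2) smooth_fun_add frechet_derivative_at[OF has_derivative_add[OF
        smooth_fun_has_derivative[OF f U] smooth_fun_has_derivative[OF h U]], symmetric])
qed

lemma vector_field_mult_fun:
  assumes X: "vector_field A X" and f: "smooth_fun A f" and h: "smooth_fun A h"
  shows "X (\<lambda>p. f p * h p) p = X f p * h p + f p * X h p"
proof -
  obtain U \<phi> where U: "(U, \<phi>) \<in> A" "p \<in> U" using chart_exists .
  show ?thesis
    by (rule vector_fieldD[OF X U(1)])
      (simp add: f h U(2) smooth_fun_mult chart_inv_left[OF U(1)] frechet_derivative_at[OF has_derivative_mult[OF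
        smooth_fun_has_derivative[OF f U] smooth_fun_has_derivative[OF h U]], symmetric])
qed

lemma vector_field_const: "vector_field A X \<Longrightarrow> X (\<lambda>p. c) p = 0"
proof -
  assume X: "vector_field A X"
  obtain U \<phi> where U: "(U, \<phi>) \<in> A" "p \<in> U" using chart_exists .
  show ?thesis
    by (rule vector_fieldD[OF X U(1)]) (simp add: smooth_fun_const U(2))
qed

lemma vector_field_cmult_fun:
  "vector_field A X \<Longrightarrow> smooth_fun A f \<Longrightarrow> X (\<lambda>p. c * f p) p = c * X f p"
  using vector_field_mult_fun[OF _ smooth_fun_const, of X f c] by (simp add: vector_field_const)

lemma vector_field_sum_fun:
  assumes "vector_field A X" "\<And>i. i \<in> I \<Longrightarrow> smooth_fun A (f i)"
  shows "X (\<lambda>p. \<Sum>i\<in>I. f i p) p = (\<Sum>i\<in>I. X (f i) p)"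
  using assms(2)
proof (induction I rule: infinite_finite_induct)
  case (insert i I)
  then have "X (\<lambda>p. f i p + (\<Sum>i\<in>I. f i p)) p = X (f i) p + X (\<lambda>p. \<Sum>i\<in>I. f i p) p"
    by (intro vector_field_add_fun assms(1) smooth_fun_sum) auto
  with insert show ?case by simp
qed (simp_all add: vector_field_const assms(1))

lemma vector_field_add:
  assumes X: "vector_field A X" and Y: "vector_field A Y"
  shows "vector_field A (X + Y)"
proof (rule vector_fieldI)
  fix U \<phi> assume U: "(U, \<phi>) \<in> A"
  obtain a where a: "smooth_on (\<phi> ` U) a" "\<And>f p. smooth_fun A f \<Longrightarrow> p \<in> U \<Longrightarrow>
      X f p = frechet_derivative (\<lambda>x. f (inv_into U \<phi> x)) (at (\<phi> p)) (a (\<phi> p))"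
    by (rule vector_fieldD[OF X U]) blast
  obtain b where b: "smooth_on (\<phi> ` U) b" "\<And>f p. smooth_fun A f \<Longrightarrow> p \<in> U \<Longrightarrow>
      Y f p = frechet_derivative (\<lambda>x. f (inv_into U \<phi> x)) (at (\<phi> p)) (b (\<phi> p))"
    by (rule vector_fieldD[OF Y U]) blast
  show "\<exists>a. smooth_on (\<phi> ` U) a \<and> (\<forall>f. smooth_fun A f \<longrightarrow> (\<forall>p\<in>U.
      (X + Y) f p = frechet_derivative (\<lambda>x. f (inv_into U \<phi> x)) (at (\<phi> p)) (a (\<phi> p))))"
    using has_derivative_linear[OF smooth_fun_has_derivative[OF _ U]]
    by (intro exI[of _ "\<lambda>x. a x + b x"] conjI smooth_on_add chart_image_open[OF U] a b)
      (simp add: a(2) b(2) linear_add)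
qed (simp add: vector_field_not_smooth X Y fun_eq_iff)

lemma vector_field_fmult:
  assumes h: "smooth_fun A h" and X: "vector_field A X"
  shows "vector_field A (fmult h X)"
proof (rule vector_fieldI)
  fix U \<phi> assume U: "(U, \<phi>) \<in> A"
  obtain a where a: "smooth_on (\<phi> ` U) a" "\<And>f p. smooth_fun A f \<Longrightarrow> p \<in> U \<Longrightarrow>
      X f p = frechet_derivative (\<lambda>x. f (inv_into U \<phi> x)) (at (\<phi> p)) (a (\<phi> p))"
    by (rule vector_fieldD[OF X U]) blast
  show "\<exists>a. smooth_on (\<phi> ` U) a \<and> (\<forall>f. smooth_fun A f \<longrightarrow> (\<forall>p\<in>U.
      (fmult h X) f p = frechet_derivative (\<lambda>x. f (inv_into U \<phi> x)) (at (\<phi> p)) (a (\<phi> p))))"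
    using has_derivative_linear[OF smooth_fun_has_derivative[OF _ U]]
    by (intro exI[of _ "\<lambda>x. h (inv_into U \<phi> x) *\<^sub>R a x"] conjI smooth_on_scaleR chart_image_open[OF U] a
        smooth_funD[OF h U])
      (simp add: a(2) fmult_def linear_scale chart_inv_left[OF U])
qed (simp add: vector_field_not_smooth X fmult_def fun_eq_iff)

end

section \<open>Global smooth functions with a prescribed differential\<close>

lemma smooth_on_inner_self: "open S \<Longrightarrow> smooth_on S f \<Longrightarrow> smooth_on S (\<lambda>x. f x \<bullet> (f x :: 'a::euclidean_space))"
  unfolding euclidean_inner[of "f _" "f _"] real_scaleR_def[symmetric]
  by (intro smooth_on_sum smooth_on_scaleR smooth_on_bounded_linear_compose[OF bounded_linear_inner_left])

context lie_grp
begin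

text \<open>The image of \<open>K\<close> in the group is compact, hence closed since the group is
  Hausdorff. So two open sets cover the group: the chart domain, where the function is a composition
  with \<open>\<phi>\<close>, and the complement of that image, where it is zero.\<close>

lemma smooth_fun_extend_by_zero:
  assumes U: "(U, \<phi>) \<in> A" and K: "compact K" "K \<subseteq> \<phi> ` U"
    and \<beta>: "smooth_on UNIV \<beta>" "\<And>x. x \<notin> K \<Longrightarrow> \<beta> x = 0"
  shows "smooth_fun A (\<lambda>q. if q \<in> U then \<beta> (\<phi> q) else 0)"
  unfolding smooth_fun_iff
proof safe
  fix W \<theta> assume W: "(W, \<theta>) \<in> A"
  let ?f = "\<lambda>q. if q \<in> U then \<beta> (\<phi> q) else 0"
  let ?i = "inv_into W \<theta>"
  note oW = chart_image_open[OF W] and mW = smooth_map_chart_inv[OF W]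
  define L where "L = inv_into U \<phi> ` K"
  have "compact L"
    unfolding L_def
    by (rule compact_continuous_image[OF continuous_on_subset[OF chart_inv_continuous[OF U] K(2)] K(1)])
  then have L: "open (- L)"
    by (simp add: compact_imp_closed open_Compl)
  show "smooth_on (\<theta> ` W) (\<lambda>y. ?f (?i y))"
  proof (rule smooth_on_local)
    fix y assume y: "y \<in> \<theta> ` W"
    show "\<exists>T. open T \<and> y \<in> T \<and> smooth_on T (\<lambda>y. ?f (?i y))"
    proof (cases "?i y \<in> U")
      case True
      let ?T = "{y \<in> \<theta> ` W. ?i y \<in> U}"
      have T: "open ?T" by (rule smooth_map_open[OF mW oW U])
      have "smooth_on ?T (\<lambda>y. \<beta> (\<phi> (?i y)))"
        by (rule smooth_on_compose[OF T open_UNIV _ smooth_mapD[OF mW U] \<beta>(1)]) simp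
      then have "smooth_on ?T (\<lambda>y. ?f (?i y))"
        by (rule smooth_on_cong[OF T, rotated]) simp
      then show ?thesis using T True y by blast
    next
      case False
      let ?T = "{y \<in> \<theta> ` W. ?i y \<in> - L}"
      have T: "open ?T"
        by (rule open_Collect_mem_preimage[OF oW chart_inv_continuous[OF W] L])
      have "\<beta> (\<phi> q) = 0" if "q \<in> U" "q \<notin> L" for q
      proof (rule \<beta>(2), rule notI)
        assume "\<phi> q \<in> K"
        then have "inv_into U \<phi> (\<phi> q) \<in> L" unfolding L_def by (rule imageI)
        with that show False by (simp add: chart_inv_left[OF U])
      qed
      then have "0 = ?f (?i z)" if "z \<in> ?T" for z
        using that by simp
      then have "smooth_on ?T (\<lambda>y. ?f (?i y))"
        by (rule smooth_on_cong[OF T _ smooth_on_const])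
      moreover have "L \<subseteq> U"
        using K(2) chart_inv_mem[OF U] by (auto simp: L_def)
      then have "y \<in> ?T" using False y by auto
      ultimately show ?thesis using T by (intro exI[of _ ?T]) simp
    qed
  qed
qed

text \<open>Multiply the linear function \<open>(x - x0) \<bullet> b\<close> by a bump supported in
  a ball inside the chart image and normalized to 1 at \<open>x0\<close>. There the linear factor
  vanishes, so the derivative of the bump drops out of the product rule.\<close>

lemma smooth_fun_with_derivative:
  assumes U: "(U, \<phi>) \<in> A" "p \<in> U"
  obtains f where "smooth_fun A f"
    "\<And>v. frechet_derivative (\<lambda>x. f (inv_into U \<phi> x)) (at (\<phi> p)) v = v \<bullet> b"
proof -
  define x0 where "x0 = \<phi> p"
  obtain r where r: "r > 0" "cball x0 r \<subseteq> \<phi> ` U"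
    using chart_image_open[OF U(1)] U(2) open_contains_cball_eq[of "\<phi> ` U"] unfolding x0_def by blast
  define c where "c = flat_exp 0 (r\<^sup>2)"
  have c: "c > 0" using r(1) by (simp add: c_def flat_exp_def)
  define h where "h x = flat_exp 0 (r\<^sup>2 + (- 1) *\<^sub>R ((x + - x0) \<bullet> (x + - x0)))" for x
  define \<beta> where "\<beta> x = h x *\<^sub>R (inverse c *\<^sub>R ((x + - x0) \<bullet> b))" for x
  have sub: "smooth_on UNIV (\<lambda>x::'m. x + - x0)"
    by (intro smooth_on_add open_UNIV smooth_on_bounded_linear[OF bounded_linear_ident] smooth_on_const)
  have h: "smooth_on UNIV h"
    unfolding h_def
    by (intro smooth_on_compose[OF open_UNIV open_UNIV _ _ smooth_on_flat_exp] smooth_on_add open_UNIV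
        smooth_on_scaleR smooth_on_const smooth_on_inner_self sub) simp
  have \<beta>: "smooth_on UNIV \<beta>"
    unfolding \<beta>_def
    by (intro smooth_on_scaleR open_UNIV h smooth_on_const
        smooth_on_bounded_linear_compose[OF bounded_linear_inner_left] sub)
  have "\<beta> x = 0" if "x \<notin> cball x0 r" for x
  proof -
    have "r\<^sup>2 < (norm (x - x0))\<^sup>2"
      using that r(1) by (intro power_strict_mono) (auto simp: dist_norm norm_minus_commute)
    then show ?thesis
      by (simp add: \<beta>_def h_def flat_exp_def power2_norm_eq_inner)
  qed
  then have f: "smooth_fun A (\<lambda>q. if q \<in> U then \<beta> (\<phi> q) else 0)"
    by (rule smooth_fun_extend_by_zero[OF U(1) compact_cball r(2) \<beta>])
  have "(h has_derivative frechet_derivative h (at x0)) (at x0)"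
    using smooth_on_imp_differentiable[OF h] frechet_derivative_works by blast
  moreover have "((\<lambda>x. inverse c *\<^sub>R ((x + - x0) \<bullet> b)) has_derivative (\<lambda>v. inverse c *\<^sub>R (v \<bullet> b))) (at x0)"
    by (auto intro!: derivative_eq_intros)
  ultimately have "(\<beta> has_derivative (\<lambda>v. h x0 *\<^sub>R (inverse c *\<^sub>R (v \<bullet> b)) +
      frechet_derivative h (at x0) v *\<^sub>R (inverse c *\<^sub>R ((x0 + - x0) \<bullet> b)))) (at x0)"
    unfolding \<beta>_def by (rule has_derivative_scaleR)
  moreover have "h x0 = c" by (simp add: h_def c_def)
  ultimately have "(\<beta> has_derivative (\<lambda>v. v \<bullet> b)) (at x0)"
    using c by (simp add: mult.assoc[symmetric])
  then have "((\<lambda>x. if inv_into U \<phi> x \<in> U then \<beta> (\<phi> (inv_into U \<phi> x)) else 0) has_derivative (\<lambda>v. v \<bullet> b)) (at x0)"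
    by (rule has_derivative_transform_within_open[OF _ chart_image_open[OF U(1)]])
      (auto simp: x0_def U(2) chart_inv_left[OF U(1)])
  from frechet_derivative_at[OF this, symmetric] show ?thesis
    by (intro that[OF f]) (simp add: x0_def)
qed

end

section \<open>The left-invariant frame\<close>

text \<open>The functions \<open>F b\<close> replace coordinates at the neutral element: their
  differentials there are the linear forms \<open>v \<bullet> b\<close>, and unlike the chart
  \<open>\<psi>\<close> they are smooth on the whole group.\<close>

locale lie_grp_frame = lie_grp A
  for A :: "('g::{topological_group_add,t2_space,second_countable_topology}, 'm::euclidean_space) atlas" +
  fixes V :: "'g set" and \<psi> :: "'g \<Rightarrow> 'm" and F :: "'m \<Rightarrow> 'g \<Rightarrow> real"
  assumes base: "(V, \<psi>) \<in> A" and zero_mem: "0 \<in> V"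
    and F_smooth: "\<And>b. smooth_fun A (F b)"
    and F_derivative: "\<And>b v. frechet_derivative (\<lambda>y. F b (inv_into V \<psi> y)) (at (\<psi> 0)) v = v \<bullet> b"

lemma (in lie_grp) frame_exists: "\<exists>V \<psi> F. lie_grp_frame A V \<psi> F"
proof -
  obtain V \<psi> where V: "(V, \<psi>) \<in> A" "0 \<in> V" using chart_exists .
  have "\<exists>f. smooth_fun A f \<and> (\<forall>v. frechet_derivative (\<lambda>x. f (inv_into V \<psi> x)) (at (\<psi> 0)) v = v \<bullet> b)" for b
    by (rule smooth_fun_with_derivative[OF V, of b]) blast
  then obtain F where "\<And>b. smooth_fun A (F b) \<and>
      (\<forall>v. frechet_derivative (\<lambda>x. F b (inv_into V \<psi> x)) (at (\<psi> 0)) v = v \<bullet> b)"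
    by metis
  then have "lie_grp_frame A V \<psi> F"
    by unfold_locales (use V in auto)
  then show ?thesis by blast
qed

context lie_grp_frame
begin

text \<open>Differentiating \<open>f (p + y)\<close> in \<open>y\<close> at the neutral element
  gives the value at \<open>p\<close> of the left-invariant field with value \<open>v\<close> at 0.
  The zero on functions that are not smooth follows the convention of
  \<open>vector_field\<close>.\<close>

definition E :: "'m \<Rightarrow> 'g field"
  where "E v f p = (if smooth_fun A f
    then frechet_derivative (\<lambda>y. f (p + inv_into V \<psi> y)) (at (\<psi> 0)) v else 0)"

text \<open>The translate of \<open>F b\<close> by \<open>p\<close> has derivative
  \<open>v \<bullet> b\<close> along \<open>E v\<close> at \<open>p\<close>, so applying
  \<open>Y\<close> to it yields the \<open>b\<close>-coordinate of \<open>Y\<close> at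
  \<open>p\<close> in the frame \<open>E\<close>.\<close>

definition coef :: "'g field \<Rightarrow> 'g \<Rightarrow> 'm"
  where "coef Y p = (\<Sum>b\<in>Basis. Y (\<lambda>q. F b (- p + q)) p *\<^sub>R b)"

lemma inv_base_0: "inv_into V \<psi> (\<psi> 0) = 0"
  by (rule chart_inv_left[OF base zero_mem])

lemma has_derivative_translate:
  assumes "smooth_fun A f"
  shows "((\<lambda>y. f (p + inv_into V \<psi> y)) has_derivative (\<lambda>v. E v f p)) (at (\<psi> 0))"
  using smooth_fun_has_derivative[OF smooth_fun_translate[OF assms, of p] base zero_mem] assms
  by (simp add: E_def)

lemma E_linear_arg: "smooth_fun A f \<Longrightarrow> linear (\<lambda>v. E v f p)"
  using has_derivative_linear has_derivative_translate by blast

lemma linear_E: "linear E"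
proof (rule linearI; intro ext)
  fix u v f p
  show "E (u + v) f p = (E u + E v) f p"
    using linear_add[OF E_linear_arg, of f u v p] by (cases "smooth_fun A f") (auto simp: E_def)
next
  fix c u f p
  show "E (c *\<^sub>R u) f p = (c *\<^sub>R E u) f p"
    using linear_scale[OF E_linear_arg, of f c u p]
    by (cases "smooth_fun A f") (auto simp: E_def scaleR_fun_def)
qed

text \<open>The chart components \<open>a v\<close> of \<open>E v\<close> are the derivative, in the
  second factor at the neutral element, of the multiplication in coordinates. They are smooth
  because this derivative depends smoothly on the first factor.\<close>

lemma E_chart:
  assumes U: "(U, \<phi>) \<in> A"
  defines "a \<equiv> \<lambda>v x. frechet_derivative (\<lambda>y. \<phi> (inv_into U \<phi> x + inv_into V \<psi> y)) (at (\<psi> 0)) v"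
  shows "smooth_on (\<phi> ` U) (a v)"
    and "p \<in> U \<Longrightarrow> linear (\<lambda>v. a v (\<phi> p))"
    and "smooth_fun A f \<Longrightarrow> p \<in> U \<Longrightarrow>
      E v f p = frechet_derivative (\<lambda>x. f (inv_into U \<phi> x)) (at (\<phi> p)) (a v (\<phi> p))"
proof -
  let ?P = "\<phi> ` U \<times> \<psi> ` V"
  let ?F = "\<lambda>z. inv_into U \<phi> (fst z) + inv_into V \<psi> (snd z)"
  let ?Q = "{z\<in>?P. ?F z \<in> U}"
  have P: "open ?P"
    by (intro open_Times chart_image_open[OF U] chart_image_open[OF base])
  have m: "smooth_map A ?P ?F"
    by (intro smooth_map_add P
        smooth_map_precompose[OF P chart_image_open[OF U] smooth_on_bounded_linear[OF bounded_linear_fst] _ smooth_map_chart_inv[OF U]]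
        smooth_map_precompose[OF P chart_image_open[OF base] smooth_on_bounded_linear[OF bounded_linear_snd] _ smooth_map_chart_inv[OF base]])
      auto
  have Q: "open ?Q" by (rule smooth_map_open[OF m P U])
  have s: "smooth_on ?Q (\<lambda>z. \<phi> (?F z))" by (rule smooth_mapD[OF m U])
  have mem: "(x, \<psi> 0) \<in> ?Q" if "x \<in> \<phi> ` U" for x
    using that chart_inv_mem[OF U that] zero_mem by (simp add: inv_base_0)
  show "smooth_on (\<phi> ` U) (a v)"
    using smooth_on_partial_derivative[OF Q s chart_image_open[OF U] smooth_on_bounded_linear[OF bounded_linear_ident]
        smooth_on_const smooth_on_const mem]
    unfolding a_def by simp
  assume p: "p \<in> U"
  have "(\<lambda>z. \<phi> (?F z)) differentiable (at (\<phi> p, \<psi> 0))"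
    by (rule smooth_on_imp_differentiable[OF s mem]) (use p in auto)
  moreover have "((\<lambda>y. (\<phi> p, y)) has_derivative (\<lambda>w. (0, w))) (at (\<psi> 0))"
    by (auto intro!: derivative_eq_intros)
  ultimately have "(\<lambda>y. \<phi> (?F (\<phi> p, y))) differentiable (at (\<psi> 0))"
    using differentiable_chain_at[of "\<lambda>y. (\<phi> p, y)" "\<psi> 0" "\<lambda>z. \<phi> (?F z)"]
    unfolding differentiable_def o_def by blast
  then have d: "((\<lambda>y. \<phi> (p + inv_into V \<psi> y)) has_derivative (\<lambda>v. a v (\<phi> p))) (at (\<psi> 0))"
    using chart_inv_left[OF U p] by (simp add: a_def frechet_derivative_works)
  then show "linear (\<lambda>v. a v (\<phi> p))" by (rule has_derivative_linear)
  assume f: "smooth_fun A f"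
  let ?D = "frechet_derivative (\<lambda>x. f (inv_into U \<phi> x)) (at (\<phi> p))"
  have "((\<lambda>y. f (inv_into U \<phi> (\<phi> (p + inv_into V \<psi> y)))) has_derivative (\<lambda>v. ?D (a v (\<phi> p)))) (at (\<psi> 0))"
    using diff_chain_at[OF d, of "\<lambda>x. f (inv_into U \<phi> x)" ?D] smooth_fun_has_derivative[OF f U p]
    by (simp add: inv_base_0 o_def)
  moreover have T: "open {y \<in> \<psi> ` V. p + inv_into V \<psi> y \<in> U}"
    by (rule smooth_map_open[OF _ chart_image_open[OF base] U])
      (intro smooth_map_add chart_image_open[OF base] smooth_map_const smooth_map_chart_inv[OF base])
  ultimately have "((\<lambda>y. f (p + inv_into V \<psi> y)) has_derivative (\<lambda>v. ?D (a v (\<phi> p)))) (at (\<psi> 0))"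
    by (rule has_derivative_transform_within_open)
      (use p zero_mem in \<open>auto simp: inv_base_0 chart_inv_left[OF U]\<close>)
  from has_derivative_unique[OF this has_derivative_translate[OF f]]
  show "E v f p = ?D (a v (\<phi> p))" by metis
qed

lemma vector_field_E: "vector_field A (E v)"
proof (rule vector_fieldI)
  fix U \<phi> assume U: "(U, \<phi>) \<in> A"
  show "\<exists>a. smooth_on (\<phi> ` U) a \<and> (\<forall>f. smooth_fun A f \<longrightarrow> (\<forall>p\<in>U.
      E v f p = frechet_derivative (\<lambda>x. f (inv_into U \<phi> x)) (at (\<phi> p)) (a (\<phi> p))))"
    using E_chart[OF U] by blast
qed (auto simp: E_def)

lemma left_push_E: "left_push g (E v) = E v"
  by (auto simp: left_push_def E_def fun_eq_iff smooth_fun_translate_iff add.assoc[symmetric])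

lemma E_in_lie_algebra: "E v \<in> lie_algebra A"
  by (simp add: lie_algebra_def vector_field_E left_push_E)

lemma E_F: "E v (\<lambda>q. F b (- p + q)) p = v \<bullet> b"
  using smooth_fun_translate[OF F_smooth, of b "- p"]
  by (simp add: E_def add.assoc[symmetric] F_derivative)

lemma coef_E: "coef (E v) p = v"
  by (simp add: coef_def E_F euclidean_representation)

text \<open>At a fixed \<open>p\<close>, \<open>B\<close> sends frame coordinates to chart
  components and \<open>\<Phi>\<close> reads chart components through the test functions.
  \<open>\<Phi> \<circ> B\<close> is the identity of the model space, and in finite dimension so is
  \<open>B \<circ> \<Phi>\<close>; hence the frame spans every tangent space.\<close>

lemma vector_field_eq_E:
  assumes Y: "vector_field A Y"
  shows "Y f p = E (coef Y p) f p"
proof (cases "smooth_fun A f")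
  case f: True
  obtain U \<phi> where U: "(U, \<phi>) \<in> A" "p \<in> U" using chart_exists .
  define D where "D f = frechet_derivative (\<lambda>x. f (inv_into U \<phi> x)) (at (\<phi> p))" for f :: "'g \<Rightarrow> real"
  obtain a where a: "\<And>f. smooth_fun A f \<Longrightarrow> Y f p = D f a"
    by (rule vector_fieldD[OF Y U(1)]) (metis D_def U(2))
  obtain B where B: "linear B" "\<And>f v. smooth_fun A f \<Longrightarrow> E v f p = D f (B v)"
    using E_chart(2,3)[OF U(1)] U(2) unfolding D_def by blast
  define G where "G b = (\<lambda>q. F b (- p + q))" for b
  have G: "smooth_fun A (G b)" for b
    unfolding G_def by (rule smooth_fun_translate[OF F_smooth])
  have D: "linear (D (G b))" for b
    unfolding D_def by (rule has_derivative_linear[OF smooth_fun_has_derivative[OF G U]])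
  define \<Phi> where "\<Phi> w = (\<Sum>b\<in>Basis. D (G b) w *\<^sub>R b)" for w
  have l: "linear \<Phi>"
    unfolding \<Phi>_def by (intro linear_compose_sum ballI) (auto intro!: linearI simp: linear_add[OF D] linear_scale[OF D] scaleR_left_distrib)
  have "\<Phi> (B v) = v" for v
    by (simp add: \<Phi>_def B(2)[OF G, symmetric]) (simp add: G_def E_F euclidean_representation)
  then have "\<Phi> \<circ> B = id" by (simp add: fun_eq_iff)
  then have "B \<circ> \<Phi> = id" by (rule linear_inverse_left[OF l B(1), THEN iffD1])
  then have "B (\<Phi> a) = a" by (metis comp_apply id_apply)
  moreover have "coef Y p = \<Phi> a"
    by (simp add: coef_def \<Phi>_def a[OF G, symmetric]) (simp add: G_def)
  ultimately show ?thesis using a[OF f] B(2)[OF f] by simp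
next
  case False
  then show ?thesis using vector_field_not_smooth[OF Y False] by (simp add: E_def)
qed

text \<open>In a chart the coordinate is the derivative in \<open>y\<close>, along the field, of the
  function of two variables \<open>F b (- x + y)\<close>, evaluated on the diagonal
  \<open>y = x\<close>.\<close>

lemma smooth_fun_coef:
  assumes Y: "vector_field A Y"
  shows "smooth_fun A (\<lambda>p. coef Y p \<bullet> b)"
  unfolding smooth_fun_iff
proof safe
  fix U \<phi> assume U: "(U, \<phi>) \<in> A"
  let ?i = "inv_into U \<phi>"
  obtain a where a: "smooth_on (\<phi> ` U) a" "\<And>f p. smooth_fun A f \<Longrightarrow> p \<in> U \<Longrightarrow>
      Y f p = frechet_derivative (\<lambda>x. f (?i x)) (at (\<phi> p)) (a (\<phi> p))"
    by (rule vector_fieldD[OF Y U]) blast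
  let ?P = "\<phi> ` U \<times> \<phi> ` U"
  note oU = chart_image_open[OF U]
  have P: "open ?P" by (intro open_Times oU)
  have H: "smooth_on ?P (\<lambda>z. F b (- ?i (fst z) + ?i (snd z)))" for b
    by (intro smooth_fun_compose[OF P _ F_smooth] smooth_map_add smooth_map_uminus P
        smooth_map_precompose[OF P oU smooth_on_bounded_linear[OF bounded_linear_fst] _ smooth_map_chart_inv[OF U]]
        smooth_map_precompose[OF P oU smooth_on_bounded_linear[OF bounded_linear_snd] _ smooth_map_chart_inv[OF U]])
      auto
  have "smooth_on (\<phi> ` U) (\<lambda>x. frechet_derivative (\<lambda>y. F b (- ?i x + ?i y)) (at x) (a x))" for b
    using smooth_on_partial_derivative[OF P H oU smooth_on_bounded_linear[OF bounded_linear_ident]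
        smooth_on_bounded_linear[OF bounded_linear_ident] a(1)] by simp
  then have *: "smooth_on (\<phi> ` U) (\<lambda>x. Y (\<lambda>q. F b (- ?i x + q)) (?i x))" for b
    by (rule smooth_on_cong[OF oU, rotated])
      (simp add: a(2) smooth_fun_translate[OF F_smooth] chart_inv_mem[OF U] chart_inv_right[OF U])
  show "smooth_on (\<phi> ` U) (\<lambda>x. coef Y (?i x) \<bullet> b)"
    unfolding coef_def
    by (intro smooth_on_bounded_linear_compose[OF bounded_linear_inner_left] smooth_on_sum
        smooth_on_scaleR smooth_on_const oU *)
qed

lemma vector_field_frame:
  assumes "\<And>b. b \<in> Basis \<Longrightarrow> smooth_fun A (\<lambda>p. \<xi> p \<bullet> b)"
  shows "vector_field A (\<lambda>f p. E (\<xi> p) f p)"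
proof -
  have z: "vector_field A 0"
    by (rule vector_fieldI) (auto intro!: exI[of _ "\<lambda>_. 0"] smooth_on_const
        simp: linear_0[OF has_derivative_linear[OF smooth_fun_has_derivative]])
  have "vector_field A (\<Sum>b\<in>B. fmult (\<lambda>p. \<xi> p \<bullet> b) (E b))" if "finite B" "B \<subseteq> Basis" for B
    using that
    by (induction B rule: finite_induct)
      (auto simp: z intro!: vector_field_add vector_field_fmult vector_field_E assms)
  then have "vector_field A (\<Sum>b\<in>Basis. fmult (\<lambda>p. \<xi> p \<bullet> b) (E b))" by auto
  moreover have "(\<Sum>b\<in>B. fmult (\<lambda>p. \<xi> p \<bullet> b) (E b)) f p = (\<Sum>b\<in>B. (\<xi> p \<bullet> b) * E b f p)" for f p B
    by (induction B rule: infinite_finite_induct) (auto simp: fmult_def)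
  moreover have "E (\<xi> p) f p = (\<Sum>b\<in>Basis. (\<xi> p \<bullet> b) * E b f p)" for f p
    using linear_basis_expansion[OF E_linear_arg[of f p], of "\<xi> p"]
    by (cases "smooth_fun A f") (auto simp: E_def)
  ultimately show ?thesis
    by (metis (no_types, lifting) ext)
qed

lemma coef_frame: "coef (\<lambda>f p. E (\<xi> p) f p) p = \<xi> p"
  using coef_E[of "\<xi> p" p] by (simp add: coef_def)

lemma coef_left_push: "coef (left_push g X) p = coef X (- g + p)"
  by (simp add: coef_def left_push_def add.assoc[symmetric] minus_add)

lemma coef_add: "coef (X + Y) p = coef X p + coef Y p"
  by (simp add: coef_def sum.distrib scaleR_left_distrib)

lemma coef_diff: "coef (X - Y) p = coef X p - coef Y p"
  by (simp add: coef_def sum_subtractf scaleR_left_diff_distrib)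

lemma coef_fmult: "coef (fmult f X) p = f p *\<^sub>R coef X p"
  by (simp add: coef_def fmult_def scaleR_sum_right)

text \<open>Translation shifts the argument of \<open>coef\<close>, so the frame coordinates of a
  left-invariant field are constant.\<close>

lemma lie_algebra_eq: "X \<in> lie_algebra A \<Longrightarrow> X = E (coef X 0)"
proof (intro ext)
  fix f p assume X: "X \<in> lie_algebra A"
  then have "coef X p = coef X 0"
    using coef_left_push[of p X p] by (simp add: lie_algebra_def)
  then show "X f p = E (coef X 0) f p"
    using X vector_field_eq_E[of X f p] by (simp add: lie_algebra_def)
qed

lemma lie_algebra_eq_range: "lie_algebra A = range E"
  using lie_algebra_eq E_in_lie_algebra by fast

lemma inj_E: "inj E"
  by (metis coef_E injI)

end

section \<open>Left-invariant connections and left-symmetric products\<close>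

text \<open>This is flatness after torsion-freeness has replaced the bracket by the commutator of
  \<open>m\<close>; the condition therefore mentions no Lie algebra.\<close>

definition left_symmetric :: "('v::real_vector \<Rightarrow> 'v \<Rightarrow> 'v) \<Rightarrow> bool"
  where "left_symmetric m \<longleftrightarrow> bilinear m \<and>
    (\<forall>u v w. m (m u v - m v u) w = m u (m v w) - m v (m u w))"

context lie_grp_frame
begin

definition vsmooth :: "('g \<Rightarrow> 'm) \<Rightarrow> bool"
  where "vsmooth \<xi> \<longleftrightarrow> (\<forall>b\<in>Basis. smooth_fun A (\<lambda>p. \<xi> p \<bullet> b))"

definition vderiv :: "'g field \<Rightarrow> ('g \<Rightarrow> 'm) \<Rightarrow> 'g \<Rightarrow> 'm"
  where "vderiv X \<xi> p = (\<Sum>b\<in>Basis. X (\<lambda>q. \<xi> q \<bullet> b) p *\<^sub>R b)"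

text \<open>The connection whose Christoffel symbols in the frame \<open>E\<close> are the structure
  constants of \<open>m\<close>: coordinates are differentiated one by one, and the product corrects
  the result pointwise.\<close>

definition conn :: "('m \<Rightarrow> 'm \<Rightarrow> 'm) \<Rightarrow> 'g connection"
  where "conn m X Y = (\<lambda>f p. E (vderiv X (coef Y) p + m (coef X p) (coef Y p)) f p)"

lemma vsmooth_coef: "vector_field A X \<Longrightarrow> vsmooth (coef X)"
  by (simp add: vsmooth_def smooth_fun_coef)

lemma vderiv_inner: "b \<in> Basis \<Longrightarrow> vderiv X \<xi> p \<bullet> b = X (\<lambda>q. \<xi> q \<bullet> b) p"
  by (simp add: vderiv_def inner_sum_left inner_Basis if_distrib sum.delta cong: if_cong)

lemma vsmooth_vderiv: "vector_field A X \<Longrightarrow> vsmooth \<xi> \<Longrightarrow> vsmooth (vderiv X \<xi>)"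
  by (simp add: vsmooth_def vderiv_inner vector_field_smooth)

lemma vsmooth_add: "vsmooth \<xi> \<Longrightarrow> vsmooth \<eta> \<Longrightarrow> vsmooth (\<lambda>p. \<xi> p + \<eta> p)"
  by (simp add: vsmooth_def inner_add_left smooth_fun_add)

lemma vsmooth_bilinear:
  assumes m: "bilinear m" and "vsmooth \<xi>" "vsmooth \<eta>"
  shows "vsmooth (\<lambda>p. m (\<xi> p) (\<eta> p))"
proof -
  have m_eq: "m u v = (\<Sum>i\<in>Basis. \<Sum>j\<in>Basis. ((u \<bullet> i) * (v \<bullet> j)) *\<^sub>R m i j)" for u v
  proof -
    have "m u v = (\<Sum>i\<in>Basis. (u \<bullet> i) *\<^sub>R m i v)"
      using m unfolding bilinear_def by (intro linear_basis_expansion[of "\<lambda>u. m u v"]) blast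
    also have "\<dots> = (\<Sum>i\<in>Basis. (u \<bullet> i) *\<^sub>R (\<Sum>j\<in>Basis. (v \<bullet> j) *\<^sub>R m i j))"
      using m unfolding bilinear_def by (simp add: linear_basis_expansion[of "m _" v, symmetric])
    finally show ?thesis by (simp add: scaleR_sum_right)
  qed
  have e: "m u v \<bullet> b = (\<Sum>i\<in>Basis. \<Sum>j\<in>Basis. (u \<bullet> i) * (v \<bullet> j) * (m i j \<bullet> b))" for u v b
    by (subst m_eq) (simp add: inner_sum_left)
  show ?thesis
    unfolding vsmooth_def e[of "\<xi> _" "\<eta> _"]
  proof (intro ballI smooth_fun_sum smooth_fun_mult smooth_fun_const)
  qed (use assms(2,3) in \<open>auto simp: vsmooth_def\<close>)
qed

text \<open>At a point, a field acts on all coordinate functions through one tangent vector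
  \<open>a\<close>. Fixing it once reduces the sum and bilinear rules for \<open>vderiv\<close> to
  those for Frechet derivatives.\<close>

lemma vderiv_chart:
  assumes X: "vector_field A X" and U: "(U, \<phi>) \<in> A" "p \<in> U"
  obtains a where "\<And>\<xi> D. vsmooth \<xi> \<Longrightarrow>
    ((\<lambda>x. \<xi> (inv_into U \<phi> x)) has_derivative D) (at (\<phi> p)) \<Longrightarrow> vderiv X \<xi> p = D a"
proof -
  obtain a where a: "\<And>f p. smooth_fun A f \<Longrightarrow> p \<in> U \<Longrightarrow>
      X f p = frechet_derivative (\<lambda>x. f (inv_into U \<phi> x)) (at (\<phi> p)) (a (\<phi> p))"
    by (rule vector_fieldD[OF X U(1)]) blast
  have "vderiv X \<xi> p = D (a (\<phi> p))"
    if \<xi>: "vsmooth \<xi>" and D: "((\<lambda>x. \<xi> (inv_into U \<phi> x)) has_derivative D) (at (\<phi> p))" for \<xi> D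
  proof (rule euclidean_eqI)
    fix b :: 'm assume b: "b \<in> Basis"
    have "((\<lambda>x. \<xi> (inv_into U \<phi> x) \<bullet> b) has_derivative (\<lambda>v. D v \<bullet> b)) (at (\<phi> p))"
      by (rule has_derivative_inner_left[OF D])
    from frechet_derivative_at[OF this, symmetric] a[of "\<lambda>q. \<xi> q \<bullet> b" p] \<xi> b U(2)
    show "vderiv X \<xi> p \<bullet> b = D (a (\<phi> p)) \<bullet> b"
      by (simp add: vderiv_inner vsmooth_def)
  qed
  then show ?thesis using that by blast
qed

lemma vsmooth_has_derivative:
  assumes "vsmooth \<xi>" "(U, \<phi>) \<in> A" "p \<in> U"
  obtains D where "((\<lambda>x. \<xi> (inv_into U \<phi> x)) has_derivative D) (at (\<phi> p))"
proof -
  have "((\<lambda>x. \<Sum>b\<in>Basis. (\<xi> (inv_into U \<phi> x) \<bullet> b) *\<^sub>R b) has_derivative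
      (\<lambda>v. \<Sum>b\<in>Basis. frechet_derivative (\<lambda>x. \<xi> (inv_into U \<phi> x) \<bullet> b) (at (\<phi> p)) v *\<^sub>R b)) (at (\<phi> p))"
    using assms(1) by (intro has_derivative_sum has_derivative_scaleR_left
        smooth_fun_has_derivative[where f = "\<lambda>q. \<xi> q \<bullet> _", OF _ assms(2,3)]) (auto simp: vsmooth_def)
  then show ?thesis using that by (simp add: euclidean_representation)
qed

lemma vderiv_add:
  assumes X: "vector_field A X" and "vsmooth \<xi>" "vsmooth \<eta>"
  shows "vderiv X (\<lambda>q. \<xi> q + \<eta> q) p = vderiv X \<xi> p + vderiv X \<eta> p"
proof -
  obtain U \<phi> where U: "(U, \<phi>) \<in> A" "p \<in> U" using chart_exists .
  obtain a where a: "\<And>\<xi> D. vsmooth \<xi> \<Longrightarrow>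
      ((\<lambda>x. \<xi> (inv_into U \<phi> x)) has_derivative D) (at (\<phi> p)) \<Longrightarrow> vderiv X \<xi> p = D a"
    by (rule vderiv_chart[OF X U]) blast
  obtain D D' where D: "((\<lambda>x. \<xi> (inv_into U \<phi> x)) has_derivative D) (at (\<phi> p))"
      "((\<lambda>x. \<eta> (inv_into U \<phi> x)) has_derivative D') (at (\<phi> p))"
    using vsmooth_has_derivative[OF assms(2) U] vsmooth_has_derivative[OF assms(3) U] by metis
  show ?thesis
    using a[OF vsmooth_add has_derivative_add[OF D]] a[OF _ D(1)] a[OF _ D(2)] assms by simp
qed

lemma vderiv_bilinear:
  assumes X: "vector_field A X" and m: "bilinear m" and s: "vsmooth \<xi>" "vsmooth \<eta>"
  shows "vderiv X (\<lambda>q. m (\<xi> q) (\<eta> q)) p = m (vderiv X \<xi> p) (\<eta> p) + m (\<xi> p) (vderiv X \<eta> p)"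
proof -
  obtain U \<phi> where U: "(U, \<phi>) \<in> A" "p \<in> U" using chart_exists .
  obtain a where a: "\<And>\<xi> D. vsmooth \<xi> \<Longrightarrow>
      ((\<lambda>x. \<xi> (inv_into U \<phi> x)) has_derivative D) (at (\<phi> p)) \<Longrightarrow> vderiv X \<xi> p = D a"
    by (rule vderiv_chart[OF X U]) blast
  obtain D D' where D: "((\<lambda>x. \<xi> (inv_into U \<phi> x)) has_derivative D) (at (\<phi> p))"
      "((\<lambda>x. \<eta> (inv_into U \<phi> x)) has_derivative D') (at (\<phi> p))"
    using vsmooth_has_derivative[OF s(1) U] vsmooth_has_derivative[OF s(2) U] by metis
  have "bounded_bilinear m" using m bilinear_conv_bounded_bilinear by blast
  from a[OF vsmooth_bilinear[OF m s] bounded_bilinear.FDERIV[OF this D]]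
  show ?thesis
    using a[OF s(1) D(1)] a[OF s(2) D(2)] by (simp add: chart_inv_left[OF U] add.commute)
qed

lemma vderiv_scaleR:
  assumes X: "vector_field A X" and f: "smooth_fun A f" and s: "vsmooth \<xi>"
  shows "vderiv X (\<lambda>q. f q *\<^sub>R \<xi> q) p = X f p *\<^sub>R \<xi> p + f p *\<^sub>R vderiv X \<xi> p"
proof (rule euclidean_eqI)
  fix b :: 'm assume b: "b \<in> Basis"
  then show "vderiv X (\<lambda>q. f q *\<^sub>R \<xi> q) p \<bullet> b = (X f p *\<^sub>R \<xi> p + f p *\<^sub>R vderiv X \<xi> p) \<bullet> b"
    using vector_field_mult_fun[OF X f, of "\<lambda>q. \<xi> q \<bullet> b" p] s
    by (simp add: vderiv_inner vsmooth_def inner_add_left)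
qed

lemma vderiv_const: "vector_field A X \<Longrightarrow> vderiv X (\<lambda>q. c) p = 0"
  by (simp add: vderiv_def vector_field_const)

lemma vderiv_add_field: "vderiv (X + Y) \<xi> p = vderiv X \<xi> p + vderiv Y \<xi> p"
  by (simp add: vderiv_def sum.distrib scaleR_left_distrib)

lemma vderiv_fmult_field: "vderiv (fmult f X) \<xi> p = f p *\<^sub>R vderiv X \<xi> p"
  by (simp add: vderiv_def fmult_def scaleR_sum_right)

lemma vector_field_conn:
  assumes "vector_field A X" "vector_field A Y" "bilinear m"
  shows "vector_field A (conn m X Y)"
  using vsmooth_add[OF vsmooth_vderiv[OF assms(1) vsmooth_coef[OF assms(2)]]
      vsmooth_bilinear[OF assms(3) vsmooth_coef[OF assms(1)] vsmooth_coef[OF assms(2)]]]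
  unfolding conn_def vsmooth_def by (intro vector_field_frame) blast

lemma coef_conn: "coef (conn m X Y) p = vderiv X (coef Y) p + m (coef X p) (coef Y p)"
  unfolding conn_def by (rule coef_frame)

lemma vector_field_eqI:
  assumes "vector_field A X" "vector_field A Y" "\<And>p. coef X p = coef Y p"
  shows "X = Y"
  using assms vector_field_eq_E by (intro ext) metis

lemma vector_field_diff: "vector_field A X \<Longrightarrow> vector_field A Y \<Longrightarrow> vector_field A (X - Y)"
proof -
  assume X: "vector_field A X" "vector_field A Y"
  have "X - Y = X + fmult (\<lambda>p. - 1) Y" by (auto simp: fmult_def fun_eq_iff)
  show ?thesis
    unfolding \<open>X - Y = _\<close> by (rule vector_field_add[OF X(1) vector_field_fmult[OF smooth_fun_const X(2)]])
qed

lemma affine_connection_conn: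
  assumes m: "bilinear m"
  shows "affine_connection A (conn m)"
  unfolding affine_connection_def
proof (intro allI impI conjI)
  fix X Y assume X: "vector_field A X" and Y: "vector_field A Y"
  show "vector_field A (conn m X Y)" by (rule vector_field_conn[OF X Y m])
  {
    fix Z assume Z: "vector_field A Z"
    show "conn m (X + Y) Z = conn m X Z + conn m Y Z"
      by (rule vector_field_eqI)
        (simp_all add: vector_field_conn vector_field_add X Y Z m coef_conn coef_add
          vderiv_add_field bilinear_ladd[OF m])
    have "coef (X + Y) = (\<lambda>q. coef X q + coef Y q)" by (simp add: coef_add fun_eq_iff)
    then show "conn m Z (X + Y) = conn m Z X + conn m Z Y"
      by (intro vector_field_eqI)
        (simp_all add: vector_field_conn vector_field_add X Y Z m coef_conn coef_add vderiv_add vsmooth_coef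
          bilinear_radd[OF m])
  next
    fix f assume f: "smooth_fun A f"
    show "conn m (fmult f X) Y = fmult f (conn m X Y)"
      by (rule vector_field_eqI)
        (simp_all add: vector_field_conn vector_field_fmult X Y f m coef_conn coef_fmult
          vderiv_fmult_field scaleR_add_right bilinear_lmul[OF m])
    have "coef (fmult f Y) = (\<lambda>q. f q *\<^sub>R coef Y q)" by (simp add: coef_fmult fun_eq_iff)
    then show "conn m X (fmult f Y) = fmult (X f) Y + fmult f (conn m X Y)"
      by (intro vector_field_eqI)
        (simp_all add: vector_field_conn vector_field_fmult vector_field_add vector_field_smooth
          X Y f m coef_conn coef_fmult coef_add vderiv_scaleR vsmooth_coef scaleR_add_right bilinear_rmul[OF m])
  }
qed

lemma left_invariant_conn: "left_invariant A (conn m)"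
  unfolding left_invariant_def
proof (intro allI impI ext)
  fix g X Y f p
  have "vderiv (left_push g X) (coef (left_push g Y)) p = vderiv X (coef Y) (- g + p)"
    unfolding vderiv_def coef_left_push by (simp add: left_push_def add.assoc[symmetric])
  moreover have "left_push g (conn m X Y) f p =
      left_push g (E (vderiv X (coef Y) (- g + p) + m (coef X (- g + p)) (coef Y (- g + p)))) f p"
    unfolding left_push_def conn_def by simp
  ultimately show "conn m (left_push g X) (left_push g Y) f p = left_push g (conn m X Y) f p"
    by (simp add: conn_def coef_left_push left_push_E)
qed

text \<open>With \<open>Y\<close> written in the frame, \<open>X\<close> differentiates either the
  coordinates, leaving a first-order term, or the invariant derivatives of \<open>f\<close>. In the
  second term the coordinates are frozen at \<open>p\<close>, so antisymmetrizing it produces the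
  bracket of two left-invariant fields.\<close>

lemma iterated_derivative:
  assumes X: "vector_field A X" and Y: "vector_field A Y" and f: "smooth_fun A f"
  shows "X (Y f) p = E (vderiv X (coef Y) p) f p + E (coef X p) (E (coef Y p) f) p"
proof -
  have E: "E v f q = (\<Sum>b\<in>Basis. (v \<bullet> b) * E b f q)" for v q
    using linear_basis_expansion[OF E_linear_arg[OF f, of q], of v] by simp
  have s: "smooth_fun A (\<lambda>q. coef Y q \<bullet> b)" "smooth_fun A (E b f)" for b
    using smooth_fun_coef[OF Y] vector_field_smooth[OF vector_field_E f] by auto
  have "Y f = (\<lambda>q. \<Sum>b\<in>Basis. (coef Y q \<bullet> b) * E b f q)"
    by (intro ext) (subst vector_field_eq_E[OF Y], rule E)
  then have "X (Y f) p = (\<Sum>b\<in>Basis. X (\<lambda>q. coef Y q \<bullet> b) p * E b f p + (coef Y p \<bullet> b) * X (E b f) p)"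
    by (simp add: vector_field_sum_fun[OF X] smooth_fun_mult s vector_field_mult_fun[OF X])
  moreover have "E (vderiv X (coef Y) p) f p = (\<Sum>b\<in>Basis. X (\<lambda>q. coef Y q \<bullet> b) p * E b f p)"
    by (subst E) (simp add: vderiv_inner)
  moreover have "E (coef Y p) f = (\<lambda>q. \<Sum>b\<in>Basis. (coef Y p \<bullet> b) * E b f q)"
    by (intro ext) (rule E)
  then have "E (coef X p) (E (coef Y p) f) p = (\<Sum>b\<in>Basis. (coef Y p \<bullet> b) * X (E b f) p)"
    by (simp add: vector_field_sum_fun[OF vector_field_E] smooth_fun_mult smooth_fun_const s
        vector_field_cmult_fun[OF vector_field_E] vector_field_eq_E[OF X, of "E _ f"])
  ultimately show ?thesis by (simp add: sum.distrib)
qed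

lemma left_push_lie_bracket:
  "left_push g (lie_bracket X Y) = lie_bracket (left_push g X) (left_push g Y)"
  by (simp add: left_push_def lie_bracket_def fun_eq_iff add.assoc[symmetric])

text \<open>Structure constants, read off at the neutral element. That \<open>E (br u v)\<close> is
  the whole bracket also requires the bracket to be a vector field, which a torsion-free connection
  supplies below.\<close>

definition br :: "'m \<Rightarrow> 'm \<Rightarrow> 'm"
  where "br u v = coef (lie_bracket (E u) (E v)) 0"

end

locale affine_lie_grp_frame = lie_grp_frame +
  assumes affine: "affine_lie_group A"
begin

text \<open>A torsion-free connection expresses the bracket through covariant derivatives, so the symmetry
  of second derivatives is not needed here.\<close>

lemma vector_field_lie_bracket:
  assumes "vector_field A X" "vector_field A Y"
  shows "vector_field A (lie_bracket X Y)"
proof -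
  obtain nab where "affine_connection A nab" "torsion_free A nab"
    using affine unfolding affine_lie_group_def left_invariant_affine_structure_def by blast
  then have "vector_field A (nab X Y)" "vector_field A (nab Y X)" "lie_bracket X Y = nab X Y - nab Y X"
    using assms unfolding affine_connection_def torsion_free_def by auto
  then show ?thesis by (simp add: vector_field_diff)
qed

lemma E_br: "E (br u v) = lie_bracket (E u) (E v)"
proof -
  have "lie_bracket (E u) (E v) \<in> lie_algebra A"
    by (simp add: lie_algebra_def vector_field_lie_bracket vector_field_E left_push_lie_bracket left_push_E)
  then show ?thesis using lie_algebra_eq br_def by metis
qed

lemma coef_lie_bracket:
  assumes X: "vector_field A X" and Y: "vector_field A Y"
  shows "coef (lie_bracket X Y) p = vderiv X (coef Y) p - vderiv Y (coef X) p + br (coef X p) (coef Y p)"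
proof -
  have "lie_bracket X Y f p =
      E (vderiv X (coef Y) p - vderiv Y (coef X) p + br (coef X p) (coef Y p)) f p"
    if "smooth_fun A f" for f
    using iterated_derivative[OF X Y that, of p] iterated_derivative[OF Y X that, of p]
      fun_cong[OF fun_cong[OF E_br], of "coef X p" "coef Y p" f p]
    by (simp add: linear_add[OF E_linear_arg[OF that]] linear_diff[OF E_linear_arg[OF that]] lie_bracket_def)
  then have "coef (lie_bracket X Y) p =
      coef (E (vderiv X (coef Y) p - vderiv Y (coef X) p + br (coef X p) (coef Y p))) p"
    unfolding coef_def using smooth_fun_translate[OF F_smooth] by (intro sum.cong) auto
  then show ?thesis by (simp add: coef_E)
qed

lemma torsion_free_conn:
  assumes "bilinear m" "\<And>u v. m u v - m v u = br u v"
  shows "torsion_free A (conn m)"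
  unfolding torsion_free_def
  by (auto intro!: vector_field_eqI vector_field_diff vector_field_conn vector_field_lie_bracket assms(1)
      simp: coef_lie_bracket coef_diff coef_conn assms(2)[symmetric])

text \<open>In the curvature, the second derivatives of \<open>Z\<close> are accounted for by
  \<open>d\<close>, the terms that differentiate the coordinates of \<open>X\<close> or
  \<open>Y\<close> match the derivative part of the bracket, and the other mixed terms cancel by the
  Leibniz rule. What remains is left symmetry of \<open>m\<close> at each point.\<close>

lemma flat_conn:
  assumes m: "left_symmetric m" and br: "\<And>u v. m u v - m v u = br u v"
  shows "flat A (conn m)"
  unfolding flat_def
proof (intro allI impI)
  fix X Y Z assume X: "vector_field A X" and Y: "vector_field A Y" and Z: "vector_field A Z"
  have bm: "bilinear m" using m by (simp add: left_symmetric_def)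
  note vf = X Y Z vector_field_conn[OF _ _ bm] vector_field_diff vector_field_lie_bracket
  note s = vsmooth_coef vsmooth_vderiv vsmooth_bilinear[OF bm] vf
  have conn: "coef (conn m X' Y') = (\<lambda>p. vderiv X' (coef Y') p + m (coef X' p) (coef Y' p))" for X' Y'
    by (simp add: coef_conn fun_eq_iff)
  \<comment> \<open>The bracket is by definition the commutator of the two operators, here applied
    to the coordinate functions of \<open>Z\<close>.\<close>
  have d: "vderiv (lie_bracket X Y) (coef Z) p =
      vderiv X (vderiv Y (coef Z)) p - vderiv Y (vderiv X (coef Z)) p" for p
    by (rule euclidean_eqI) (simp add: vderiv_inner inner_diff_left lie_bracket_def)
  show "conn m X (conn m Y Z) - conn m Y (conn m X Z) = conn m (lie_bracket X Y) Z"
  proof (rule vector_field_eqI)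
    fix p
    let ?x = "coef X p" and ?y = "coef Y p" and ?z = "coef Z p"
    have "m (br ?x ?y) ?z = m ?x (m ?y ?z) - m ?y (m ?x ?z)"
      using m unfolding left_symmetric_def br[symmetric] by blast
    then show "coef (conn m X (conn m Y Z) - conn m Y (conn m X Z)) p =
        coef (conn m (lie_bracket X Y) Z) p"
      by (simp add: coef_diff coef_conn d coef_lie_bracket X Y)
        (simp add: conn vderiv_add vderiv_bilinear[OF _ bm] s bilinear_ladd[OF bm] bilinear_radd[OF bm]
          bilinear_lsub[OF bm])
  qed (simp_all add: vf)
qed

lemma conn_left_invariant_affine_structure:
  assumes "left_symmetric m" "\<And>u v. m u v - m v u = br u v"
  shows "left_invariant_affine_structure A (conn m)"
  using assms affine_connection_conn left_invariant_conn flat_conn torsion_free_conn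
  by (simp add: left_invariant_affine_structure_def left_symmetric_def)

lemma conn_E: "conn m (E u) (E v) = E (m u v)"
proof -
  have "coef (E v) = (\<lambda>p. v)" by (simp add: coef_E fun_eq_iff)
  then show ?thesis by (simp add: conn_def coef_E vderiv_const[OF vector_field_E])
qed

lemma product_of_connection:
  assumes nab: "left_invariant_affine_structure A nab"
  obtains m where "left_symmetric m" "\<And>u v. m u v - m v u = br u v" "\<And>u v. nab (E u) (E v) = E (m u v)"
proof -
  have n: "affine_connection A nab" "left_invariant A nab" "flat A nab" "torsion_free A nab"
    using nab by (auto simp: left_invariant_affine_structure_def)
  note E = vector_field_E
  define m where "m u v = coef (nab (E u) (E v)) 0" for u v
  have "nab (E u) (E v) \<in> lie_algebra A" for u v
  proof -
    have "vector_field A (nab (E u) (E v))"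
      using n(1) E unfolding affine_connection_def by blast
    moreover have "left_push g (nab (E u) (E v)) = nab (left_push g (E u)) (left_push g (E v))" for g
      using n(2) E unfolding left_invariant_def by simp
    ultimately show ?thesis by (simp add: lie_algebra_def left_push_E)
  qed
  then have nE: "nab (E u) (E v) = E (m u v)" for u v
    using lie_algebra_eq m_def by metis
  have inj: "E u = E v \<Longrightarrow> u = v" for u v using inj_E by (simp add: inj_eq)
  have c: "c *\<^sub>R X = fmult (\<lambda>p. c) X" for c X by (simp add: scaleR_fun_def fmult_def fun_eq_iff)
  have "nab (E u + E v) (E w) = nab (E u) (E w) + nab (E v) (E w)"
    "nab (E w) (E u + E v) = nab (E w) (E u) + nab (E w) (E v)" for u v w
    using n(1) E unfolding affine_connection_def by blast+
  moreover have "nab (c *\<^sub>R E u) (E v) = c *\<^sub>R nab (E u) (E v)"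
    "nab (E u) (c *\<^sub>R E v) = c *\<^sub>R nab (E u) (E v)" for c u v
  proof -
    \<comment> \<open>Real homogeneity in the second argument is the Leibniz rule for a constant
      function, whose derivative term vanishes.\<close>
    have z: "fmult (E u (\<lambda>p. c)) (E v) = 0"
      by (simp add: fmult_def fun_eq_iff vector_field_const[OF E])
    show "nab (c *\<^sub>R E u) (E v) = c *\<^sub>R nab (E u) (E v)"
      using n(1) E smooth_fun_const[of c] unfolding c affine_connection_def by blast
    have "nab (E u) (fmult (\<lambda>p. c) (E v)) = fmult (E u (\<lambda>p. c)) (E v) + fmult (\<lambda>p. c) (nab (E u) (E v))"
      using n(1) E smooth_fun_const[of c] unfolding affine_connection_def by blast
    then show "nab (E u) (c *\<^sub>R E v) = c *\<^sub>R nab (E u) (E v)"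
      unfolding c z by simp
  qed
  ultimately have "bilinear m"
    unfolding bilinear_def
    by (auto intro!: linearI inj simp: linear_add[OF linear_E] linear_scale[OF linear_E] nE[symmetric])
  moreover have br: "m u v - m v u = br u v" for u v
    using n(4) E unfolding torsion_free_def
    by (auto intro!: inj simp: linear_diff[OF linear_E] nE[symmetric] E_br)
  moreover have "m (m u v - m v u) w = m u (m v w) - m v (m u w)" for u v w
  proof (rule inj)
    have "nab (E u) (nab (E v) (E w)) - nab (E v) (nab (E u) (E w)) = nab (lie_bracket (E u) (E v)) (E w)"
      using n(3) E unfolding flat_def by blast
    then show "E (m (m u v - m v u) w) = E (m u (m v w) - m v (m u w))"
      by (simp add: br linear_diff[OF linear_E] nE E_br[symmetric])
  qed
  ultimately show ?thesis
    by (intro that[of m]) (auto simp: left_symmetric_def nE)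
qed

end

section \<open>Models of the Lie algebra\<close>

text \<open>All that is used of the geometry later: a linear identification of the Lie algebra with
  the model space under which left-invariant affine structures and left-symmetric products with
  commutator \<open>br\<close> translate into each other. Since it survives a change of basis, the
  remaining work is algebra on one vector space.\<close>

definition lie_model ::
    "('g::{topological_group_add,t2_space,second_countable_topology}, 'm::euclidean_space) atlas \<Rightarrow>
      ('m \<Rightarrow> 'g field) \<Rightarrow> ('m \<Rightarrow> 'm \<Rightarrow> 'm) \<Rightarrow> bool"
  where "lie_model A T br \<longleftrightarrow> linear T \<and> bij_betw T UNIV (lie_algebra A) \<and>
    (\<forall>u v. T (br u v) = lie_bracket (T u) (T v)) \<and>
    (\<forall>nab. left_invariant_affine_structure A nab \<longrightarrow>
      (\<exists>m. left_symmetric m \<and> (\<forall>u v. m u v - m v u = br u v) \<and> (\<forall>u v. nab (T u) (T v) = T (m u v)))) \<and>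
    (\<forall>m. left_symmetric m \<and> (\<forall>u v. m u v - m v u = br u v) \<longrightarrow>
      (\<exists>nab. left_invariant_affine_structure A nab \<and> (\<forall>u v. nab (T u) (T v) = T (m u v))))"

lemma lie_model_exists:
  assumes "lie_group A" "affine_lie_group A"
  obtains T br where "lie_model A T br"
proof -
  interpret lie_grp A by unfold_locales (rule assms(1))
  obtain V \<psi> F where "lie_grp_frame A V \<psi> F" using frame_exists by blast
  then interpret affine_lie_grp_frame A V \<psi> F
    using assms(2) by (simp add: affine_lie_grp_frame_def affine_lie_grp_frame_axioms_def)
  have "lie_model A E br"
    unfolding lie_model_def
  proof (intro conjI allI impI)
    show "bij_betw E UNIV (lie_algebra A)"
      by (simp add: bij_betw_def inj_E lie_algebra_eq_range)
    show "\<exists>m. left_symmetric m \<and> (\<forall>u v. m u v - m v u = br u v) \<and> (\<forall>u v. nab (E u) (E v) = E (m u v))"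
      if "left_invariant_affine_structure A nab" for nab
      by (rule product_of_connection[OF that]) blast
    show "\<exists>nab. left_invariant_affine_structure A nab \<and> (\<forall>u v. nab (E u) (E v) = E (m u v))"
      if "left_symmetric m \<and> (\<forall>u v. m u v - m v u = br u v)" for m
      using that by (intro exI[of _ "conn m"]) (simp add: conn_E conn_left_invariant_affine_structure)
  qed (auto simp: linear_E E_br)
  then show ?thesis by (rule that)
qed

lemma lie_model_isomorphic: "lie_model A T br \<Longrightarrow> lie_algebra_isomorphic A br"
  unfolding lie_model_def lie_algebra_isomorphic_def by blast

lemma bilinear_compose:
  assumes "bilinear m" "linear S" "linear R"
  shows "bilinear (\<lambda>x y. R (m (S x) (S y)))"
  by (auto intro!: linearI simp: bilinear_def linear_add[OF assms(2)] linear_scale[OF assms(2)]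
      linear_add[OF assms(3)] linear_scale[OF assms(3)] bilinear_ladd[OF assms(1)]
      bilinear_radd[OF assms(1)] bilinear_lmul[OF assms(1)] bilinear_rmul[OF assms(1)])

lemma left_symmetric_conjugate:
  assumes m: "left_symmetric m" and S: "linear S" and R: "linear R"
    and SR: "\<And>x. S (R x) = x"
  shows "left_symmetric (\<lambda>x y. R (m (S x) (S y)))"
  using m bilinear_compose[OF _ S R, of m] unfolding left_symmetric_def
  by (simp add: SR linear_diff[OF S] linear_diff[OF R, symmetric])

lemma lie_model_change_basis:
  assumes M: "lie_model A T br" and S: "linear S" "bij S"
    and br: "\<And>x y. br (S x) (S y) = S (br' x y)"
  shows "lie_model A (T \<circ> S) br'"
proof -
  obtain R where R: "linear R" "\<And>x. R (S x) = x" "\<And>x. S (R x) = x"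
    using linear_injective_left_inverse[OF S(1) bij_is_inj[OF S(2)]] S
    by (metis bij_inv_eq_iff bij_is_surj comp_apply id_apply surj_f_inv_f)
  have T: "linear T" "bij_betw T UNIV (lie_algebra A)" "\<And>u v. T (br u v) = lie_bracket (T u) (T v)"
    and N: "\<And>nab. left_invariant_affine_structure A nab \<Longrightarrow>
      \<exists>m. left_symmetric m \<and> (\<forall>u v. m u v - m v u = br u v) \<and> (\<forall>u v. nab (T u) (T v) = T (m u v))"
    and C: "\<And>m. left_symmetric m \<Longrightarrow> (\<And>u v. m u v - m v u = br u v) \<Longrightarrow>
      \<exists>nab. left_invariant_affine_structure A nab \<and> (\<forall>u v. nab (T u) (T v) = T (m u v))"
    using M unfolding lie_model_def by blast+
  show ?thesis
    unfolding lie_model_def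
  proof (intro conjI allI impI)
    show "linear (T \<circ> S)" using S(1) T(1) by (rule linear_compose)
    show "bij_betw (T \<circ> S) UNIV (lie_algebra A)" using S(2) T(2) by (rule bij_betw_trans)
    show "(T \<circ> S) (br' u v) = lie_bracket ((T \<circ> S) u) ((T \<circ> S) v)" for u v
      by (simp add: br[symmetric] T(3))
  next
    fix nab assume "left_invariant_affine_structure A nab"
    then obtain m where m: "left_symmetric m" "\<And>u v. m u v - m v u = br u v"
      "\<And>u v. nab (T u) (T v) = T (m u v)" using N by blast
    show "\<exists>m. left_symmetric m \<and> (\<forall>u v. m u v - m v u = br' u v) \<and>
        (\<forall>u v. nab ((T \<circ> S) u) ((T \<circ> S) v) = (T \<circ> S) (m u v))"
      using left_symmetric_conjugate[OF m(1) S(1) R(1,3)]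
      by (intro exI[of _ "\<lambda>x y. R (m (S x) (S y))"])
        (simp add: linear_diff[OF R(1), symmetric] m(2,3) br R(2,3))
  next
    fix m assume m: "left_symmetric m \<and> (\<forall>u v. m u v - m v u = br' u v)"
    let ?m = "\<lambda>x y. S (m (R x) (R y))"
    have "left_symmetric ?m" using left_symmetric_conjugate[OF _ R(1) S(1) R(2)] m by blast
    moreover have "?m u v - ?m v u = br u v" for u v
      using m br[of "R u" "R v"] by (simp add: linear_diff[OF S(1), symmetric] R(3))
    ultimately obtain nab where "left_invariant_affine_structure A nab" "\<And>u v. nab (T u) (T v) = T (?m u v)"
      using C by blast
    then show "\<exists>nab. left_invariant_affine_structure A nab \<and>
        (\<forall>u v. nab ((T \<circ> S) u) ((T \<circ> S) v) = (T \<circ> S) (m u v))"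
      by (intro exI[of _ nab]) (simp add: R(2))
  qed
qed

lemma lie_model_of_isomorphic:
  assumes M: "lie_model A T br" and iso: "lie_algebra_isomorphic A br'"
  obtains T' where "lie_model A T' br'"
proof -
  have T: "linear T" "bij_betw T UNIV (lie_algebra A)" "\<And>u v. T (br u v) = lie_bracket (T u) (T v)"
    using M unfolding lie_model_def by blast+
  obtain T' where T': "linear T'" "bij_betw T' UNIV (lie_algebra A)" "\<And>u v. T' (br' u v) = lie_bracket (T' u) (T' v)"
    using iso unfolding lie_algebra_isomorphic_def by blast
  define S where "S = inv T \<circ> T'"
  have TS: "T (S x) = T' x" for x
    unfolding S_def comp_apply using T(2) T'(2)
    by (intro f_inv_into_f) (auto simp: bij_betw_def)
  have inj: "T x = T y \<Longrightarrow> x = y" for x y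
    using T(2) unfolding bij_betw_def inj_def by blast
  have "bij_betw (inv T) (lie_algebra A) UNIV" using T(2) by (rule bij_betw_inv_into)
  then have "bij S" unfolding S_def by (rule bij_betw_trans[OF T'(2)])
  moreover have "linear S"
    by (intro linearI inj) (simp_all add: TS linear_add[OF T(1)] linear_scale[OF T(1)] linear_add[OF T'(1)] linear_scale[OF T'(1)])
  moreover have "br (S x) (S y) = S (br' x y)" for x y
    by (rule inj) (simp add: T(3) T'(3) TS)
  ultimately show ?thesis using that lie_model_change_basis[OF M] by blast
qed

lemma lie_model_lie_algebra: "lie_model A T br \<Longrightarrow> lie_algebra A = range T"
  by (simp add: lie_model_def bij_betw_def)

lemma lie_model_connection:
  assumes "lie_model A T br" "left_symmetric m" "\<And>u v. m u v - m v u = br u v"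
  obtains nab where "left_invariant_affine_structure A nab" "\<And>u v. nab (T u) (T v) = T (m u v)"
  using assms unfolding lie_model_def by blast

text \<open>\<open>m (m x y) z = 0\<close> says that any two right multiplications compose to zero:
  each has square zero, and all of them commute.\<close>

lemma lie_model_complete_novikov:
  assumes M: "lie_model A T br" and m: "left_symmetric m" "\<And>u v. m u v - m v u = br u v"
    and z: "\<And>x y z. m (m x y) z = 0"
  shows "complete_lie_group A" and "novikov_lie_group A"
proof -
  obtain nab where nab: "left_invariant_affine_structure A nab" "\<And>u v. nab (T u) (T v) = T (m u v)"
    using lie_model_connection[OF M m] by blast
  have "T 0 = 0" using M by (simp add: lie_model_def linear_0)
  then have "complete_structure A nab" "novikov_structure A nab"
    unfolding complete_structure_def novikov_structure_def lie_model_lie_algebra[OF M]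
    by (auto intro!: exI[of _ 2] simp: numeral_2_eq_2 nab(2) z)
  then show "complete_lie_group A" "novikov_lie_group A"
    using nab(1) by (auto simp: complete_lie_group_def novikov_lie_group_def)
qed

lemma lie_model_radiant:
  assumes M: "lie_model A T br" and m: "left_symmetric m" "\<And>u v. m u v - m v u = br u v"
    and z: "\<And>x. m x z = x"
  shows "radiant_lie_group A"
proof -
  obtain nab where nab: "left_invariant_affine_structure A nab" "\<And>u v. nab (T u) (T v) = T (m u v)"
    using lie_model_connection[OF M m] by blast
  have "radiant_structure A nab"
    unfolding radiant_structure_def lie_model_lie_algebra[OF M]
    by (rule bexI[of _ "T z"]) (auto simp: nab(2) z)
  then show ?thesis using nab(1) by (auto simp: radiant_lie_group_def)
qed

lemma lie_model_associative:
  assumes M: "lie_model A T br" and m: "bilinear m" "\<And>u v. m u v - m v u = br u v"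
    and a: "\<And>x y z. m (m x y) z = m x (m y z)"
  shows "associative_lie_group A"
proof -
  have "left_symmetric m"
    using m(1) by (simp add: left_symmetric_def bilinear_lsub a)
  then obtain nab where nab: "left_invariant_affine_structure A nab" "\<And>u v. nab (T u) (T v) = T (m u v)"
    using lie_model_connection[OF M _ m(2)] by blast
  have "associative_structure A nab"
    unfolding associative_structure_def lie_model_lie_algebra[OF M] associator_def
    by (auto simp: nab(2) a)
  then show ?thesis using nab(1) by (auto simp: associative_lie_group_def)
qed

lemma associative_imp_bisymmetric: "associative_lie_group A \<Longrightarrow> bisymmetric_lie_group A"
  unfolding associative_lie_group_def bisymmetric_lie_group_def associative_structure_def
    bisymmetric_structure_def by metis

lemma lie_model_bisymmetric:
  assumes M: "lie_model A T br" and b: "bisymmetric_lie_group A"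
  obtains m where "left_symmetric m" "\<And>u v. m u v - m v u = br u v"
    "\<And>x y z. m (m x y) z - m x (m y z) = m (m x z) y - m x (m z y)"
proof -
  obtain nab where nab: "left_invariant_affine_structure A nab" "bisymmetric_structure A nab"
    using b by (auto simp: bisymmetric_lie_group_def)
  obtain m where m: "left_symmetric m" "\<And>u v. m u v - m v u = br u v" "\<And>u v. nab (T u) (T v) = T (m u v)"
    using M nab(1) unfolding lie_model_def by blast
  have T: "linear T" "inj T" using M by (auto simp: lie_model_def bij_betw_def)
  have "T (m (m x y) z - m x (m y z)) = T (m (m x z) y - m x (m z y))" for x y z
    using nab(2) unfolding bisymmetric_structure_def lie_model_lie_algebra[OF M] associator_def
    by (simp add: m(3) linear_diff[OF T(1)])
  then have "m (m x y) z - m x (m y z) = m (m x z) y - m x (m z y)" for x y z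
    using T(2) by (simp add: inj_eq)
  then show ?thesis using that m(1,2) by blast
qed

section \<open>Three-dimensional algebra\<close>

lemma axis3_simps [simp]:
  "(axis 1 c :: real ^ 3) $ 1 = c" "(axis 1 c :: real ^ 3) $ 2 = 0" "(axis 1 c :: real ^ 3) $ 3 = 0"
  "(axis 2 c :: real ^ 3) $ 1 = 0" "(axis 2 c :: real ^ 3) $ 2 = c" "(axis 2 c :: real ^ 3) $ 3 = 0"
  "(axis 3 c :: real ^ 3) $ 1 = 0" "(axis 3 c :: real ^ 3) $ 2 = 0" "(axis 3 c :: real ^ 3) $ 3 = c"
  by (simp_all add: axis_def)

lemma vec3_eq_iff: "(x :: real ^ 3) = y \<longleftrightarrow> x $ 1 = y $ 1 \<and> x $ 2 = y $ 2 \<and> x $ 3 = y $ 3"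
  by (simp add: vec_eq_iff forall_3)

lemma vec3_expansion: "(x :: real ^ 3) = x $ 1 *\<^sub>R e1 + x $ 2 *\<^sub>R e2 + x $ 3 *\<^sub>R e3"
  by (simp add: vec3_eq_iff)

definition of_basis :: "real ^ 3 \<Rightarrow> real ^ 3 \<Rightarrow> real ^ 3 \<Rightarrow> real ^ 3 \<Rightarrow> real ^ 3"
  where "of_basis u v w x = x $ 1 *\<^sub>R u + x $ 2 *\<^sub>R v + x $ 3 *\<^sub>R w"

lemma linear_of_basis: "linear (of_basis u v w)"
  by (auto intro!: linearI simp: of_basis_def algebra_simps)

lemma bij_of_basis:
  assumes "\<And>a b c. a *\<^sub>R u + b *\<^sub>R v + c *\<^sub>R w = 0 \<Longrightarrow> a = 0 \<and> b = 0 \<and> c = 0"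
  shows "bij (of_basis u v w)"
proof -
  have "x = 0" if "of_basis u v w x = 0" for x
    using assms[of "x $ 1" "x $ 2" "x $ 3"] that by (simp add: of_basis_def vec3_eq_iff[of x 0])
  then have "inj (of_basis u v w)"
    unfolding linear_injective_0[OF linear_of_basis] by blast
  then show ?thesis
    using linear_injective_imp_surjective[OF linear_of_basis] by (simp add: bij_def)
qed

lemma of_basis_bracket:
  assumes b: "bilinear br" and alt: "\<And>x y. br x y = - br y x"
    and c: "br u v = of_basis u v w c12" "br u w = of_basis u v w c13" "br v w = of_basis u v w c23"
  shows "br (of_basis u v w x) (of_basis u v w y) = of_basis u v w (bracket3 c12 c13 c23 x y)"
proof -
  have z: "br z z = 0" for z using alt[of z z] by (simp add: vec3_eq_iff)
  have "br (of_basis u v w x) (of_basis u v w y) = (x $ 1 * y $ 2 - x $ 2 * y $ 1) *\<^sub>R br u v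
      + (x $ 1 * y $ 3 - x $ 3 * y $ 1) *\<^sub>R br u w + (x $ 2 * y $ 3 - x $ 3 * y $ 2) *\<^sub>R br v w"
    unfolding of_basis_def
    by (simp add: bilinear_ladd[OF b] bilinear_radd[OF b] bilinear_lmul[OF b] bilinear_rmul[OF b] z
        alt[of v u] alt[of w u] alt[of w v] algebra_simps)
  also have "\<dots> = of_basis u v w (bracket3 c12 c13 c23 x y)"
    unfolding c bracket3_def by (simp add: linear_add[OF linear_of_basis] linear_scale[OF linear_of_basis])
  finally show ?thesis .
qed

lemma of_basis_axis [simp]:
  "of_basis u v w e1 = u" "of_basis u v w e2 = v" "of_basis u v w e3 = w" "of_basis u v w 0 = 0"
  by (simp_all add: of_basis_def)

lemma bilinear_bracket3: "bilinear (bracket3 c12 c13 c23)"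
  unfolding bilinear_def bracket3_def by (auto intro!: linearI simp: algebra_simps)

lemma bracket3_alternating: "bracket3 c12 c13 c23 x y = - bracket3 c12 c13 c23 y x"
  by (simp add: bracket3_def vec3_eq_iff algebra_simps)

section \<open>Traces and representations of simple brackets\<close>

definition tr3 :: "(real ^ 3 \<Rightarrow> real ^ 3) \<Rightarrow> real"
  where "tr3 f = f e1 $ 1 + f e2 $ 2 + f e3 $ 3"

lemma linear_vec3:
  fixes f :: "real ^ 3 \<Rightarrow> 'b::real_vector"
  assumes "linear f"
  shows "f x = x $ 1 *\<^sub>R f e1 + x $ 2 *\<^sub>R f e2 + x $ 3 *\<^sub>R f e3"
  by (subst vec3_expansion[of x]) (simp add: linear_add[OF assms] linear_scale[OF assms])

lemma tr3_commute:
  assumes "linear f" "linear g"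
  shows "tr3 (\<lambda>x. f (g x)) = tr3 (\<lambda>x. g (f x))"
  unfolding tr3_def linear_vec3[OF assms(1), of "g _"] linear_vec3[OF assms(2), of "f _"]
  by (simp add: algebra_simps)

lemma tr3_diff: "tr3 (\<lambda>x. f x - g x) = tr3 f - tr3 g"
  by (simp add: tr3_def)

lemma tr3_scale: "tr3 (\<lambda>x. c *\<^sub>R f x) = c * tr3 f"
  by (simp add: tr3_def algebra_simps)

text \<open>The theorem of Cayley and Hamilton, with the coefficients expressed by power sums.\<close>

lemma nilpotent_of_traces:
  assumes f: "linear f" and t: "tr3 f = 0" "tr3 (\<lambda>x. f (f x)) = 0" "tr3 (\<lambda>x. f (f (f x))) = 0"
  shows "f (f (f x)) = 0"
proof -
  define a b c where "a = f e1" and "b = f e2" and "c = f e3"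
  have e: "f y = y $ 1 *\<^sub>R a + y $ 2 *\<^sub>R b + y $ 3 *\<^sub>R c" for y
    unfolding a_def b_def c_def by (rule linear_vec3[OF f])
  define p1 p2 p3 where "p1 = tr3 f" and "p2 = tr3 (\<lambda>x. f (f x))" and "p3 = tr3 (\<lambda>x. f (f (f x)))"
  note p = p1_def[unfolded tr3_def e] p2_def[unfolded tr3_def e] p3_def[unfolded tr3_def e]
  have "6 * (f (f (f x)) $ i) = 6 * p1 * (f (f x) $ i) - 3 * (p1 ^ 2 - p2) * (f x $ i)
      + (p1 ^ 3 - 3 * p1 * p2 + 2 * p3) * (x $ i)" if "i = 1 \<or> i = 2 \<or> i = 3" for i
    unfolding p e using that by (elim disjE) (simp_all add: algebra_simps power2_eq_square power3_eq_cube)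
  then show ?thesis
    using t unfolding p1_def p2_def p3_def by (simp add: vec3_eq_iff)
qed

text \<open>The operators represent a simple bracket, and the last hypothesis says that the Casimir
  operator has trace zero. As commutators are traceless, the first three power traces of
  \<open>A\<close> vanish, so \<open>A\<close> is nilpotent and with it \<open>ad A\<close>. But
  \<open>B\<close> satisfies an eigenvalue equation for the square of \<open>ad A\<close> with a
  nonzero eigenvalue, so \<open>B\<close> vanishes.\<close>

lemma simple_triple_trivial:
  assumes l: "linear A" "linear B" "linear C"
    and AB: "\<And>x. A (B x) - B (A x) = c *\<^sub>R C x" and BC: "\<And>x. B (C x) - C (B x) = a *\<^sub>R A x"
    and CA: "\<And>x. C (A x) - A (C x) = b *\<^sub>R B x" and nz: "a \<noteq> 0" "b \<noteq> 0" "c \<noteq> 0"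
    and t: "a * tr3 (\<lambda>x. A (A x)) + b * tr3 (\<lambda>x. B (B x)) + c * tr3 (\<lambda>x. C (C x)) = 0"
  shows "B x = 0"
proof -
  have lc: "linear (\<lambda>x. f (g x))" if "linear f" "linear g" for f g :: "real ^ 3 \<Rightarrow> real ^ 3"
    using linear_compose[OF that(2,1)] by (simp add: o_def)
  note ll = lc[OF l(1) l(2)] lc[OF l(1) l(3)] lc[OF l(2) l(3)] lc[OF l(3) l(2)] lc[OF l(1) l(1)] lc[OF l(3) l(1)]
  note sc = linear_scale[OF l(1)] linear_scale[OF l(2)] linear_scale[OF l(3)]
  note df = linear_diff[OF l(1)] linear_diff[OF l(2)] linear_diff[OF l(3)]
  have "a * tr3 A = tr3 (\<lambda>x. B (C x)) - tr3 (\<lambda>x. C (B x))"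
    by (simp add: tr3_diff[symmetric] BC tr3_scale)
  then have t1: "tr3 A = 0" using tr3_commute[OF l(2,3)] nz by simp
  \<comment> \<open>Invariance of the trace form: each of the three weighted traces of squares
    equals \<open>p - q\<close>, so their vanishing sum makes each of them vanish.\<close>
  define p q where "p = tr3 (\<lambda>x. A (B (C x)))" and "q = tr3 (\<lambda>x. A (C (B x)))"
  have "a * tr3 (\<lambda>x. A (A x)) = tr3 (\<lambda>x. A (B (C x) - C (B x)))"
    by (simp add: BC sc tr3_scale)
  then have a2: "a * tr3 (\<lambda>x. A (A x)) = p - q"
    by (simp add: df tr3_diff p_def q_def)
  have "b * tr3 (\<lambda>x. B (B x)) = tr3 (\<lambda>x. B (C (A x) - A (C x)))"
    by (simp add: CA sc tr3_scale)
  also have "\<dots> = tr3 (\<lambda>x. B (C (A x))) - tr3 (\<lambda>x. B (A (C x)))"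
    by (simp add: df tr3_diff)
  also have "\<dots> = p - q"
    using tr3_commute[OF l(1) ll(3)] tr3_commute[OF l(2) ll(2)] by (simp add: p_def q_def)
  finally have b2: "b * tr3 (\<lambda>x. B (B x)) = p - q" .
  have "c * tr3 (\<lambda>x. C (C x)) = tr3 (\<lambda>x. C (A (B x) - B (A x)))"
    by (simp add: AB sc tr3_scale)
  also have "\<dots> = tr3 (\<lambda>x. C (A (B x))) - tr3 (\<lambda>x. C (B (A x)))"
    by (simp add: df tr3_diff)
  also have "\<dots> = p - q"
    using tr3_commute[OF l(3) ll(1)] tr3_commute[OF l(1) ll(4)] by (simp add: p_def q_def)
  finally have c2: "c * tr3 (\<lambda>x. C (C x)) = p - q" .
  have t2: "tr3 (\<lambda>x. A (A x)) = 0"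
    using t a2 b2 c2 nz by simp
  \<comment> \<open>Preparation for the cubic trace: with \<open>a A\<close> replaced by the
    commutator of \<open>B\<close> and \<open>C\<close>, moving \<open>C\<close> around the trace
    cancels the two terms.\<close>
  have "a * tr3 (\<lambda>x. C (C (A x))) = tr3 (\<lambda>x. C (C (B (C x) - C (B x))))"
    by (simp add: BC sc tr3_scale)
  also have "\<dots> = tr3 (\<lambda>x. C (C (B (C x)))) - tr3 (\<lambda>x. C (C (C (B x))))"
    by (simp add: df tr3_diff)
  also have "\<dots> = 0"
    using tr3_commute[OF l(3) lc[OF l(3) ll(4)]] by simp
  finally have ACC: "tr3 (\<lambda>x. C (C (A x))) = 0" using nz by simp
  have "a * tr3 (\<lambda>x. A (A (A x))) = tr3 (\<lambda>x. A (A (B (C x) - C (B x))))"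
    by (simp add: BC sc tr3_scale)
  also have "\<dots> = tr3 (\<lambda>x. A (A (B (C x)))) - tr3 (\<lambda>x. A (A (C (B x))))"
    by (simp add: df tr3_diff)
  also have "tr3 (\<lambda>x. A (A (C (B x)))) = tr3 (\<lambda>x. B (A (A (C x))))"
    using tr3_commute[OF lc[OF l(1) lc[OF l(1) l(3)]] l(2)] by simp
  \<comment> \<open>Commuting \<open>A\<close> and \<open>B\<close> in both terms reaches the common
    middle \<open>A B A C\<close>; the corrections are traces of \<open>C C A\<close> up to cyclic
    order.\<close>
  also have "(\<lambda>x. A (A (B (C x)))) = (\<lambda>x. A (B (A (C x))) + c *\<^sub>R A (C (C x)))"
  proof
    fix x
    have "A (B (C x)) = B (A (C x)) + c *\<^sub>R C (C x)" using AB[of "C x"] by (simp add: algebra_simps)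
    then show "A (A (B (C x))) = A (B (A (C x))) + c *\<^sub>R A (C (C x))"
      by (simp add: linear_add[OF l(1)] sc)
  qed
  also have "(\<lambda>x. B (A (A (C x)))) = (\<lambda>x. A (B (A (C x))) - c *\<^sub>R C (A (C x)))"
    using AB[of "A (C _)"] by (simp add: algebra_simps)
  also have "tr3 (\<lambda>x. A (B (A (C x))) + c *\<^sub>R A (C (C x))) - tr3 (\<lambda>x. A (B (A (C x))) - c *\<^sub>R C (A (C x))) =
      c * tr3 (\<lambda>x. A (C (C x))) + c * tr3 (\<lambda>x. C (A (C x)))"
    by (simp add: tr3_def algebra_simps)
  also have "\<dots> = 0"
    using ACC tr3_commute[OF l(1) lc[OF l(3) l(3)]] tr3_commute[OF l(3) lc[OF l(3) l(1)]] by simp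
  finally have t3: "tr3 (\<lambda>x. A (A (A x))) = 0" using nz by simp
  have N: "A (A (A x)) = 0" for x by (rule nilpotent_of_traces[OF l(1) t1 t2 t3])
  \<comment> \<open>The eigenvalue: \<open>[A, [A, B]] = c [A, C] = - b c B\<close>.\<close>
  define s where "s = - (b * c)"
  have s: "s \<noteq> 0" using nz by (simp add: s_def)
  have 1: "A (A (B x)) - 2 *\<^sub>R A (B (A x)) + B (A (A x)) = s *\<^sub>R B x" for x
  proof -
    have "A (A (B x) - B (A x)) - (A (B (A x)) - B (A (A x))) = c *\<^sub>R (A (C x) - C (A x))"
      unfolding AB by (simp add: sc algebra_simps)
    also have "A (C x) - C (A x) = - (b *\<^sub>R B x)"
      using CA[of x] by (simp add: algebra_simps)
    finally show ?thesis by (simp add: df s_def algebra_simps scaleR_2)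
  qed
  note z = linear_0[OF l(1)] linear_0[OF l(2)]
  note lin = linear_add[OF l(1)] linear_neg[OF l(1)] df sc
  \<comment> \<open>Relation \<open>1\<close> is multiplied by powers of \<open>A\<close> on either
    side, where the cube of \<open>A\<close> is zero: this kills \<open>B A A\<close>, then
    \<open>A A B\<close>, then \<open>A B\<close>, and finally \<open>B\<close> itself.\<close>
  have AAB: "A (A (B (A (A x)))) = s *\<^sub>R B (A (A x))" for x
    using 1[of "A (A x)"] by (simp add: N z)
  have "A (A (B (A (A x)))) = 0" for x
  proof -
    have "A (A (A (A (B (A (A x)))))) = s *\<^sub>R A (A (B (A (A x))))" for x
      using AAB[of x] by (simp add: sc)
    then show ?thesis using N s z by simp
  qed
  then have BAA: "B (A (A x)) = 0" for x using AAB[of x] s by simp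
  have "A (A (A (A (B x)) - 2 *\<^sub>R A (B (A x)) + B (A (A x)))) = s *\<^sub>R A (A (B x))" for x
    unfolding 1 by (simp add: sc)
  then have AAB0: "A (A (B x)) = 0" for x
    using N s by (simp add: lin BAA z)
  have "A (A (A (B x)) - 2 *\<^sub>R A (B (A x)) + B (A (A x))) = s *\<^sub>R A (B x)" for x
    unfolding 1 by (simp add: sc)
  then have "A (B x) = 0" for x
    using s by (simp add: lin BAA AAB0 z)
  then show ?thesis
    using 1[of x] s by (simp add: BAA z)
qed

text \<open>The signs of \<open>d1\<close>, \<open>d2\<close>, \<open>d3\<close> cover both real
  simple algebras at once. By \<open>simple_triple_trivial\<close> all left multiplications vanish,
  and then so does the bracket, contrary to \<open>d1 \<noteq> 0\<close>.\<close>

lemma no_left_symmetric_simple: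
  assumes m: "left_symmetric m" and nz: "d1 \<noteq> 0" "d2 \<noteq> 0" "d3 \<noteq> 0"
    and c: "\<And>x y. m x y - m y x = bracket3 (d3 *\<^sub>R e3) (- (d2 *\<^sub>R e2)) (d1 *\<^sub>R e1) x y"
  shows False
proof -
  have b: "bilinear m" using m by (simp add: left_symmetric_def)
  have ls: "m (m u v - m v u) w = m u (m v w) - m v (m u w)" for u v w
    using m by (simp add: left_symmetric_def)
  note lin = bilinear_ladd[OF b] bilinear_radd[OF b] bilinear_lmul[OF b] bilinear_rmul[OF b]
    bilinear_lsub[OF b] bilinear_rsub[OF b] bilinear_lneg[OF b] bilinear_rneg[OF b]
  have l: "linear (m x)" for x using b by (simp add: bilinear_def)
  have br: "m e1 e2 - m e2 e1 = d3 *\<^sub>R e3" "m e2 e3 - m e3 e2 = d1 *\<^sub>R e1" "m e3 e1 - m e1 e3 = d2 *\<^sub>R e2"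
    by (simp_all add: c bracket3_def)
  have AB: "m e1 (m e2 x) - m e2 (m e1 x) = d3 *\<^sub>R m e3 x"
    and BC: "m e2 (m e3 x) - m e3 (m e2 x) = d1 *\<^sub>R m e1 x"
    and CA: "m e3 (m e1 x) - m e1 (m e3 x) = d2 *\<^sub>R m e2 x" for x
    using ls[of e1 e2 x] ls[of e2 e3 x] ls[of e3 e1 x] by (simp_all add: br lin)
  \<comment> \<open>Each basis vector is a multiple of a bracket, so its left multiplication is a
    multiple of a commutator of operators.\<close>
  have "d3 * tr3 (m e3) = 0" "d1 * tr3 (m e1) = 0" "d2 * tr3 (m e2) = 0"
    using tr3_commute[OF l l, of e1 e2] tr3_commute[OF l l, of e2 e3] tr3_commute[OF l l, of e3 e1]
    unfolding tr3_scale[symmetric] AB[symmetric] BC[symmetric] CA[symmetric] by (simp_all add: tr3_diff)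
  then have t: "tr3 (m e1) = 0" "tr3 (m e2) = 0" "tr3 (m e3) = 0" using nz by auto
  have tL: "tr3 (m x) = 0" for x
  proof -
    have "m x y = x $ 1 *\<^sub>R m e1 y + x $ 2 *\<^sub>R m e2 y + x $ 3 *\<^sub>R m e3 y" for y
      by (subst vec3_expansion[of x]) (simp add: lin)
    then have "tr3 (m x) = x $ 1 * tr3 (m e1) + x $ 2 * tr3 (m e2) + x $ 3 * tr3 (m e3)"
      by (simp add: tr3_def algebra_simps)
    then show ?thesis by (simp add: t)
  qed
  text \<open>Right multiplication by \<open>w\<close> is the Casimir operator of the representation by left multiplications.\<close>
  define w where "w = d1 *\<^sub>R m e1 e1 + d2 *\<^sub>R m e2 e2 + d3 *\<^sub>R m e3 e3"
  have cas: "m x w = d1 *\<^sub>R m e1 (m e1 x) + d2 *\<^sub>R m e2 (m e2 x) + d3 *\<^sub>R m e3 (m e3 x)"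
    if "x = e1 \<or> x = e2 \<or> x = e3" for x
  proof -
    \<comment> \<open>Left symmetry with a repeated argument. Summed over the basis with weights
      \<open>d1\<close>, \<open>d2\<close>, \<open>d3\<close>, the terms containing
      \<open>m x e - m e x\<close> cancel: this is the invariance of the weighted sum of squares
      under the adjoint action.\<close>
    have r: "m x (m e e) = m e (m e x) + m e (m x e - m e x) + m (m x e - m e x) e" for e
      using ls[of x e e] by (simp add: lin)
    have br': "m e1 e2 = m e2 e1 + d3 *\<^sub>R e3" "m e2 e3 = m e3 e2 + d1 *\<^sub>R e1" "m e3 e1 = m e1 e3 + d2 *\<^sub>R e2"
      using br by (simp_all add: algebra_simps)
    show ?thesis
      unfolding w_def lin r using that
      by (elim disjE) (simp_all add: br' lin algebra_simps)
  qed
  \<comment> \<open>Right and left multiplication by \<open>w\<close> differ by \<open>ad w\<close>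
    up to sign, which has zero diagonal in this basis.\<close>
  have "tr3 (\<lambda>x. m x w) = tr3 (m w)"
  proof -
    have "tr3 (\<lambda>x. m x w) - tr3 (m w) = tr3 (\<lambda>x. m x w - m w x)" by (simp add: tr3_diff)
    also have "\<dots> = 0" by (simp add: tr3_def c bracket3_def)
    finally show ?thesis by simp
  qed
  then have "d1 * tr3 (\<lambda>x. m e1 (m e1 x)) + d2 * tr3 (\<lambda>x. m e2 (m e2 x)) + d3 * tr3 (\<lambda>x. m e3 (m e3 x)) = 0"
    by (simp add: tL) (simp add: tr3_def cas algebra_simps)
  from simple_triple_trivial[OF l l l AB BC CA nz this]
  have "m e2 x = 0" for x .
  then have "m e3 x = 0" "m e1 x = 0" for x
    using AB[of x] BC[of x] nz linear_0[OF l] by (auto dest!: spec)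
  then show False using br(2) nz \<open>m e2 e3 = 0\<close> by (auto simp: axis_eq_0_iff)
qed

section \<open>Orthonormal frames and self-adjoint operators\<close>

definition rh_frame :: "real ^ 3 \<Rightarrow> real ^ 3 \<Rightarrow> real ^ 3 \<Rightarrow> bool"
  where "rh_frame u v w \<longleftrightarrow> u \<bullet> u = 1 \<and> v \<bullet> v = 1 \<and> u \<bullet> v = 0 \<and> cross3 u v = w"

lemma cross_cross_right: "cross3 x (cross3 y z) = (x \<bullet> z) *\<^sub>R y - (x \<bullet> y) *\<^sub>R z"
  by (simp add: vec3_eq_iff cross_components inner_vec_def sum_3 algebra_simps)

lemma rh_frame_simps:
  assumes "rh_frame u v w"
  shows "u \<bullet> w = 0" "v \<bullet> w = 0" "w \<bullet> w = 1" "cross3 v w = u" "cross3 w u = v" "cross3 u w = - v"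
    "cross3 u v = w" "u \<bullet> u = 1" "v \<bullet> v = 1" "u \<bullet> v = 0" "v \<bullet> u = 0" "w \<bullet> u = 0" "w \<bullet> v = 0"
proof -
  have h: "u \<bullet> u = 1" "v \<bullet> v = 1" "u \<bullet> v = 0" "cross3 u v = w" using assms by (auto simp: rh_frame_def)
  show *: "u \<bullet> w = 0" "v \<bullet> w = 0" unfolding h(4)[symmetric] by (rule dot_cross_self)+
  have "(norm w)\<^sup>2 + (u \<bullet> v)\<^sup>2 = (norm u * norm v)\<^sup>2" using norm_cross_dot[of u v] h(4) by simp
  then show "w \<bullet> w = 1" by (simp add: power2_norm_eq_inner power_mult_distrib h)
  show c: "cross3 v w = u" "cross3 u w = - v" unfolding h(4)[symmetric]
    by (simp_all add: cross_cross_right h(1-3) inner_commute[of v u])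
  show "cross3 w u = v" using c(2) cross_skew[of w u] by simp
  show "cross3 u v = w" "u \<bullet> u = 1" "v \<bullet> v = 1" "u \<bullet> v = 0" "v \<bullet> u = 0" "w \<bullet> u = 0" "w \<bullet> v = 0"
    using h * by (simp_all add: inner_commute)
qed

lemma rh_frame_expansion:
  assumes "rh_frame u v w"
  shows "x = (x \<bullet> u) *\<^sub>R u + (x \<bullet> v) *\<^sub>R v + (x \<bullet> w) *\<^sub>R w"
proof -
  note f = rh_frame_simps[OF assms]
  define y where "y = x - ((x \<bullet> u) *\<^sub>R u + (x \<bullet> v) *\<^sub>R v + (x \<bullet> w) *\<^sub>R w)"
  have y: "y \<bullet> u = 0" "y \<bullet> v = 0" "y \<bullet> w = 0"
    by (simp_all add: y_def inner_diff_left inner_add_left f)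
  \<comment> \<open>As \<open>w\<close> is the cross product of \<open>u\<close> and
    \<open>v\<close>, the triple product expansion vanishes; \<open>y\<close> is then both parallel
    and orthogonal to the unit vector \<open>w\<close>.\<close>
  have "cross3 y w = 0" unfolding f(7)[symmetric] by (simp add: cross_cross_right y)
  then have "y = 0" using y(3) norm_and_cross_eq_0[of y w] f(3) by auto
  then show ?thesis by (simp add: y_def)
qed

lemma bij_rh_frame:
  assumes "rh_frame u v w"
  shows "bij (of_basis u v w)"
proof (rule bij_of_basis)
  note f = rh_frame_simps[OF assms]
  fix a b c assume z: "a *\<^sub>R u + b *\<^sub>R v + c *\<^sub>R w = 0"
  have "(a *\<^sub>R u + b *\<^sub>R v + c *\<^sub>R w) \<bullet> u = a" "(a *\<^sub>R u + b *\<^sub>R v + c *\<^sub>R w) \<bullet> v = b"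
    "(a *\<^sub>R u + b *\<^sub>R v + c *\<^sub>R w) \<bullet> w = c"
    by (simp_all add: inner_add_left f)
  then show "a = 0 \<and> b = 0 \<and> c = 0" unfolding z by simp
qed

lemma rh_frame_of_unit:
  assumes w: "w \<bullet> w = 1"
  obtains u v where "rh_frame u v w"
proof -
  have "w \<noteq> 0" using w by auto
  then obtain e where e: "cross3 w e \<noteq> 0" using cross_basis_nonzero by blast
  define u where "u = inverse (norm (cross3 w e)) *\<^sub>R cross3 w e"
  have "norm u = 1" using e by (simp add: u_def)
  then have uu: "u \<bullet> u = 1" by (simp add: norm_eq_1)
  have uw: "u \<bullet> w = 0" "w \<bullet> u = 0" by (simp_all add: u_def dot_cross_self)
  define v where "v = cross3 w u"
  have "cross3 u v = w" by (simp add: v_def cross_cross_right uu uw)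
  moreover have "v \<bullet> v = 1"
    using norm_cross_dot[of w u] by (simp add: v_def power2_norm_eq_inner power_mult_distrib uu w uw)
  moreover have "u \<bullet> v = 0" by (simp add: v_def dot_cross_self)
  ultimately show ?thesis using that uu by (simp add: rh_frame_def)
qed

text \<open>\<open>u\<close> maximizes the Rayleigh quotient on the unit sphere of \<open>W\<close>.
  The conclusion is orthogonality inside \<open>W\<close> instead of an eigenvalue equation because
  \<open>M\<close> may leave \<open>W\<close>.\<close>

lemma self_adjoint_maximizer:
  fixes M :: "'a::euclidean_space \<Rightarrow> 'a"
  assumes M: "linear M" "\<And>x y. M x \<bullet> y = x \<bullet> M y" and W: "subspace W" and z: "z \<in> W" "z \<noteq> 0"
  obtains u where "u \<in> W" "u \<bullet> u = 1" "\<And>y. y \<in> W \<Longrightarrow> u \<bullet> y = 0 \<Longrightarrow> M u \<bullet> y = 0"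
proof -
  let ?K = "sphere 0 1 \<inter> W"
  have "compact ?K" using compact_Int_closed[OF compact_sphere closed_subspace[OF W]] .
  moreover have "inverse (norm z) *\<^sub>R z \<in> ?K" using z W by (simp add: subspace_scale)
  then have "?K \<noteq> {}" by blast
  moreover have "continuous_on ?K (\<lambda>x. M x \<bullet> x)"
    using M(1) by (intro continuous_intros linear_continuous_on linear_conv_bounded_linear[THEN iffD1])
  ultimately have "\<exists>u\<in>?K. \<forall>y\<in>?K. M y \<bullet> y \<le> M u \<bullet> u"
    by (rule continuous_attains_sup)
  then obtain u where u: "u \<in> ?K" "\<And>y. y \<in> ?K \<Longrightarrow> M y \<bullet> y \<le> M u \<bullet> u"
    by blast
  have uu: "u \<in> W" "u \<bullet> u = 1" using u(1) by (auto simp: norm_eq_1)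
  define k where "k = M u \<bullet> u"
  have le: "M x \<bullet> x \<le> k * (x \<bullet> x)" if x: "x \<in> W" "x \<noteq> 0" for x
  proof -
    define n where "n = norm x"
    have n: "n > 0" using x by (simp add: n_def)
    have "inverse n *\<^sub>R x \<in> ?K" using x W by (simp add: subspace_scale n_def)
    from u(2)[OF this] have "inverse n * (inverse n * (M x \<bullet> x)) \<le> k"
      by (simp add: linear_scale[OF M(1)] k_def)
    then have "M x \<bullet> x \<le> k * n\<^sup>2" using n by (simp add: field_simps power2_eq_square)
    then show ?thesis by (simp add: n_def power2_norm_eq_inner)
  qed
  have "M u \<bullet> y = 0" if y: "y \<in> W" "u \<bullet> y = 0" for y
  proof -
    define b where "b = M u \<bullet> y"
    \<comment> \<open>A positive bound for \<open>k * (y \<bullet> y) - M y \<bullet> y\<close>.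
      With it, moving from \<open>u\<close> along \<open>y\<close> by \<open>t = b / c\<close> would
      raise the quotient unless \<open>b = 0\<close>.\<close>
    define c where "c = \<bar>k * (y \<bullet> y) - M y \<bullet> y\<bar> + 1"
    have c: "c > 0" by (simp add: c_def)
    define t where "t = b / c"
    let ?x = "u + t *\<^sub>R y"
    have xu: "?x \<bullet> u = 1" using uu y by (simp add: inner_add_left inner_commute[of y u])
    have "M ?x \<bullet> ?x \<le> k * (?x \<bullet> ?x)"
      by (rule le) (use xu uu y W in \<open>auto simp: subspace_add subspace_scale\<close>)
    moreover have "M ?x \<bullet> ?x = k + 2 * (t * b) + t * t * (M y \<bullet> y)"
      by (simp add: linear_add[OF M(1)] linear_scale[OF M(1)] inner_add_left inner_add_right k_def b_def
          M(2)[of y u] inner_commute[of y "M u"] algebra_simps)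
    moreover have "?x \<bullet> ?x = 1 + t * t * (y \<bullet> y)"
      using uu y by (simp add: inner_add_left inner_add_right inner_commute[of y u])
    ultimately have "k + 2 * (t * b) + t * t * (M y \<bullet> y) \<le> k * (1 + t * t * (y \<bullet> y))"
      by (simp only:)
    then have "2 * (t * b) \<le> t * t * (k * (y \<bullet> y) - M y \<bullet> y)"
      by (simp add: algebra_simps)
    also have "\<dots> \<le> t * t * c"
      by (rule mult_left_mono) (auto simp: c_def)
    also have "\<dots> = t * b" using c by (simp add: t_def)
    finally have "t * b \<le> 0" by linarith
    then have "b * b \<le> 0" using c by (simp add: t_def field_simps)
    then show ?thesis using b_def by (metis mult_eq_0_iff order_antisym zero_le_square)
  qed
  then show ?thesis using that uu by blast
qed

text \<open>Maximize on the whole space, then on the plane orthogonal to the first vector. The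
  remaining off-diagonal entries vanish by self-adjointness, so the completing cross product is an
  eigenvector too.\<close>

lemma self_adjoint_eigenframe:
  fixes M :: "real ^ 3 \<Rightarrow> real ^ 3"
  assumes M: "linear M" "\<And>x y. M x \<bullet> y = x \<bullet> M y"
  obtains u v w a b c where "rh_frame u v w" "M u = a *\<^sub>R u" "M v = b *\<^sub>R v" "M w = c *\<^sub>R w"
proof -
  have "(e1 :: real ^ 3) \<noteq> 0" by (simp add: axis_eq_0_iff)
  then obtain u where u: "u \<bullet> u = 1" "\<And>y. u \<bullet> y = 0 \<Longrightarrow> M u \<bullet> y = 0"
    using self_adjoint_maximizer[OF M subspace_UNIV, of e1] by auto
  obtain x y where xy: "rh_frame x y u" using rh_frame_of_unit[OF u(1)] by blast
  have "subspace {z. u \<bullet> z = 0}" by (rule subspace_hyperplane)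
  moreover have "x \<in> {z. u \<bullet> z = 0}" using rh_frame_simps[OF xy] by simp
  moreover have "x \<noteq> 0" using rh_frame_simps[OF xy] by auto
  ultimately obtain v where v: "u \<bullet> v = 0" "v \<bullet> v = 1" "\<And>y. u \<bullet> y = 0 \<Longrightarrow> v \<bullet> y = 0 \<Longrightarrow> M v \<bullet> y = 0"
    using self_adjoint_maximizer[OF M, of "{z. u \<bullet> z = 0}" x] by auto
  define w where "w = cross3 u v"
  have f: "rh_frame u v w" by (simp add: rh_frame_def u v w_def)
  note fs = rh_frame_simps[OF f]
  have o: "M u \<bullet> v = 0" "M u \<bullet> w = 0" "M v \<bullet> w = 0" using u(2) v(3) fs by auto
  then have o': "M v \<bullet> u = 0" "M w \<bullet> u = 0" "M w \<bullet> v = 0"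
    using M(2) inner_commute by metis+
  have "M u = (M u \<bullet> u) *\<^sub>R u" "M v = (M v \<bullet> v) *\<^sub>R v" "M w = (M w \<bullet> w) *\<^sub>R w"
    using rh_frame_expansion[OF f, of "M u"] rh_frame_expansion[OF f, of "M v"]
      rh_frame_expansion[OF f, of "M w"] by (simp_all add: o o')
  then show ?thesis using that f by blast
qed

section \<open>Existence of an abelian ideal of dimension two\<close>

lemma commutator_bilinear:
  assumes "bilinear m"
  shows "bilinear (\<lambda>x y. m x y - m y x)"
  by (auto intro!: linearI simp: bilinear_def bilinear_ladd[OF assms] bilinear_radd[OF assms]
      bilinear_lmul[OF assms] bilinear_rmul[OF assms] algebra_simps)

text \<open>Writing the bracket as \<open>M (x \<times> y)\<close>, the Jacobi identity says that \<open>M\<close> kills the axial vector of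
  its antisymmetric part. Hence \<open>M\<close> and its adjoint have a common kernel vector \<open>n\<close>, and then the plane
  orthogonal to \<open>n\<close> is an abelian ideal, unless \<open>M\<close> is self-adjoint and injective.\<close>

lemma left_symmetric_abelian_plane:
  fixes m :: "real ^ 3 \<Rightarrow> real ^ 3 \<Rightarrow> real ^ 3"
  assumes m: "left_symmetric m"
  obtains S c13 c23 where "linear S" "bij S" "c13 $ 3 = 0" "c23 $ 3 = 0"
    "\<And>x y. m (S x) (S y) - m (S y) (S x) = S (bracket3 0 c13 c23 x y)"
proof -
  have b: "bilinear m" using m by (simp add: left_symmetric_def)
  have ls: "m (m u v - m v u) w = m u (m v w) - m v (m u w)" for u v w
    using m by (simp add: left_symmetric_def)
  define br where "br x y = m x y - m y x" for x y
  have bb: "bilinear br" unfolding br_def by (rule commutator_bilinear[OF b])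
  have alt: "br x y = - br y x" for x y by (simp add: br_def)
  have z: "br x x = 0" for x by (simp add: br_def)
  have jac: "br x (br y z) + br y (br z x) + br z (br x y) = 0" for x y z
    unfolding br_def ls bilinear_rsub[OF b] by (simp add: algebra_simps)
  \<comment> \<open>The cyclic order matches \<open>cross3 e2 e3 = e1\<close> and its rotations, so
    that \<open>M\<close>, which has these columns, composed with the cross product is the
    bracket.\<close>
  define c1 c2 c3 where "c1 = br e2 e3" and "c2 = br e3 e1" and "c3 = br e1 e2"
  define M where "M z = z $ 1 *\<^sub>R c1 + z $ 2 *\<^sub>R c2 + z $ 3 *\<^sub>R c3" for z :: "real ^ 3"
  define N :: "real ^ 3 \<Rightarrow> real ^ 3" where "N z = (c1 \<bullet> z) *\<^sub>R e1 + (c2 \<bullet> z) *\<^sub>R e2 + (c3 \<bullet> z) *\<^sub>R e3" for z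
  have lM: "linear M" by (auto intro!: linearI simp: M_def algebra_simps)
  have brM: "br x y = M (cross3 x y)" for x y
  proof -
    have id: "of_basis e1 e2 e3 x = x" for x
      by (simp add: of_basis_def vec3_eq_iff)
    have "br (of_basis e1 e2 e3 x) (of_basis e1 e2 e3 y) = of_basis e1 e2 e3 (bracket3 c3 (- c2) c1 x y)"
      by (rule of_basis_bracket[OF bb alt])
        (simp_all only: id c1_def c2_def c3_def alt[of e1 e3])
    then have "br x y = bracket3 c3 (- c2) c1 x y"
      by (simp only: id)
    then show ?thesis by (simp add: bracket3_def M_def cross_components vec3_eq_iff algebra_simps)
  qed
  have adj: "M x \<bullet> y = x \<bullet> N y" for x y
    by (simp add: M_def N_def inner_vec_def sum_3 algebra_simps)
  \<comment> \<open>The axial vector of \<open>M\<close>: as \<open>N\<close> is the adjoint,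
    \<open>M - N\<close> is antisymmetric, hence a cross product with a fixed vector.\<close>
  define v where "v = cross3 e1 c1 + cross3 e2 c2 + cross3 e3 c3"
  have MN: "M x - N x = cross3 v x" for x
    by (simp add: v_def M_def N_def vec3_eq_iff cross_components inner_vec_def sum_3 algebra_simps)
  have "M v = br e1 c1 + br e2 c2 + br e3 c3"
    by (simp add: v_def brM linear_add[OF lM])
  also have "\<dots> = 0" using jac[of e1 e2 e3] by (simp add: c1_def c2_def c3_def)
  finally have Mv: "M v = 0" .
  note conclude = that
  have plane: thesis if n: "n \<noteq> 0" "M n = 0" "N n = 0" for n
  proof -
    define w where "w = inverse (norm n) *\<^sub>R n"
    have lN: "linear N" by (auto intro!: linearI simp: N_def inner_add_right algebra_simps)
    have "norm w = 1" using n by (simp add: w_def)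
    then have w: "w \<bullet> w = 1" "M w = 0" "N w = 0"
      using n by (simp_all add: norm_eq_1) (simp_all add: w_def linear_scale[OF lM] linear_scale[OF lN])
    obtain u v where f: "rh_frame u v w" using rh_frame_of_unit[OF w(1)] by blast
    note fs = rh_frame_simps[OF f]
    define c13 :: "real ^ 3" where "c13 = - ((M v \<bullet> u) *\<^sub>R e1 + (M v \<bullet> v) *\<^sub>R e2)"
    define c23 :: "real ^ 3" where "c23 = (M u \<bullet> u) *\<^sub>R e1 + (M u \<bullet> v) *\<^sub>R e2"
    \<comment> \<open>\<open>N w = 0\<close> makes the image of \<open>M\<close> orthogonal to
      \<open>w\<close>, so all brackets lie in the plane of \<open>u\<close> and \<open>v\<close>,
      and the bracket of these two is \<open>M w = 0\<close>.\<close>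
    have Mx: "M x = (M x \<bullet> u) *\<^sub>R u + (M x \<bullet> v) *\<^sub>R v" for x
      using rh_frame_expansion[OF f, of "M x"] adj[of x w] w(3) by simp
    have "br u w = - M v" "br v w = M u" "br u v = 0"
      by (simp_all add: brM fs w linear_neg[OF lM])
    moreover have "- M v = of_basis u v w c13" "M u = of_basis u v w c23"
      by (rule arg_cong[OF Mx, of uminus, THEN trans] Mx[THEN trans],
          simp add: of_basis_def c13_def c23_def)+
    ultimately have "br (of_basis u v w x) (of_basis u v w y) =
        of_basis u v w (bracket3 0 c13 c23 x y)" for x y
      by (intro of_basis_bracket[OF bb alt]) simp_all
    then show thesis
    proof (intro conclude[of "of_basis u v w" c13 c23])
    qed (simp_all add: linear_of_basis bij_rh_frame[OF f] c13_def c23_def br_def)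
  qed
  show thesis
  proof (cases "v = 0")
    case False
    then show ?thesis using plane[of v] MN[of v] Mv by simp
  next
    case True
    then have NM: "N x = M x" for x using MN[of x] by simp
    obtain p q r a b c where f: "rh_frame p q r" and e: "M p = a *\<^sub>R p" "M q = b *\<^sub>R q" "M r = c *\<^sub>R r"
      using self_adjoint_eigenframe[OF lM] adj NM by metis
    note fs = rh_frame_simps[OF f]
    have nz: "p \<noteq> 0" "q \<noteq> 0" "r \<noteq> 0" using fs by auto
    show ?thesis
    proof (cases "a = 0 \<or> b = 0 \<or> c = 0")
      case True
      then show ?thesis using plane[of p] plane[of q] plane[of r] e nz NM by auto
    next
      case False
      \<comment> \<open>With all eigenvalues nonzero, the bracket takes the diagonal form of
        \<open>no_left_symmetric_simple\<close> in the eigenframe; that lemma is applied to the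
        product conjugated by \<open>?S\<close>.\<close>
      let ?S = "of_basis p q r"
      have S: "br (?S x) (?S y) = ?S (bracket3 (c *\<^sub>R e3) (- (b *\<^sub>R e2)) (a *\<^sub>R e1) x y)" for x y
        by (rule of_basis_bracket[OF bb alt])
          (simp_all add: brM fs e linear_neg[OF lM], simp_all add: of_basis_def)
      obtain R where R: "linear R" "R \<circ> ?S = id" "?S \<circ> R = id"
        using linear_injective_left_inverse[OF linear_of_basis bij_is_inj[OF bij_rh_frame[OF f]]]
          linear_inverse_left[OF _ linear_of_basis] by blast
      have "left_symmetric (\<lambda>x y. R (m (?S x) (?S y)))"
        by (rule left_symmetric_conjugate[OF m linear_of_basis R(1)]) (use R(3) in \<open>simp add: fun_eq_iff\<close>)
      then show ?thesis
        using no_left_symmetric_simple[of "\<lambda>x y. R (m (?S x) (?S y))" a b c] False S R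
        by (simp add: linear_diff[OF R(1), symmetric] br_def[symmetric] fun_eq_iff)
    qed
  qed
qed

text \<open>Full symmetry of the associator makes the operator \<open>T = (a, a, \<cdot>)\<close> commute with \<open>\<delta> = ad a\<close> on the
  abelian ideal. Since \<open>T\<close> is also the commutator of left multiplication by \<open>a\<close> with \<open>\<delta>\<close>, it vanishes
  there. Then left multiplication by \<open>a\<close> is \<open>(\<delta> + c) / 2\<close>, and comparing with \<open>a \<cdot> a = c a + u\<close> shows
  that \<open>(\<delta>\<^sup>2 - c\<^sup>2) / 4\<close> is multiplication by \<open>u\<close>, which must be zero.\<close>

lemma bisymmetric_derivation_square:
  fixes m :: "real ^ 3 \<Rightarrow> real ^ 3 \<Rightarrow> real ^ 3"
  assumes m: "left_symmetric m"
    and bi: "\<And>x y z. m (m x y) z - m x (m y z) = m (m x z) y - m x (m z y)"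
    and com: "\<And>x y. m x y - m y x = bracket3 0 c13 c23 x y"
    and c3: "c13 $ 3 = 0" "c23 $ 3 = 0"
    and det: "c13 $ 1 * c23 $ 2 - c13 $ 2 * c23 $ 1 \<noteq> 0"
  defines "\<delta> \<equiv> bracket3 0 c13 c23 e3"
  obtains c where "c \<noteq> 0" "\<And>x. x $ 3 = 0 \<Longrightarrow> \<delta> (\<delta> x) = (c * c) *\<^sub>R x"
proof -
  have b: "bilinear m" using m by (simp add: left_symmetric_def)
  have ls: "m (m u v - m v u) w = m u (m v w) - m v (m u w)" for u v w
    using m by (simp add: left_symmetric_def)
  note vec3_comp = vec3_eq_iff vector_add_component vector_minus_component vector_scaleR_component
    real_scaleR_def zero_index
  note lin = bilinear_ladd[OF b] bilinear_radd[OF b] bilinear_lmul[OF b] bilinear_rmul[OF b]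
    bilinear_lsub[OF b] bilinear_rsub[OF b]
  define a :: "real ^ 3" where "a = e3"
  have a3: "a $ 3 = 1" by (simp add: a_def)
  have d: "\<delta> x = m a x - m x a" for x by (simp add: \<delta>_def com a_def)
  have l\<delta>: "linear \<delta>"
    unfolding \<delta>_def using bilinear_bracket3 by (simp add: bilinear_def)
  note dl = linear_add[OF l\<delta>] linear_diff[OF l\<delta>] linear_scale[OF l\<delta>] linear_neg[OF l\<delta>] linear_0[OF l\<delta>]
  have \<delta>_eq: "\<delta> x = - (x $ 1 *\<^sub>R c13 + x $ 2 *\<^sub>R c23)" for x
    by (simp add: \<delta>_def bracket3_def)
  have d3: "\<delta> x $ 3 = 0" for x by (simp add: \<delta>_eq c3)
  have ab: "m x y = m y x" if "x $ 3 = 0" "y $ 3 = 0" for x y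
    using com[of x y] that by (simp add: bracket3_def)
  \<comment> \<open>Cramer's rule for \<open>\<delta>\<close> on the plane; the minus signs in the
    witness undo the sign in \<open>\<delta>_eq\<close>.\<close>
  have surj: "\<exists>y. y $ 3 = 0 \<and> \<delta> y = x" if "x $ 3 = 0" for x
  proof -
    define D where "D = c13 $ 1 * c23 $ 2 - c13 $ 2 * c23 $ 1"
    have D: "D \<noteq> 0" using det by (simp add: D_def)
    define y :: "real ^ 3" where "y = (- (x $ 1 * c23 $ 2 - x $ 2 * c23 $ 1) / D) *\<^sub>R e1
        + (- (c13 $ 1 * x $ 2 - c13 $ 2 * x $ 1) / D) *\<^sub>R e2"
    have "D * \<delta> y $ 1 = D * x $ 1" "D * \<delta> y $ 2 = D * x $ 2"
      using D by (simp_all add: \<delta>_eq y_def field_simps) (simp_all add: D_def algebra_simps)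
    then have "\<delta> y = x" using D that d3[of y] by (simp add: vec3_eq_iff)
    then show ?thesis by (intro exI[of _ y]) (simp add: y_def)
  qed
  have inj: "x = 0" if "x $ 3 = 0" "\<delta> x = 0" for x
  proof -
    have e: "x $ 1 * c13 $ 1 + x $ 2 * c23 $ 1 = 0" "x $ 1 * c13 $ 2 + x $ 2 * c23 $ 2 = 0"
      using that(2) by (simp_all add: \<delta>_eq vec3_eq_iff)
    have "x $ 1 * (c13 $ 1 * c23 $ 2 - c13 $ 2 * c23 $ 1) = 0"
      "x $ 2 * (c13 $ 1 * c23 $ 2 - c13 $ 2 * c23 $ 1) = 0"
      using e by algebra+
    then show ?thesis using det that(1) by (simp add: vec3_eq_iff)
  qed
  define A where "A x y z = m (m x y) z - m x (m y z)" for x y z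
  have s2: "A x y z = A x z y" for x y z using bi by (simp add: A_def)
  have s1: "A x y z = A y x z" for x y z
    using ls[of x y z] by (simp add: A_def lin algebra_simps)
  \<comment> \<open>The Teichmueller identity, valid for the associator of any bilinear
    product.\<close>
  have teich: "A (m w x) y z - A w (m x y) z + A w x (m y z) = m w (A x y z) + m (A w x y) z" for w x y z
    by (simp add: A_def lin algebra_simps)
  define T where "T = A a a"
  have T: "A a z a = T z" "A z a a = T z" for z
    using s1[of z a a] s2[of a z a] by (simp_all add: T_def)
  have Td: "T (x - y) = T x - T y" for x y by (simp add: T_def A_def lin algebra_simps)
  have T1: "T z = m a (\<delta> z) - \<delta> (m a z)" for z
    unfolding T(1)[symmetric] by (simp add: A_def d lin)
  define t where "t = A a a a"
  have t3: "t $ 3 = 0"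
  proof -
    have "t = - \<delta> (m a a)" by (simp add: t_def A_def d)
    then show ?thesis by (simp add: d3)
  qed
  \<comment> \<open>The identity is used at \<open>(a, a, a, z)\<close> and
    \<open>(z, a, a, a)\<close>. Symmetry of the associator cancels two terms in each, and the extra
    terms \<open>m t z\<close> and \<open>m z t\<close> agree because \<open>t\<close> lies in the
    abelian ideal.\<close>
  have T2: "T (\<delta> z) = \<delta> (T z)" if z: "z $ 3 = 0" for z
  proof -
    have "T (m a z) = m a (T z) + m t z"
      using teich[of a a a z] s1[of "m a a" a z] by (simp add: T_def t_def)
    moreover have "T (m z a) = m z t + m (T z) a"
      using teich[of z a a a] s2[of z "m a a" a] T(2) s1[of "m z a" a a] T(1)[of "m z a"] by (simp add: t_def)
    moreover have "m t z = m z t" using ab[OF t3 z] .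
    ultimately show ?thesis by (simp add: d Td)
  qed
  have T3: "T z $ 3 = 0" if z: "z $ 3 = 0" for z
    using surj[OF z] T2 d3 by metis
  have L3: "m a z $ 3 = 0" if z: "z $ 3 = 0" for z
  proof -
    obtain y where y: "y $ 3 = 0" "\<delta> y = z" using surj[OF z] by blast
    have "m a z = T y + \<delta> (m a y)" using T1[of y] y by simp
    then show ?thesis by (simp add: T3 y d3)
  qed
  define c where "c = m a a $ 3"
  define u where "u = m a a - c *\<^sub>R a"
  have u3: "u $ 3 = 0" by (simp add: u_def a3 c_def)
  have maa: "m a a = c *\<^sub>R a + u" by (simp add: u_def)
  \<comment> \<open>The commutator of \<open>m a a\<close> with \<open>x\<close> computed twice: as
    \<open>c *\<^sub>R \<delta> x\<close>, because \<open>u\<close> commutes with \<open>x\<close>,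
    and through associators.\<close>
  have S5: "\<delta> (m a x) + \<delta> (m a x) + (T x + T x + T x) = \<delta> (\<delta> x) + c *\<^sub>R \<delta> x" if x: "x $ 3 = 0" for x
  proof -
    have "m (m a a) x - m x (m a a) = c *\<^sub>R \<delta> x"
      unfolding maa lin d using ab[OF u3 x] by (simp add: algebra_simps)
    then have "T x + m a (m a x) - (m (m x a) a - T x) = c *\<^sub>R \<delta> x"
      using T(2)[of x] by (simp add: T_def A_def algebra_simps)
    moreover have "\<delta> (m a x) + \<delta> (m a x) - \<delta> (\<delta> x) = m a (m a x) - m (m x a) a - T x"
      unfolding T(1)[symmetric] by (simp add: A_def d lin algebra_simps)
    ultimately show ?thesis unfolding vec3_comp by (elim conjE, intro conjI; linarith)
  qed
  \<comment> \<open>Compare \<open>S5\<close> at \<open>\<delta> x\<close> with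
    \<open>\<delta>\<close> applied to \<open>S5\<close> at \<open>x\<close>. As \<open>T\<close>
    commutes with \<open>\<delta>\<close>, only \<open>\<delta> (T x) = 0\<close> is left.\<close>
  have S6: "T x = 0" if x: "x $ 3 = 0" for x
  proof -
    have "\<delta> (m a (\<delta> x)) + \<delta> (m a (\<delta> x)) + (T (\<delta> x) + T (\<delta> x) + T (\<delta> x)) =
        \<delta> (\<delta> (m a x) + \<delta> (m a x) + (T x + T x + T x))"
      unfolding S5[OF x] S5[OF d3] by (simp add: dl)
    then have "\<delta> (m a (\<delta> x)) = \<delta> (\<delta> (m a x))"
      unfolding T2[OF x] dl vec3_comp by (elim conjE, intro conjI; linarith)
    then have "\<delta> (T x) = 0" unfolding T1[of x] dl by simp
    then show ?thesis using inj T3[OF x] by blast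
  qed
  have S7: "m a x + m a x = \<delta> x + c *\<^sub>R x" if x: "x $ 3 = 0" for x
  proof -
    have "\<delta> (m a x + m a x - (\<delta> x + c *\<^sub>R x)) = 0"
      using S5[OF x] S6[OF x] unfolding dl by simp
    moreover have "(m a x + m a x - (\<delta> x + c *\<^sub>R x)) $ 3 = 0"
      unfolding vector_add_component vector_minus_component by (simp add: d3 L3 x)
    ultimately have "m a x + m a x - (\<delta> x + c *\<^sub>R x) = 0"
      using inj by blast
    then show ?thesis by simp
  qed
  have S7': "m x a + m x a = c *\<^sub>R x - \<delta> x" if x: "x $ 3 = 0" for x
    using S7[OF x] d[of x] unfolding vec3_comp by (elim conjE, intro conjI; linarith)
  have E1: "m (\<delta> x) y = m a (m x y) - m x (m a y)" for x y
    unfolding d by (rule ls)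
  have E1': "m (\<delta> x) y + m (\<delta> x) y = m a (m x y) + m a (m x y) - m x (\<delta> y) - c *\<^sub>R m x y"
    if "x $ 3 = 0" "y $ 3 = 0" for x y
    using arg_cong[OF S7[OF that(2)], of "m x"] E1[of x y]
    unfolding lin vec3_comp by (elim conjE, intro conjI; linarith)
  have E2: "m (m x y) a + m (m x y) a - (c *\<^sub>R m x y - m x (\<delta> y)) =
      (c *\<^sub>R m x y - m (\<delta> x) y) - (m x (\<delta> y) + c *\<^sub>R m x y)"
    if "x $ 3 = 0" "y $ 3 = 0" for x y
    using arg_cong[OF S7[OF that(2)], of "m x"] arg_cong[OF S7'[OF that(2)], of "m x"]
      arg_cong[OF S7'[OF that(1)], of "\<lambda>x. m x y"] bi[of x y a]
    unfolding lin vec3_comp by (elim conjE, intro conjI; linarith)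
  have f1: "m a z $ 3 = c * z $ 3" for z
  proof -
    have "m a z = m a (z - z $ 3 *\<^sub>R a) + z $ 3 *\<^sub>R m a a" by (simp add: lin)
    then show ?thesis using L3[of "z - z $ 3 *\<^sub>R a"] by (simp add: a3 c_def)
  qed
  have f2: "m z a $ 3 = c * z $ 3" for z
    using f1[of z] d3[of z] by (simp add: d)
  \<comment> \<open>Let \<open>h\<close>, \<open>p\<close>, \<open>q\<close> be the third
    coordinates of \<open>m x y\<close>, \<open>m (\<delta> x) y\<close>,
    \<open>m x (\<delta> y)\<close>. The equations read \<open>2 p + q = c h\<close>,
    \<open>p + 2 q = c h\<close> and \<open>c h = - p - 2 q\<close>, which forces
    \<open>p = q = 0\<close>.\<close>
  have h0: "m (\<delta> x) y $ 3 = 0" if x: "x $ 3 = 0" and y: "y $ 3 = 0" for x y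
    using arg_cong[OF E1'[OF x y], of "\<lambda>v. v $ 3"] arg_cong[OF E1'[OF y x], of "\<lambda>v. v $ 3"]
      arg_cong[OF E2[OF x y], of "\<lambda>v. v $ 3"] ab[OF x y] ab[OF d3 y, of x] ab[OF d3 x, of y]
    by (auto simp: f1 f2)
  have h3: "m x y $ 3 = 0" if x: "x $ 3 = 0" and y: "y $ 3 = 0" for x y
    using surj[OF x] h0[OF _ y] by metis
  \<comment> \<open>Rule \<open>1\<close> and its version with \<open>x\<close> and \<open>y\<close>
    exchanged show that \<open>m (\<delta> x) y = m x (\<delta> y)\<close>. The resulting factor 3
    is what makes multiplication by \<open>u\<close> vanish in \<open>S11\<close>.\<close>
  have S9: "m (\<delta> x) y + m (\<delta> x) y + m (\<delta> x) y = \<delta> (m x y)" if x: "x $ 3 = 0" and y: "y $ 3 = 0" for x y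
  proof -
    have 1: "m (\<delta> x) y + m (\<delta> x) y = \<delta> (m x y) - m x (\<delta> y)" if "x $ 3 = 0" "y $ 3 = 0" for x y
      using E1'[OF that] S7[OF h3[OF that]] unfolding vec3_comp by (elim conjE, intro conjI; linarith)
    show ?thesis
      using 1[OF x y] 1[OF y x, unfolded ab[OF y x] ab[OF d3 x, of y] ab[OF y d3, of x]]
      unfolding vec3_comp by (elim conjE, intro conjI; linarith)
  qed
  have S10: "4 *\<^sub>R m u x = \<delta> (\<delta> x) - (c * c) *\<^sub>R x" if x: "x $ 3 = 0" for x
  proof -
    have "m (m a a) x = m a (m a x)"
      using S6[OF x] by (simp add: T_def A_def)
    then have 1: "c *\<^sub>R m a x + m u x = m a (m a x)" unfolding maa lin .
    have "m a (m a x + m a x) + m a (m a x + m a x) = \<delta> (\<delta> x + c *\<^sub>R x) + c *\<^sub>R (\<delta> x + c *\<^sub>R x)"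
      unfolding S7[OF x] by (rule S7) (simp add: d3 x)
    then have 2: "4 * m a (m a x) $ i = \<delta> (\<delta> x) $ i + 2 * (c * \<delta> x $ i) + c * c * x $ i" for i
      unfolding lin dl vec_eq_iff by (auto simp: algebra_simps dest!: spec[of _ i])
    have 3: "2 * m a x $ i = \<delta> x $ i + c * x $ i" for i
      using arg_cong[OF S7[OF x], of "\<lambda>v. v $ i"] by simp
    have 4: "m u x $ i = m a (m a x) $ i - c * m a x $ i" for i
      using arg_cong[OF 1, of "\<lambda>v. v $ i"] by simp
    have "4 * m u x $ i = \<delta> (\<delta> x) $ i - c * c * x $ i" for i
    proof -
      have "4 * m u x $ i = 4 * m a (m a x) $ i - 2 * c * (2 * m a x $ i)" using 4[of i] by (simp add: algebra_simps)
      then show ?thesis unfolding 2 3 by (simp add: algebra_simps)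
    qed
    then show ?thesis by (simp add: vec_eq_iff)
  qed
  \<comment> \<open>On the plane, \<open>K = \<delta>\<^sup>2 - c\<^sup>2\<close> is four times
    multiplication by \<open>u\<close> and commutes with \<open>\<delta>\<close>, whereas
    \<open>S9\<close> gives \<open>3 K \<delta> = \<delta> K\<close>. Hence
    \<open>\<delta> K = 0\<close>, and \<open>\<delta>\<close> is injective.\<close>
  have S11: "\<delta> (\<delta> x) = (c * c) *\<^sub>R x" if x: "x $ 3 = 0" for x
  proof -
    have "m u (\<delta> x) + m u (\<delta> x) + m u (\<delta> x) = \<delta> (m u x)"
      using S9[OF x u3] ab[OF d3 u3, of x] ab[OF x u3] by simp
    then have "4 *\<^sub>R m u (\<delta> x) + 4 *\<^sub>R m u (\<delta> x) + 4 *\<^sub>R m u (\<delta> x) = \<delta> (4 *\<^sub>R m u x)"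
      by (metis dl(3) scaleR_add_right)
    then have "\<delta> (\<delta> (\<delta> x)) - (c * c) *\<^sub>R \<delta> x = 0"
      unfolding S10[OF x] S10[OF d3] unfolding dl vec3_comp by (elim conjE, intro conjI; linarith)
    then have "\<delta> (\<delta> (\<delta> x) - (c * c) *\<^sub>R x) = 0" by (simp add: dl)
    then have "\<delta> (\<delta> x) - (c * c) *\<^sub>R x = 0" by (rule inj[rotated]) (simp add: d3 x)
    then show ?thesis by simp
  qed
  have "c \<noteq> 0"
  proof
    assume "c = 0"
    then have "\<delta> (\<delta> e1) = 0" using S11[of e1] by simp
    then have "(e1 :: real ^ 3) = 0" using inj d3 axis3_simps(3) by blast
    then show False by (simp add: axis_eq_0_iff)
  qed
  then show ?thesis using that S11 by blast
qed

section \<open>Classification\<close>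

lemma lie_model_basis:
  assumes M: "lie_model A T br" and b: "bilinear br" and alt: "\<And>x y. br x y = - br y x"
    and ind: "\<And>a b c. a *\<^sub>R u + b *\<^sub>R v + c *\<^sub>R w = 0 \<Longrightarrow> a = 0 \<and> b = 0 \<and> c = 0"
    and c: "br u v = of_basis u v w c12" "br u w = of_basis u v w c13" "br v w = of_basis u v w c23"
  shows "lie_algebra_isomorphic A (bracket3 c12 c13 c23)"
proof -
  have "bij (of_basis u v w)" using ind by (rule bij_of_basis)
  moreover have "br (of_basis u v w x) (of_basis u v w y) =
      of_basis u v w (bracket3 c12 c13 c23 x y)" for x y
    using b alt c by (rule of_basis_bracket)
  ultimately have "lie_model A (T \<circ> of_basis u v w) (bracket3 c12 c13 c23)"
    by (rule lie_model_change_basis[OF M linear_of_basis])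
  then show ?thesis by (rule lie_model_isomorphic)
qed

lemma lie_model_semidirect:
  assumes "lie_group A" "affine_lie_group A"
  obtains T :: "real ^ 3 \<Rightarrow> 'g::{topological_group_add,t2_space,second_countable_topology} field" and c13 c23
  where "lie_model A T (bracket3 0 c13 c23)" "c13 $ 3 = 0" "c23 $ 3 = 0"
proof -
  obtain T br where M: "lie_model A T br" using lie_model_exists[OF assms] by blast
  obtain nab where "left_invariant_affine_structure A nab"
    using assms(2) by (auto simp: affine_lie_group_def)
  then obtain m where m: "left_symmetric m" "\<And>u v. m u v - m v u = br u v"
    using M unfolding lie_model_def by blast
  obtain S c13 c23 where S: "linear S" "bij S" "c13 $ 3 = 0" "c23 $ 3 = 0"
    "\<And>x y. m (S x) (S y) - m (S y) (S x) = S (bracket3 0 c13 c23 x y)"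
    using left_symmetric_abelian_plane[OF m(1)] by blast
  then show ?thesis
    using that lie_model_change_basis[OF M S(1,2)] m(2) by metis
qed

lemma semidirect_complete_novikov:
  assumes M: "lie_model A T (bracket3 0 c13 c23)" and c: "c13 $ 3 = 0" "c23 $ 3 = 0"
  shows "complete_lie_group A" "novikov_lie_group A"
proof -
  \<comment> \<open>\<open>D\<close> is \<open>ad e3\<close>; the sign appears because
    \<open>c13\<close> and \<open>c23\<close> are brackets with \<open>e3\<close> on the
    right.\<close>
  define D where "D y = - (y $ 1 *\<^sub>R c13 + y $ 2 *\<^sub>R c23)" for y :: "real ^ 3"
  define m where "m x y = x $ 3 *\<^sub>R D y" for x y :: "real ^ 3"
  have D3: "D y $ 3 = 0" for y by (simp add: D_def c)
  have b: "bilinear m" by (auto intro!: linearI simp: bilinear_def m_def D_def algebra_simps)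
  have com: "m x y - m y x = bracket3 0 c13 c23 x y" for x y
    by (simp add: m_def D_def bracket3_def algebra_simps)
  have z: "m (m x y) z = 0" for x y z by (simp add: m_def D3)
  have "D (a *\<^sub>R y) = a *\<^sub>R D y" for a y by (simp add: D_def algebra_simps)
  then have "left_symmetric m"
    by (simp add: left_symmetric_def b bilinear_lsub z) (simp add: m_def)
  from lie_model_complete_novikov[OF M this com z] show "complete_lie_group A" "novikov_lie_group A" .
qed

lemma semidirect_radiant:
  assumes M: "lie_model A T (bracket3 0 c13 c23)" and c: "c13 $ 3 = 0" "c23 $ 3 = 0"
  shows "radiant_lie_group A"
proof -
  define D where "D y = - (y $ 1 *\<^sub>R c13 + y $ 2 *\<^sub>R c23)" for y :: "real ^ 3"
  \<comment> \<open>The last term corrects the double count of \<open>e3\<close> in the two before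
    it, so that \<open>m e3 e3 = e3\<close>.\<close>
  define m where "m x y = x $ 3 *\<^sub>R D y + x $ 3 *\<^sub>R y + y $ 3 *\<^sub>R x - (x $ 3 * y $ 3) *\<^sub>R e3" for x y :: "real ^ 3"
  have "bilinear m" by (auto intro!: linearI simp: bilinear_def m_def D_def algebra_simps)
  moreover have com: "m x y - m y x = bracket3 0 c13 c23 x y" for x y
    by (simp add: m_def D_def bracket3_def algebra_simps)
  moreover have "m (m u v - m v u) w = m u (m v w) - m v (m u w)" for u v w
    unfolding com by (simp add: m_def D_def bracket3_def c vec3_eq_iff algebra_simps)
  ultimately have "left_symmetric m" by (simp add: left_symmetric_def)
  moreover have "m x e3 = x" for x by (simp add: m_def D_def)
  ultimately show ?thesis using lie_model_radiant[OF M _ com] by blast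
qed

lemma associative_of_isomorphic:
  fixes br br' :: "'m::euclidean_space \<Rightarrow> 'm \<Rightarrow> 'm"
  assumes M: "lie_model A T br" and iso: "lie_algebra_isomorphic A br'"
    and m: "bilinear m" "\<And>u v. m u v - m v u = br' u v" "\<And>x y z. m (m x y) z = m x (m y z)"
  shows "associative_lie_group A"
  by (rule lie_model_of_isomorphic[OF M iso], rule lie_model_associative[OF _ m])

text \<open>Outside the nilpotent cases an idempotent, \<open>e3\<close> or \<open>e2\<close>,
  produces the bracket: on other basis vectors it acts as a unit from one side and as zero from the
  other. The product for \<open>br_g31\<close> is that of strictly triangular matrices.\<close>

lemma listed_imp_associative:
  fixes br :: "real ^ 3 \<Rightarrow> real ^ 3 \<Rightarrow> real ^ 3"
  assumes M: "lie_model A T br"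
    and "lie_algebra_isomorphic A br_g34m1 \<or> lie_algebra_isomorphic A br_g33 \<or>
         lie_algebra_isomorphic A br_g31 \<or> lie_algebra_isomorphic A br_2g21_g1 \<or>
         lie_algebra_isomorphic A br_3g1"
  shows "associative_lie_group A"
  using assms(2)
proof (elim disjE)
  assume "lie_algebra_isomorphic A br_g34m1"
  then show ?thesis
    by (rule associative_of_isomorphic[OF M, where m = "\<lambda>x y. (x $ 1 * y $ 3) *\<^sub>R e1 + (x $ 3 * y $ 2) *\<^sub>R e2 + (x $ 3 * y $ 3) *\<^sub>R e3"])
      (auto intro!: linearI simp: bilinear_def br_g34m1_def bracket3_def vec3_eq_iff algebra_simps)
next
  assume "lie_algebra_isomorphic A br_g33"
  then show ?thesis
    by (rule associative_of_isomorphic[OF M, where m = "\<lambda>x y. y $ 3 *\<^sub>R x"])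
      (auto intro!: linearI simp: bilinear_def br_g33_def bracket3_def vec3_eq_iff algebra_simps)
next
  assume "lie_algebra_isomorphic A br_g31"
  then show ?thesis
    by (rule associative_of_isomorphic[OF M, where m = "\<lambda>x y. (x $ 1 * y $ 2) *\<^sub>R e3"])
      (auto intro!: linearI simp: bilinear_def br_g31_def bracket3_def vec3_eq_iff algebra_simps)
next
  assume "lie_algebra_isomorphic A br_2g21_g1"
  then show ?thesis
    by (rule associative_of_isomorphic[OF M, where m = "\<lambda>x y. y $ 2 *\<^sub>R (x $ 1 *\<^sub>R e1 + x $ 2 *\<^sub>R e2)"])
      (auto intro!: linearI simp: bilinear_def br_2g21_g1_def bracket3_def vec3_eq_iff algebra_simps)
next
  assume "lie_algebra_isomorphic A br_3g1"
  then show ?thesis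
    by (rule associative_of_isomorphic[OF M, where m = "\<lambda>x y. 0"])
      (auto intro!: linearI simp: bilinear_def br_3g1_def bracket3_def)
qed

text \<open>The cases follow the normal form of \<open>\<delta>\<close> on the plane. If it is
  invertible, its square is \<open>k\<^sup>2\<close>, so it is diagonalizable with eigenvalues among
  \<open>k\<close> and \<open>- k\<close>: equal ones give \<open>br_g33\<close>, opposite ones
  \<open>br_g34m1\<close>. If it is singular, it is zero, nilpotent, or has one nonzero eigenvalue,
  which gives \<open>br_3g1\<close>, \<open>br_g31\<close> and \<open>br_2g21_g1\<close>.\<close>

lemma bisymmetric_imp_listed:
  assumes M: "lie_model A T (bracket3 0 c13 c23)" and c: "c13 $ 3 = 0" "c23 $ 3 = 0"
    and bi: "bisymmetric_lie_group A"
  shows "lie_algebra_isomorphic A br_g34m1 \<or> lie_algebra_isomorphic A br_g33 \<or>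
         lie_algebra_isomorphic A br_g31 \<or> lie_algebra_isomorphic A br_2g21_g1 \<or>
         lie_algebra_isomorphic A br_3g1"
proof -
  define br where "br = bracket3 0 c13 c23"
  define \<delta> where "\<delta> = br e3"
  have bb: "bilinear br" unfolding br_def by (rule bilinear_bracket3)
  have alt: "br x y = - br y x" for x y unfolding br_def by (rule bracket3_alternating)
  note basis = lie_model_basis[OF M, folded br_def, OF bb alt]
  have ld: "linear \<delta>" using bb by (simp add: \<delta>_def bilinear_def)
  note dl = linear_add[OF ld] linear_diff[OF ld] linear_scale[OF ld] linear_neg[OF ld] linear_0[OF ld]
  have \<delta>_eq: "\<delta> x = - (x $ 1 *\<^sub>R c13 + x $ 2 *\<^sub>R c23)" for x
    by (simp add: \<delta>_def br_def bracket3_def)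
  have d3: "\<delta> x $ 3 = 0" for x by (simp add: \<delta>_eq c)
  have br0: "br x y = 0" if "x $ 3 = 0" "y $ 3 = 0" for x y
    using that by (simp add: br_def bracket3_def)
  have bre: "br e3 x = \<delta> x" "br x e3 = - \<delta> x" for x
    using alt[of x e3] by (simp_all add: \<delta>_def)
  note bl = bilinear_lmul[OF bb] bilinear_rmul[OF bb] bilinear_lneg[OF bb] bilinear_rneg[OF bb]
  \<comment> \<open>The basis is completed by \<open>- e3 / s\<close>: the scaling normalizes the
    eigenvalues, and the sign accounts for \<open>e3\<close> standing on the right in the target
    brackets.\<close>
  have sp: "lie_algebra_isomorphic A (bracket3 0 (k *\<^sub>R e1) (l *\<^sub>R e2))"
    if x: "x $ 3 = 0" "\<delta> x = (k * s) *\<^sub>R x" and y: "y $ 3 = 0" "\<delta> y = (l * s) *\<^sub>R y" and s: "s \<noteq> 0"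
      and ind: "\<And>a b. a *\<^sub>R x + b *\<^sub>R y = 0 \<Longrightarrow> a = 0 \<and> b = 0" for x y k l s
  proof (rule basis[of x y "- inverse s *\<^sub>R e3"])
    fix a b c assume z: "a *\<^sub>R x + b *\<^sub>R y + c *\<^sub>R (- inverse s *\<^sub>R e3) = 0"
    have "c = 0" using arg_cong[OF z, of "\<lambda>v. v $ 3"] x y s by simp
    with z ind show "a = 0 \<and> b = 0 \<and> c = 0" by simp
  next
    show "br x y = of_basis x y (- inverse s *\<^sub>R e3) 0" using br0 x y by simp
  next
    show "br x (- inverse s *\<^sub>R e3) = of_basis x y (- inverse s *\<^sub>R e3) (k *\<^sub>R e1)"
      using s by (simp add: bl bre x of_basis_def)
    show "br y (- inverse s *\<^sub>R e3) = of_basis x y (- inverse s *\<^sub>R e3) (l *\<^sub>R e2)"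
      using s by (simp add: bl bre y of_basis_def)
  qed
  show ?thesis
  proof (cases "c13 $ 1 * c23 $ 2 - c13 $ 2 * c23 $ 1 = 0")
    case False
    obtain m where m: "left_symmetric m" "\<And>u v. m u v - m v u = bracket3 0 c13 c23 u v"
      "\<And>x y z. m (m x y) z - m x (m y z) = m (m x z) y - m x (m z y)"
      using lie_model_bisymmetric[OF M bi] by blast
    obtain k where k: "k \<noteq> 0" "\<And>x. x $ 3 = 0 \<Longrightarrow> \<delta> (\<delta> x) = (k * k) *\<^sub>R x"
      using bisymmetric_derivation_square[OF m(1,3,2) c False] unfolding \<delta>_def br_def by blast
    show ?thesis
    proof (cases "\<exists>s. s \<noteq> 0 \<and> (\<forall>x. x $ 3 = 0 \<longrightarrow> \<delta> x = s *\<^sub>R x)")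
      case True
      then obtain s where s: "s \<noteq> 0" "\<And>x. x $ 3 = 0 \<Longrightarrow> \<delta> x = s *\<^sub>R x" by blast
      have "lie_algebra_isomorphic A (bracket3 0 (1 *\<^sub>R e1) (1 *\<^sub>R e2))"
        by (rule sp[of e1 1 s e2 1]) (use s in \<open>auto simp: vec3_eq_iff\<close>)
      then show ?thesis by (simp add: br_g33_def)
    next
      case False
      \<comment> \<open>\<open>\<delta>\<close> is neither \<open>k\<close> nor \<open>- k\<close>
        on the plane. Since \<open>(\<delta> - k) (\<delta> + k) = 0\<close> there, the vectors
        \<open>f\<close> and \<open>g\<close> below are eigenvectors for \<open>k\<close> and
        \<open>- k\<close>.\<close>
      then obtain x y where x: "x $ 3 = 0" "\<delta> x \<noteq> k *\<^sub>R x" and y: "y $ 3 = 0" "\<delta> y \<noteq> (- k) *\<^sub>R y"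
        using k(1) by (metis neg_equal_0_iff_equal)
      define f g where "f = \<delta> y + k *\<^sub>R y" and "g = \<delta> x - k *\<^sub>R x"
      have fg: "f \<noteq> 0" "g \<noteq> 0" using x y by (auto simp: f_def g_def eq_neg_iff_add_eq_0)
      have df: "\<delta> f = k *\<^sub>R f" "\<delta> g = - (k *\<^sub>R g)"
        unfolding f_def g_def dl k(2)[OF x(1)] k(2)[OF y(1)] by (simp_all add: algebra_simps)
      have "lie_algebra_isomorphic A (bracket3 0 (1 *\<^sub>R e1) ((- 1) *\<^sub>R e2))"
      proof (rule sp[of f 1 k g "- 1"])
        fix a b assume z: "a *\<^sub>R f + b *\<^sub>R g = 0"
        have "k *\<^sub>R (a *\<^sub>R f - b *\<^sub>R g) = \<delta> (a *\<^sub>R f + b *\<^sub>R g)"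
          by (simp add: dl df algebra_simps)
        then have "a *\<^sub>R f - b *\<^sub>R g = 0" using k(1) by (simp add: z dl)
        then have "a *\<^sub>R f = 0" "b *\<^sub>R g = 0" using z unfolding vec_eq_iff by (auto simp: algebra_simps)
        then show "a = 0 \<and> b = 0" using fg by simp
      qed (use x y df k in \<open>simp_all add: f_def g_def d3\<close>)
      then show ?thesis by (simp add: br_g34m1_def)
    qed
  next
    case True
    define t where "t = - (c13 $ 1 + c23 $ 2)"
    \<comment> \<open>Cayley-Hamilton in the plane with determinant zero; \<open>t\<close> is the
      trace of \<open>\<delta>\<close>.\<close>
    have ch: "\<delta> (\<delta> x) = t *\<^sub>R \<delta> x" for x
    proof -
      have "\<delta> (\<delta> x) - t *\<^sub>R \<delta> x = (- (c13 $ 1 * c23 $ 2 - c13 $ 2 * c23 $ 1)) *\<^sub>R (x $ 1 *\<^sub>R e1 + x $ 2 *\<^sub>R e2)"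
        by (simp add: \<delta>_eq t_def vec3_eq_iff c algebra_simps)
      then show ?thesis by (simp add: True)
    qed
    show ?thesis
    proof (cases "\<forall>x. \<delta> x = 0")
      case True
      have "c13 = 0" "c23 = 0" using True[rule_format, of e1] True[rule_format, of e2] by (simp_all add: \<delta>_eq)
      then show ?thesis using lie_model_isomorphic[OF M] by (simp add: br_3g1_def)
    next
      case False
      then obtain x where x: "\<delta> x \<noteq> 0" by blast
      define y where "y = x - x $ 3 *\<^sub>R e3"
      define z where "z = \<delta> y"
      have y: "y $ 3 = 0" by (simp add: y_def)
      have z: "z $ 3 = 0" "z \<noteq> 0" using x by (simp_all add: z_def d3) (simp add: y_def \<delta>_eq)
      have dz: "\<delta> z = t *\<^sub>R z" unfolding z_def by (rule ch)
      show ?thesis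
      proof (cases "t = 0")
        case t: True
        have "lie_algebra_isomorphic A (bracket3 e3 0 0)"
        proof (rule basis[of e3 y z])
          fix a b c assume s: "a *\<^sub>R e3 + b *\<^sub>R y + c *\<^sub>R z = 0"
          have a: "a = 0" using arg_cong[OF s, of "\<lambda>v. v $ 3"] y z by simp
          have "b *\<^sub>R z = \<delta> (b *\<^sub>R y + c *\<^sub>R z)" by (simp add: dl dz t z_def[symmetric])
          also have "b *\<^sub>R y + c *\<^sub>R z = 0" using s a by simp
          finally have "b = 0" using z by (simp add: dl)
          then show "a = 0 \<and> b = 0 \<and> c = 0" using s a z by simp
        qed (use y z in \<open>simp_all add: bre br0 dz t z_def[symmetric]\<close>)
        then show ?thesis by (simp add: br_g31_def)
      next
        case t: False
        \<comment> \<open>Otherwise \<open>\<delta>\<close> would be \<open>t\<close> on the plane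
          and have trace \<open>2 t\<close>.\<close>
        have "\<exists>w. w $ 3 = 0 \<and> \<delta> w \<noteq> t *\<^sub>R w"
        proof (rule ccontr)
          assume "\<not> ?thesis"
          then have e: "\<delta> w = t *\<^sub>R w" if "w $ 3 = 0" for w using that by blast
          have "\<delta> e1 $ 1 + \<delta> e2 $ 2 = t" by (simp add: \<delta>_eq t_def)
          moreover have "\<delta> e1 $ 1 = t" unfolding e[OF axis3_simps(3)] by simp
          moreover have "\<delta> e2 $ 2 = t" unfolding e[OF axis3_simps(6)] by simp
          ultimately show False using t by simp
        qed
        then obtain w where w: "w $ 3 = 0" "\<delta> w \<noteq> t *\<^sub>R w" by blast
        define k where "k = \<delta> w - t *\<^sub>R w"
        have k: "k $ 3 = 0" "k \<noteq> 0" "\<delta> k = 0" using w by (simp_all add: k_def d3 dl ch)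
        have "lie_algebra_isomorphic A (bracket3 e1 0 0)"
        \<comment> \<open>\<open>z\<close> and \<open>k\<close> span the image and the kernel of
          \<open>\<delta>\<close> in the plane: the bracket of \<open>z\<close> with
          \<open>- e3 / t\<close> is \<open>z\<close>, and \<open>k\<close> is central.\<close>
        proof (rule basis[of z "- inverse t *\<^sub>R e3" k])
          fix a b c assume s: "a *\<^sub>R z + b *\<^sub>R (- inverse t *\<^sub>R e3) + c *\<^sub>R k = 0"
          have b: "b = 0" using arg_cong[OF s, of "\<lambda>v. v $ 3"] k z t by simp
          have "a *\<^sub>R (t *\<^sub>R z) = \<delta> (a *\<^sub>R z + c *\<^sub>R k)" by (simp add: dl dz k)
          also have "a *\<^sub>R z + c *\<^sub>R k = 0" using s b by simp
          finally have "a = 0" using z t by (simp add: dl)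
          then show "a = 0 \<and> b = 0 \<and> c = 0" using s b k by simp
        qed (use z k t in \<open>simp_all add: bl bre br0 dz\<close>)
        then show ?thesis by (simp add: br_2g21_g1_def)
      qed
    qed
  qed
qed

theorem theorem1:
  fixes A :: "('g::{topological_group_add,t2_space,second_countable_topology}, real ^ 3) atlas"
  assumes "lie_group A"
    and "connected (UNIV :: 'g set)"
    and "simply_connected (UNIV :: 'g set)"
    and "affine_lie_group A"
  shows "complete_lie_group A
    \<and> novikov_lie_group A
    \<and> radiant_lie_group A
    \<and> (associative_lie_group A \<longleftrightarrow>
         lie_algebra_isomorphic A br_g34m1 \<or> lie_algebra_isomorphic A br_g33 \<or>
         lie_algebra_isomorphic A br_g31 \<or> lie_algebra_isomorphic A br_2g21_g1 \<or>
         lie_algebra_isomorphic A br_3g1)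
    \<and> (bisymmetric_lie_group A \<longleftrightarrow>
         lie_algebra_isomorphic A br_g34m1 \<or> lie_algebra_isomorphic A br_g33 \<or>
         lie_algebra_isomorphic A br_g31 \<or> lie_algebra_isomorphic A br_2g21_g1 \<or>
         lie_algebra_isomorphic A br_3g1)"
proof -
  obtain T c13 c23 where M: "lie_model A T (bracket3 0 c13 c23)" and c: "c13 $ 3 = 0" "c23 $ 3 = 0"
    using lie_model_semidirect[OF assms(1,4)] by blast
  show ?thesis
    using semidirect_complete_novikov[OF M c] semidirect_radiant[OF M c] bisymmetric_imp_listed[OF M c]
      listed_imp_associative[OF M] associative_imp_bisymmetric[of A] by blast
qed

end
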